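(* Let $\mu$ be a real-analytic function on a neighborhood $\mathcal N$ of $0$ with $\mu(0)=0$, $\mu'(0)>0$ and $\mu(t)=0\Leftrightarrow t=0$ in $\mathcal N$. Let $I_+\subset\mathcal N$ be a compact interval within $t>0$ and let $\lambda(t)=i\sqrt{\mu(t)}$. Then there exists an $\epsilon_0>0$ such that for all $0\le\epsilon\le\epsilon_0$ the following holds. There exists a transformation $(u,v,t)\mapsto(x,y)$, which is analytic in $t\in I_+$, Gevrey-1 with respect to $\epsilon$ uniformly in $t\in I_+$, and a linear isomorphism in $(u,v)$ for fixed $t\in I_+$, such that the system $$\dot x=y,\qquad\dot y=-\mu(t)x,\qquad\dot t=\epsilon$$ becomes $$\dot u=\nu(t,\epsilon)u,\qquad\dot v=\overline\nu(t,\epsilon)v,\qquad\dot t=\epsilon,$$ with $$\nu(t,\epsilon)=\lambda(t)f(t,\epsilon)-\epsilon\lambda(t)^{-1}\lambda'(t)$$ for some function $f$, where $\nu$ is also analytic in $t$ and uniformly Gevrey-1 with respect to $\epsilon$, and satisfies $$\nu(t,\epsilon)=\lambda(t)-\frac12\lambda(t)^{-1}\lambda'(t)\epsilon+\epsilon^2T_2(t,\epsilon)$$ for some $T_2$ with identical analytic properties (analytic in $t$, uniformly Gevrey-1 with respect to $\epsilon$).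
   Context: $\overline\nu$ denotes the complex conjugate (for real $t,\epsilon$). Gevrey-1: for $\theta\in(0,2\pi)$ let $S_\theta=\{z\in\mathbb C:0\le|\arg z|<\theta/2\}$ be the sector of opening $\theta$ centered on the positive real axis. An analytic function $h$ on $S_\theta$ (intersected with a small disc around $0$), extending continuously to $z=0$ with $h(0)=0$, is Gevrey-1 with respect to $z\in S_\theta$ if there are $\{h_n\}_{n\in\mathbb N}\subset\mathbb C$, $a>0$, $b>0$ such that $|h(z)-\sum_{n=1}^{N-1}h_nz^n|\le a\,b^N N!\,|z|^N$ for all $N$ and all $z$ in the domain; if $h(0)\neq0$ the definition is applied to $h-h(0)$. A function $h(t,z)$ is Gevrey-1 in $z$ uniformly in $t$ if the $h_n$ are analytic functions of $t$ (on a domain containing the interval considered) and $a,b$ can be chosen independent of $t$. A function of real $\epsilon\in[0,\epsilon_0]$ is Gevrey-1 if it extends to such a function for some $\theta$; the opening $\theta$ is not specified.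
   Formalization: The neighborhood N of 0 is taken to be open and connected (an open interval); for a disconnected N, μ could be negative on the part containing I_+, where λ would be real and the claim false. *)

theory Defs
  imports "HOL-Complex_Analysis.Complex_Analysis"
begin

definition real_analytic_on :: "(real \<Rightarrow> real) \<Rightarrow> real set \<Rightarrow> bool" where
  "real_analytic_on g S \<longleftrightarrow>
     (\<forall>x\<in>S. \<exists>r>0. \<exists>c :: nat \<Rightarrow> real. \<forall>y. \<bar>y - x\<bar> < r \<longrightarrow> (\<lambda>n. c n * (y - x) ^ n) sums g y)"

text \<open>The sector \<open>S\<^sub>\<theta>\<close> does not contain its vertex; in HOL \<open>Arg 0 = 0\<close>, so the origin has to be
  removed explicitly.\<close>

definition sector :: "real \<Rightarrow> complex set" where
  "sector \<theta> = {z. z \<noteq> 0 \<and> \<bar>Arg z\<bar> < \<theta> / 2}"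

text \<open>The Gevrey-1 estimate on \<open>Z\<close> for \<open>h - h 0\<close>, with coefficients \<open>c\<close> (\<open>c 0\<close> is unused). The case
  \<open>N = 0\<close> only adds boundedness, which on a bounded \<open>Z\<close> follows from the case \<open>N = 1\<close> after
  enlarging \<open>A\<close>.\<close>

definition gevrey1_bound ::
  "complex set \<Rightarrow> (nat \<Rightarrow> complex) \<Rightarrow> real \<Rightarrow> real \<Rightarrow> (complex \<Rightarrow> complex) \<Rightarrow> bool" where
  "gevrey1_bound Z c A B h \<longleftrightarrow>
     (\<forall>N::nat. \<forall>z\<in>Z. norm (h z - h 0 - (\<Sum>n=1..<N. c n * z ^ n)) \<le> A * B ^ N * fact N * norm z ^ N)"

text \<open>A function \<open>h\<close> of real \<open>t \<in> I\<close> and real \<open>\<epsilon> \<in> {0..e}\<close> is analytic in \<open>t\<close> and Gevrey-1 in \<open>\<epsilon>\<close>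
  uniformly in \<open>t\<close>: it has an extension \<open>H\<close> to complex \<open>t\<close> in a domain \<open>D\<close> around \<open>I\<close> and to \<open>\<epsilon>\<close> in
  some sector of some disc of radius \<open>r > e\<close> (vertex included by continuity), with the opening
  \<open>\<theta>\<close>, the domain \<open>D\<close> and the constants \<open>A\<close>, \<open>B\<close> independent of \<open>t\<close> and \<open>\<epsilon>\<close>.\<close>

definition analytic_unif_gevrey1 ::
  "real set \<Rightarrow> real \<Rightarrow> (real \<Rightarrow> real \<Rightarrow> complex) \<Rightarrow> bool" where
  "analytic_unif_gevrey1 I e h \<longleftrightarrow>
     (\<exists>(H :: complex \<Rightarrow> complex \<Rightarrow> complex) D \<theta> r (c :: nat \<Rightarrow> complex \<Rightarrow> complex) A B.
        open D \<and> connected D \<and> complex_of_real ` I \<subseteq> D \<and>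
        0 < \<theta> \<and> \<theta> < 2 * pi \<and> e < r \<and> 0 < A \<and> 0 < B \<and>
        (\<forall>t\<in>I. \<forall>\<epsilon>\<in>{0..e}. H (complex_of_real t) (complex_of_real \<epsilon>) = h t \<epsilon>) \<and>
        (\<forall>z \<in> insert 0 (sector \<theta> \<inter> ball 0 r). (\<lambda>t. H t z) holomorphic_on D) \<and>
        (\<forall>n\<ge>1. c n holomorphic_on D) \<and>
        (\<forall>t\<in>D. H t holomorphic_on (sector \<theta> \<inter> ball 0 r) \<and>
                continuous_on (insert 0 (sector \<theta> \<inter> ball 0 r)) (H t) \<and>
                gevrey1_bound (sector \<theta> \<inter> ball 0 r) (\<lambda>n. c n t) A B (H t)))"

definition lam :: "(real \<Rightarrow> real) \<Rightarrow> real \<Rightarrow> complex" where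
  "lam \<mu> t = \<i> * complex_of_real (sqrt (\<mu> t))"

abbreviation lam' :: "(real \<Rightarrow> real) \<Rightarrow> real \<Rightarrow> complex" where
  "lam' \<mu> t \<equiv> vector_derivative (lam \<mu>) (at t)"

text \<open>Solution curves, parametrised by a time interval \<open>J\<close>; derivatives are one-sided at end points
  of \<open>J\<close> that belong to \<open>J\<close>.\<close>

definition solves_xy ::
  "(real \<Rightarrow> real) \<Rightarrow> real \<Rightarrow> real set \<Rightarrow> (real \<Rightarrow> complex) \<Rightarrow> (real \<Rightarrow> complex) \<Rightarrow> (real \<Rightarrow> real) \<Rightarrow> bool" where
  "solves_xy \<mu> \<epsilon> J x y \<tau> \<longleftrightarrow> (\<forall>s\<in>J.
      (x has_vector_derivative y s) (at s within J) \<and>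
      (y has_vector_derivative - complex_of_real (\<mu> (\<tau> s)) * x s) (at s within J) \<and>
      (\<tau> has_vector_derivative \<epsilon>) (at s within J))"

definition solves_uv ::
  "(real \<Rightarrow> real \<Rightarrow> complex) \<Rightarrow> real \<Rightarrow> real set \<Rightarrow> (real \<Rightarrow> complex) \<Rightarrow> (real \<Rightarrow> complex) \<Rightarrow> (real \<Rightarrow> real) \<Rightarrow> bool" where
  "solves_uv \<nu> \<epsilon> J u v \<tau> \<longleftrightarrow> (\<forall>s\<in>J.
      (u has_vector_derivative \<nu> (\<tau> s) \<epsilon> * u s) (at s within J) \<and>
      (v has_vector_derivative cnj (\<nu> (\<tau> s) \<epsilon>) * v s) (at s within J) \<and>
      (\<tau> has_vector_derivative \<epsilon>) (at s within J))"

text \<open>The transformation \<open>(u, v, t) \<mapsto> (x, y)\<close> given by \<open>\<Phi>\<close> (at the parameter value \<open>\<epsilon>\<close>) turns the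
  first system into the second one over \<open>I\<close>: as long as \<open>t\<close> stays in \<open>I\<close>, a curve solves one system
  iff its transform solves the other. Together with bijectivity of \<open>\<Phi> t \<epsilon>\<close>
  this makes the solutions of the two systems correspond one-to-one.\<close>

definition transforms_system ::
  "(real \<Rightarrow> real) \<Rightarrow> (real \<Rightarrow> real \<Rightarrow> complex) \<Rightarrow> real set \<Rightarrow> real
     \<Rightarrow> (real \<Rightarrow> real \<Rightarrow> complex ^ 2 \<Rightarrow> complex ^ 2) \<Rightarrow> bool" where
  "transforms_system \<mu> \<nu> I \<epsilon> \<Phi> \<longleftrightarrow>
     (\<forall>J u v \<tau>. is_interval J \<and> \<tau> ` J \<subseteq> I \<longrightarrow>
        (solves_uv \<nu> \<epsilon> J u v \<tau> \<longleftrightarrow>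
         solves_xy \<mu> \<epsilon> J (\<lambda>s. \<Phi> (\<tau> s) \<epsilon> (vector [u s, v s]) $ 1)
                         (\<lambda>s. \<Phi> (\<tau> s) \<epsilon> (vector [u s, v s]) $ 2) \<tau>))"

end

theory Submission
  imports Defs
begin

text \<open>
  If \<open>\<nu>\<close> solves the Riccati equation \<open>\<epsilon> \<nu>' + \<nu>\<^sup>2 + \<mu> = 0\<close>, then \<open>y = \<nu> x\<close> is invariant under the system
  \<open>x' = y\<close>, \<open>y' = - \<mu> x\<close>, \<open>t' = \<epsilon>\<close>, and so is \<open>y = cnj \<nu> x\<close>, because \<open>\<mu>\<close> is real. Where \<open>\<nu>\<close> is not real,
  \<open>x = u + v\<close>, \<open>y = \<nu> u + cnj \<nu> v\<close> therefore diagonalises the system (\<open>transforms_system_riccati\<close>).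
  Inserting a power series shows that \<open>\<nu>\<close> must begin with \<open>\<lambda> - \<epsilon> \<lambda>' / (2 \<lambda>)\<close>. What has to be proved is
  that there is a true solution \<open>\<nu>\<close>, holomorphic near the interval and Gevrey-1 in \<open>\<epsilon>\<close>.

  Extend \<open>\<mu>\<close> to a holomorphic function and use \<open>x = \<integral> \<surd>\<mu>\<close> as a new variable. Writing
  \<open>\<nu> = \<surd>\<mu> (\<i> + \<epsilon> p)\<close>, the equation becomes \<open>p' = - (2 \<i> / \<epsilon>) p - p\<^sup>2 - k p - \<i> k / \<epsilon>\<close> with a holomorphic
  function \<open>k\<close>. For a fixed direction of \<open>\<epsilon>\<close>, integrate from a base point such that the
  exponential \<open>exp (2 \<i> (s - x) / \<epsilon>)\<close> decays along the segments from the end point \<open>x\<close> back to the base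
  point; then Picard iteration gives a bounded solution (\<open>riccati_solution\<close>). With the four corners of
  a rectangle around the interval as base points, the directions of \<open>\<epsilon>\<close> in four overlapping
  sectors, which together cover the punctured plane, are all served, for the same set of \<open>x\<close>.

  Where two of these sectors overlap, the two solutions satisfy the same equation, and their difference
  is \<open>O(exp (- c / |\<epsilon>|))\<close> (\<open>riccati_difference_exp_small\<close>). Cauchy's formula over four triangles around
  \<open>\<epsilon> = 0\<close> expresses the solution in the sector about the positive axis by integrals of these
  differences along rays ending at 0, and by integrals that stay away from 0. Expanding the Cauchy
  kernel in a geometric series yields a Gevrey-1 expansion, uniform in \<open>x\<close> and with
  holomorphic coefficients (\<open>cauchy_integral_gevrey\<close>, \<open>four_triangles_gevrey\<close>). No formal power series
  solution has to be estimated. The first two coefficients are read off from the equation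
  (\<open>riccati_gevrey_solution\<close>), and \<open>T\<^sub>2\<close> is the remainder after them, divided by \<open>\<epsilon>\<^sup>2\<close>.
\<close>

section \<open>Contour integrals depending on a parameter\<close>

lemma continuous_on_contour_integral_param:
  assumes "continuous_on (S \<times> closed_segment a b) (\<lambda>(x, \<zeta>). G x \<zeta>)"
  shows "continuous_on S (\<lambda>x. contour_integral (linepath a b) (G x))"
proof -
  have "continuous_on (S \<times> cbox 0 (1::real)) (\<lambda>(x, t). G x (linepath a b t) * (b - a))"
  proof -
    have "continuous_on (S \<times> cbox 0 (1::real)) (\<lambda>y. (\<lambda>(x, \<zeta>). G x \<zeta>) (fst y, linepath a b (snd y)))"
      by (rule continuous_on_compose2[OF assms])
         (auto intro!: continuous_intros simp: linepath_def in_segment mem_Times_iff)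
    then show ?thesis
      by (auto simp: case_prod_beta intro!: continuous_intros)
  qed
  from integral_continuous_on_param[OF this] show ?thesis
    by (simp add: contour_integral_integral)
qed

text \<open>Morera: the triangle integrals vanish after exchanging the two integrations.\<close>

lemma holomorphic_on_contour_integral_param:
  assumes "open U" and G: "continuous_on (U \<times> closed_segment a b) (\<lambda>(x, \<zeta>). G x \<zeta>)"
    and hol: "\<And>\<zeta>. \<zeta> \<in> closed_segment a b \<Longrightarrow> (\<lambda>x. G x \<zeta>) holomorphic_on U"
  shows "(\<lambda>x. contour_integral (linepath a b) (G x)) holomorphic_on U"
proof (rule analytic_imp_holomorphic)
  show "(\<lambda>x. contour_integral (linepath a b) (G x)) analytic_on U"
  proof (rule Morera_triangle)
  show "continuous_on U (\<lambda>x. contour_integral (linepath a b) (G x))"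
    by (rule continuous_on_contour_integral_param[OF G])
  show "open U" by fact
  fix p q r :: complex
  let ?I = "\<lambda>p q. contour_integral (linepath p q) (\<lambda>x. contour_integral (linepath a b) (G x))"
  let ?K = "\<lambda>p q \<zeta>. contour_integral (linepath p q) (\<lambda>x. G x \<zeta>)"
  show "convex hull {p, q, r} \<subseteq> U \<longrightarrow> ?I p q + ?I q r + ?I r p = 0"
  proof
    assume sub: "convex hull {p, q, r} \<subseteq> U"
    then have seg: "closed_segment p q \<subseteq> U" "closed_segment q r \<subseteq> U" "closed_segment r p \<subseteq> U"
      by (auto simp: segment_convex_hull intro!: order_trans[OF hull_mono sub])
    have swap: "?I p q = contour_integral (linepath a b) (?K p q)"
      if "closed_segment p q \<subseteq> U" for p q
    proof (rule contour_integral_swap)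
      show "continuous_on (path_image (linepath p q) \<times> path_image (linepath a b)) (\<lambda>(y1, y2). G y1 y2)"
        by (rule continuous_on_subset[OF G]) (use that in auto)
    qed (auto simp: vector_derivative_linepath_at)
    have integ: "?K p q contour_integrable_on linepath a b"
      if "closed_segment p q \<subseteq> U" for p q
    proof (rule contour_integrable_continuous_linepath, rule continuous_on_contour_integral_param)
      have "continuous_on (closed_segment a b \<times> closed_segment p q) (\<lambda>y. (\<lambda>(x, \<zeta>). G x \<zeta>) (snd y, fst y))"
        by (rule continuous_on_compose2[OF G]) (use that in \<open>auto intro!: continuous_intros\<close>)
      then show "continuous_on (closed_segment a b \<times> closed_segment p q) (\<lambda>(\<zeta>, x). G x \<zeta>)"
        by (simp add: case_prod_beta)
    qed
    have "?I p q + ?I q r + ?I r p = contour_integral (linepath a b) (\<lambda>\<zeta>. ?K p q \<zeta> + ?K q r \<zeta> + ?K r p \<zeta>)"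
      unfolding swap[OF seg(1)] swap[OF seg(2)] swap[OF seg(3)]
        contour_integral_add[OF contour_integrable_add[OF integ[OF seg(1)] integ[OF seg(2)]] integ[OF seg(3)]]
        contour_integral_add[OF integ[OF seg(1)] integ[OF seg(2)]] ..
    also have "\<dots> = contour_integral (linepath a b) (\<lambda>_. 0)"
    proof (rule contour_integral_cong)
      fix \<zeta> assume "\<zeta> \<in> path_image (linepath a b)"
      then have h: "(\<lambda>x. G x \<zeta>) holomorphic_on convex hull {p, q, r}"
        using hol holomorphic_on_subset sub by auto
      have "((\<lambda>x. G x \<zeta>) has_contour_integral 0) (linepath p q +++ linepath q r +++ linepath r p)"
        by (rule Cauchy_theorem_triangle[OF h])
      then show "?K p q \<zeta> + ?K q r \<zeta> + ?K r p \<zeta> = 0"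
        by (rule has_chain_integral_chain_integral3)
    qed auto
    finally show "?I p q + ?I q r + ?I r p = 0" by simp
  qed
qed


qed

section \<open>Bounded solutions of the Riccati equation\<close>

text \<open>The solution, vanishing at \<open>b\<close>, of the linear equation \<open>p' = - (2 \<i> / e) p + F\<close>.\<close>

definition wkb_integral :: "complex \<Rightarrow> (complex \<Rightarrow> complex \<Rightarrow> complex) \<Rightarrow> complex \<Rightarrow> complex \<Rightarrow> complex" where
  "wkb_integral b F x e = contour_integral (linepath b x) (\<lambda>s. exp (2 * \<i> * (s - x) / e) * F s e)"

text \<open>Continuity is needed in both variables jointly, since later the solutions are integrated over
  the parameter \<open>e\<close> and the integrals must be holomorphic in \<open>x\<close>.\<close>

lemma continuous_on_wkb_integral:
  assumes "convex R" "b \<in> R" and F: "continuous_on (R \<times> - {0}) (\<lambda>(x, e). F x e)"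
  shows "continuous_on (R \<times> - {0}) (\<lambda>(x, e). wkb_integral b F x e)"
proof -
  have seg: "(1 - t) *\<^sub>R b + t *\<^sub>R x \<in> R" if "x \<in> R" "0 \<le> t" "t \<le> 1" for x t
    using assms that by (simp add: convexD_alt)
  have "continuous_on ((R \<times> - {0}) \<times> cbox 0 (1::real))
          (\<lambda>(y, t). exp (2 * \<i> * (linepath b (fst y) t - fst y) / snd y)
                     * F (linepath b (fst y) t) (snd y) * (fst y - b))"
  proof -
    have "continuous_on ((R \<times> - {0}) \<times> cbox 0 (1::real))
           (\<lambda>y. (\<lambda>(x, e). F x e) (linepath b (fst (fst y)) (snd y), snd (fst y)))"
      by (rule continuous_on_compose2[OF F])
         (auto intro!: continuous_intros seg simp: linepath_def[abs_def] )
    then show ?thesis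
      unfolding case_prod_beta
      by (intro continuous_intros) (auto intro!: continuous_intros simp: linepath_def)
  qed
  from integral_continuous_on_param[OF this] show ?thesis
    by (simp add: contour_integral_integral wkb_integral_def[abs_def] case_prod_beta)
qed

lemma wkb_integral_has_derivative:
  assumes "open R" "convex R" "b \<in> R" "x \<in> R" "e \<noteq> 0" and F: "(\<lambda>x. F x e) holomorphic_on R"
  shows "((\<lambda>x. wkb_integral b F x e) has_field_derivative F x e - 2 * \<i> / e * wkb_integral b F x e) (at x)"
proof -
  define G where "G = (\<lambda>s. exp (2 * \<i> * s / e) * F s e)"
  have G: "G holomorphic_on R"
    unfolding G_def by (intro holomorphic_intros F) (use assms in auto)
  have prim: "((\<lambda>x. contour_integral (linepath b x) G) has_field_derivative G x) (at x)"
  proof (rule triangle_contour_integrals_starlike_primitive)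
    show "continuous_on R G" by (rule holomorphic_on_imp_continuous_on[OF G])
    show "closed_segment b y \<subseteq> R" if "y \<in> R" for y
      using assms that by (simp add: closed_segment_subset)
    fix c d assume cd: "closed_segment c d \<subseteq> R"
    then have "convex hull {b, c, d} \<subseteq> R"
      using assms by (intro hull_minimal) auto
    from Cauchy_theorem_triangle[OF holomorphic_on_subset[OF G this]]
    show "contour_integral (linepath b c) G + contour_integral (linepath c d) G
        + contour_integral (linepath d b) G = 0"
      by (rule has_chain_integral_chain_integral3)
  qed (use assms in auto)
  have eq: "wkb_integral b F y e = exp (- (2 * \<i> * y / e)) * contour_integral (linepath b y) G" if "y \<in> R" for y
  proof -
    have "closed_segment b y \<subseteq> R"
      using assms that by (simp add: closed_segment_subset)
    then have "G contour_integrable_on linepath b y"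
      by (intro contour_integrable_continuous_linepath continuous_on_subset[OF holomorphic_on_imp_continuous_on[OF G]])
    then have "exp (- (2 * \<i> * y / e)) * contour_integral (linepath b y) G
        = contour_integral (linepath b y) (\<lambda>s. exp (- (2 * \<i> * y / e)) * G s)"
      by (simp add: contour_integral_lmul)
    also have "(\<lambda>s. exp (- (2 * \<i> * y / e)) * G s) = (\<lambda>s. exp (2 * \<i> * (s - y) / e) * F s e)"
      by (simp add: G_def exp_diff exp_minus right_diff_distrib diff_divide_distrib field_simps)
    finally show ?thesis by (simp add: wkb_integral_def)
  qed
  have "((\<lambda>y. exp (- (2 * \<i> * y / e)) * contour_integral (linepath b y) G)
          has_field_derivative F x e - 2 * \<i> / e * wkb_integral b F x e) (at x)"
    by (rule derivative_eq_intros prim refl \<open>e \<noteq> 0\<close>)+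
       (use \<open>x \<in> R\<close> \<open>e \<noteq> 0\<close> in \<open>simp add: eq G_def exp_minus field_simps\<close>)
  then show ?thesis
    by (rule has_field_derivative_transform_within_open[OF _ \<open>open R\<close> \<open>x \<in> R\<close>]) (simp add: eq)
qed

lemma wkb_integral_holomorphic_parameter:
  assumes "convex R" "b \<in> R" "x \<in> R" and F: "continuous_on (R \<times> - {0}) (\<lambda>(x, e). F x e)"
    and hol: "\<And>s. s \<in> R \<Longrightarrow> F s holomorphic_on (- {0})"
  shows "wkb_integral b F x holomorphic_on (- {0})"
proof -
  have seg: "closed_segment b x \<subseteq> R"
    using assms by (simp add: closed_segment_subset)
  have "(\<lambda>e. contour_integral (linepath b x) (\<lambda>s. exp (2 * \<i> * (s - x) / e) * F s e)) holomorphic_on (- {0})"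
  proof (rule holomorphic_on_contour_integral_param)
    have "continuous_on ((- {0}) \<times> closed_segment b x) (\<lambda>y. (\<lambda>(x, e). F x e) (snd y, fst y))"
      by (rule continuous_on_compose2[OF F]) (use seg in \<open>auto intro!: continuous_intros\<close>)
    then show "continuous_on ((- {0}) \<times> closed_segment b x) (\<lambda>(e, s). exp (2 * \<i> * (s - x) / e) * F s e)"
      by (auto simp: case_prod_beta intro!: continuous_intros)
    show "(\<lambda>e. exp (2 * \<i> * (s - x) / e) * F s e) holomorphic_on (- {0})" if "s \<in> closed_segment b x" for s
      using that seg by (auto intro!: holomorphic_intros hol)
  qed auto
  then show ?thesis by (simp add: wkb_integral_def[abs_def])
qed

text \<open>Along the segment the exponential decays away from the end point \<open>x\<close> at the rate \<open>m / |e|\<close>,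
  so the integral gains a factor \<open>|e|\<close> over its integrand, however long the segment is.\<close>

lemma norm_wkb_integral_le:
  assumes m: "0 < m" and e: "e \<noteq> 0"
    and cone: "Im ((x - b) * cnj e) \<le> - m * norm (x - b) * norm e"
    and cont: "continuous_on (closed_segment b x) (\<lambda>s. F s e)"
    and F: "\<And>s. s \<in> closed_segment b x \<Longrightarrow> norm (F s e) \<le> B"
  shows "norm (wkb_integral b F x e) \<le> B * (norm e / (2 * m))"
proof (cases "x = b")
  case True
  have "0 \<le> B" using order_trans[OF norm_ge_zero F[of b]] by simp
  then show ?thesis using m True by (simp add: wkb_integral_def)
next
  case False
  define c where "c = m * norm (x - b) / norm e"
  have c: "0 < c" using False m e by (simp add: c_def)
  let ?g = "\<lambda>t. exp (2 * \<i> * (linepath b x t - x) / e) * F (linepath b x t) e * (x - b)"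
  let ?h = "\<lambda>t. B * norm (x - b) * exp (- (2 * c * (1 - t)))"
  have ne: "norm (exp (2 * \<i> * (linepath b x t - x) / e)) \<le> exp (- (2 * c * (1 - t)))"
    if "t \<in> {0..1}" for t
  proof -
    have lin: "linepath b x t - x = - ((1 - t) *\<^sub>R (x - b))"
      by (simp add: linepath_def scaleR_conv_of_real algebra_simps)
    have "2 * \<i> * (linepath b x t - x) / e = - (2 * (1 - t)) *\<^sub>R (\<i> * ((x - b) / e))"
      unfolding lin using e by (simp add: scaleR_conv_of_real field_simps)
    moreover have "Re (- (2 * (1 - t)) *\<^sub>R (\<i> * w)) = 2 * (1 - t) * Im w" for w
      by (simp add: algebra_simps)
    ultimately have re: "Re (2 * \<i> * (linepath b x t - x) / e) = 2 * (1 - t) * Im ((x - b) / e)"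
      by metis
    have "Im ((x - b) / e) = Im ((x - b) * cnj e) / (norm e)\<^sup>2"
      by (subst complex_div_cnj) simp
    also have "\<dots> \<le> (- m * norm (x - b) * norm e) / (norm e)\<^sup>2"
      using cone by (rule divide_right_mono) simp
    also have "\<dots> = - c" using e by (simp add: c_def power2_eq_square field_simps)
    finally have "2 * (1 - t) * Im ((x - b) / e) \<le> 2 * (1 - t) * - c"
      by (rule mult_left_mono) (use that in auto)
    then have "Re (2 * \<i> * (linepath b x t - x) / e) \<le> - (2 * c * (1 - t))"
      unfolding re by (simp add: algebra_simps)
    then show ?thesis by simp
  qed
  have cont': "continuous_on {0..1} (\<lambda>t. F (linepath b x t) e)"
    by (rule continuous_on_compose2[OF cont]) (auto intro!: continuous_intros simp: linepath_def in_segment)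
  have int_h: "(?h has_integral (B * norm (x - b) / (2 * c) * exp (- (2 * c * (1 - 1)))
                 - B * norm (x - b) / (2 * c) * exp (- (2 * c * (1 - 0))))) {0..1}"
    by (rule fundamental_theorem_of_calculus)
       (use c in \<open>auto intro!: derivative_eq_intros simp flip: has_real_derivative_iff_has_vector_derivative\<close>)
  have "norm (wkb_integral b F x e) = norm (integral {0..1} ?g)"
    by (simp add: wkb_integral_def contour_integral_integral)
  also have "\<dots> \<le> integral {0..1} ?h"
  proof (rule integral_norm_bound_integral)
    show "?g integrable_on {0..1}"
      by (rule integrable_continuous_real) (auto intro!: continuous_intros cont' simp: e)
    show "?h integrable_on {0..1}" using int_h by blast
    fix t :: real assume t: "t \<in> {0..1}"
    have "norm (F (linepath b x t) e) \<le> B"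
      by (rule F) (use t in \<open>auto simp: linepath_def in_segment\<close>)
    then have "norm (?g t) \<le> exp (- (2 * c * (1 - t))) * B * norm (x - b)"
      unfolding norm_mult
      by (intro mult_mono ne t mult_nonneg_nonneg) (auto intro: order_trans[OF norm_ge_zero])
    then show "norm (?g t) \<le> ?h t" by (simp add: mult_ac)
  qed
  also have "\<dots> = B * norm (x - b) / (2 * c) * (1 - exp (- (2 * c)))"
    unfolding integral_unique[OF int_h] by (simp add: right_diff_distrib)
  also have "\<dots> \<le> B * norm (x - b) / (2 * c) * 1"
  proof (rule mult_left_mono)
    have "0 \<le> B" using order_trans[OF norm_ge_zero F[of b]] by simp
    then show "0 \<le> B * norm (x - b) / (2 * c)" using c by simp
  qed simp
  also have "\<dots> = B * (norm e / (2 * m))"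
    using False m e by (simp add: c_def field_simps)
  finally show ?thesis .
qed

lemma wkb_integral_diff:
  assumes "(\<lambda>s. exp (2 * \<i> * (s - x) / e) * F s e) contour_integrable_on linepath b x"
    and "(\<lambda>s. exp (2 * \<i> * (s - x) / e) * G s e) contour_integrable_on linepath b x"
  shows "wkb_integral b (\<lambda>s e. F s e - G s e) x e = wkb_integral b F x e - wkb_integral b G x e"
  using contour_integral_diff[OF assms] by (simp add: wkb_integral_def right_diff_distrib)

abbreviation riccati_source :: "(complex \<Rightarrow> complex) \<Rightarrow> (complex \<Rightarrow> complex \<Rightarrow> complex) \<Rightarrow> complex \<Rightarrow> complex \<Rightarrow> complex" where
  "riccati_source k p \<equiv> \<lambda>s e. (p s e)\<^sup>2 + k s * p s e + \<i> * k s / e"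

text \<open>Picard iteration for \<open>p' = - (2 \<i> / e) p - p\<^sup>2 - k p - \<i> k / e\<close>, with \<open>p = 0\<close> at \<open>b\<close>. This is the
  equation \<open>e w' = - 2 \<i> w - w\<^sup>2 - e k (\<i> + w)\<close> for \<open>w = e p\<close>.\<close>

primrec riccati_iter :: "(complex \<Rightarrow> complex) \<Rightarrow> complex \<Rightarrow> nat \<Rightarrow> complex \<Rightarrow> complex \<Rightarrow> complex" where
  "riccati_iter k b 0 = (\<lambda>x e. 0)"
| "riccati_iter k b (Suc n) = (\<lambda>x e. - wkb_integral b (riccati_source k (riccati_iter k b n)) x e)"

lemma riccati_iter_regular:
  assumes "open R" "convex R" "b \<in> R" and k: "k holomorphic_on R"
  shows "continuous_on (R \<times> - {0}) (\<lambda>(x, e). riccati_iter k b n x e)"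
    and "\<And>e. e \<noteq> 0 \<Longrightarrow> (\<lambda>x. riccati_iter k b n x e) holomorphic_on R"
    and "\<And>x. x \<in> R \<Longrightarrow> riccati_iter k b n x holomorphic_on (- {0})"
proof (induction n)
  case 0
  { case 1 show ?case by (simp add: case_prod_beta) }
  { case 2 show ?case by simp }
  { case 3 show ?case by simp }
next
  case (Suc n)
  let ?F = "riccati_source k (riccati_iter k b n)"
  have contk: "continuous_on (R \<times> - {0 :: complex}) (\<lambda>y. k (fst y))"
    by (rule continuous_on_compose2[OF holomorphic_on_imp_continuous_on[OF k]]) (auto intro!: continuous_intros)
  have contF: "continuous_on (R \<times> - {0}) (\<lambda>(x, e). ?F x e)"
    using Suc(1) contk unfolding case_prod_beta by (intro continuous_intros) auto
  have holF: "(\<lambda>x. ?F x e) holomorphic_on R" if "e \<noteq> 0" for e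
    by (intro holomorphic_intros Suc(2) k that)
  have holF': "?F x holomorphic_on (- {0})" if "x \<in> R" for x
    using that by (auto intro!: holomorphic_intros Suc(3))
  { case 1
    have "continuous_on (R \<times> - {0}) (\<lambda>y. - (case y of (x, e) \<Rightarrow> wkb_integral b ?F x e))"
      by (intro continuous_intros continuous_on_wkb_integral assms contF)
    then show ?case by (simp add: case_prod_beta)
  }
  { case (2 e)
    then have "(\<lambda>x. wkb_integral b ?F x e) holomorphic_on R"
      using wkb_integral_has_derivative[where F = ?F, OF assms(1-3) _ 2] holF[OF 2] \<open>open R\<close>
      by (auto simp: holomorphic_on_open)
    then show ?case by (auto intro!: holomorphic_intros)
  }
  { case (3 x)
    then have "wkb_integral b ?F x holomorphic_on (- {0})"
      by (intro wkb_integral_holomorphic_parameter[where R = R] assms contF holF')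
    then have "(\<lambda>e. - wkb_integral b ?F x e) holomorphic_on (- {0})"
      by (rule holomorphic_on_minus)
    then show ?case by simp
  }
qed

lemma riccati_iter_has_derivative:
  assumes "open R" "convex R" "b \<in> R" "k holomorphic_on R" "x \<in> R" "e \<noteq> 0"
  shows "((\<lambda>x. riccati_iter k b (Suc n) x e) has_field_derivative
           - (2 * \<i> / e) * riccati_iter k b (Suc n) x e - riccati_source k (riccati_iter k b n) x e) (at x)"
proof -
  have "(\<lambda>x. riccati_source k (riccati_iter k b n) x e) holomorphic_on R"
    by (intro holomorphic_intros riccati_iter_regular(2) assms)
  from DERIV_minus[OF wkb_integral_has_derivative[where F = "riccati_source k (riccati_iter k b n)", OF assms(1-3,5,6) this]]
  show ?thesis by simp
qed

text \<open>The forcing \<open>k / e\<close> is large, but integration gains \<open>|e| / (2 m)\<close>. So the forcing contributes at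
  most \<open>K / (2 m)\<close>, and for small \<open>|e|\<close> the quadratic and linear terms fit into the remaining
  unit of \<open>P\<close> and contract by the factor \<open>1 / 2\<close>.\<close>

lemma riccati_iter_bounds:
  assumes "open R" "convex R" "k holomorphic_on R" "C \<subseteq> R" "b \<in> C"
    and seg: "\<And>x. x \<in> C \<Longrightarrow> closed_segment b x \<subseteq> C"
    and k: "\<And>x. x \<in> C \<Longrightarrow> norm (k x) \<le> K"
    and m: "0 < m" and e: "e \<noteq> 0"
    and cone: "\<And>x. x \<in> C \<Longrightarrow> Im ((x - b) * cnj e) \<le> - m * norm (x - b) * norm e"
    and P: "P = K / (2 * m) + 1"
    and small: "norm e * (P\<^sup>2 + K * P) \<le> m" "norm e * (2 * P + K) \<le> m"
    and "x \<in> C"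
  shows "norm (riccati_iter k b n x e) \<le> P"
    and "norm (riccati_iter k b (Suc n) x e - riccati_iter k b n x e) \<le> P * (1 / 2) ^ n"
proof -
  let ?p = "riccati_iter k b"
  have b: "b \<in> R" using assms by auto
  have K: "0 \<le> K" using order_trans[OF norm_ge_zero k[OF \<open>b \<in> C\<close>]] .
  then have P0: "0 \<le> P" using m by (simp add: P)
  have cont: "continuous_on (closed_segment b x) (\<lambda>s. riccati_source k (?p n) s e)" if "x \<in> C" for x n
  proof -
    have "(\<lambda>x. riccati_source k (riccati_iter k b n) x e) holomorphic_on R"
      by (intro holomorphic_intros riccati_iter_regular(2) assms b)
    then show ?thesis
      using seg[OF that] \<open>C \<subseteq> R\<close> by (meson continuous_on_subset holomorphic_on_imp_continuous_on order_trans)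
  qed
  have bound: "norm (?p n x e) \<le> P" if "x \<in> C" for x n
    using that
  proof (induction n arbitrary: x)
    case 0
    then show ?case using P0 by simp
  next
    case (Suc n)
    have F: "norm (riccati_source k (?p n) s e) \<le> P\<^sup>2 + K * P + K / norm e" if s: "s \<in> closed_segment b x" for s
    proof -
      have sC: "s \<in> C" using s seg Suc.prems by blast
      have "norm (riccati_source k (?p n) s e) \<le> norm ((?p n s e)\<^sup>2) + norm (k s * ?p n s e) + norm (\<i> * k s / e)"
        by (intro order_trans[OF norm_triangle_ineq] add_mono order_refl)
      also have "\<dots> \<le> P\<^sup>2 + K * P + K / norm e"
        unfolding norm_mult norm_power norm_divide
        using Suc.IH[OF sC] k[OF sC] K by (intro add_mono power_mono mult_mono divide_right_mono) auto
      finally show ?thesis .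
    qed
    have "norm (?p (Suc n) x e) \<le> (P\<^sup>2 + K * P + K / norm e) * (norm e / (2 * m))"
      using norm_wkb_integral_le[where F = "riccati_source k (?p n)", OF m e cone[OF Suc.prems] cont[OF Suc.prems] F] by simp
    also have "\<dots> = norm e * (P\<^sup>2 + K * P) / (2 * m) + K / (2 * m)"
      using e m by (simp add: field_simps)
    also have "\<dots> \<le> 1 + K / (2 * m)"
      using small m by (simp add: divide_simps)
    finally show ?case by (simp add: P)
  qed
  show "norm (?p n x e) \<le> P" by (rule bound[OF \<open>x \<in> C\<close>])
  have "norm (?p (Suc n) x e - ?p n x e) \<le> P * (1 / 2) ^ n" if "x \<in> C" for x n
    using that
  proof (induction n arbitrary: x)
    case 0
    then show ?case using bound[OF 0, of 1] by simp
  next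
    case (Suc n)
    define D where "D = P * (1 / 2) ^ n"
    let ?G = "\<lambda>s e. riccati_source k (?p (Suc n)) s e - riccati_source k (?p n) s e"
    have F: "norm (?G s e) \<le> (2 * P + K) * D" if s: "s \<in> closed_segment b x" for s
    proof -
      have sC: "s \<in> C" using s seg Suc.prems by blast
      have "?G s e = (?p (Suc n) s e + ?p n s e + k s) * (?p (Suc n) s e - ?p n s e)"
        by (simp add: power2_eq_square algebra_simps del: riccati_iter.simps)
      also have "norm \<dots> \<le> (P + P + K) * D"
        unfolding norm_mult D_def
        using P0 K by (intro mult_mono Suc.IH[OF sC] order_trans[OF norm_triangle_ineq] add_mono bound[OF sC] k[OF sC])
                      auto
      finally show ?thesis by simp
    qed
    have int: "(\<lambda>s. exp (2 * \<i> * (s - x) / e) * riccati_source k (?p n) s e) contour_integrable_on linepath b x" for n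
      by (intro contour_integrable_continuous_linepath continuous_on_mult cont Suc.prems)
         (auto intro!: continuous_intros simp: e)
    have "norm (wkb_integral b ?G x e) \<le> (2 * P + K) * D * (norm e / (2 * m))"
      by (rule norm_wkb_integral_le[where F = ?G, OF m e cone[OF Suc.prems] _ F])
         (intro continuous_on_diff cont Suc.prems)
    also have "\<dots> = norm e * (2 * P + K) / (2 * m) * D"
      using m by (simp add: field_simps)
    also have "\<dots> \<le> 1 / 2 * D"
      using small(2) m P0 by (intro mult_right_mono) (auto simp: D_def field_simps)
    also have "wkb_integral b ?G x e = - (?p (Suc (Suc n)) x e - ?p (Suc n) x e)"
    proof -
      have step: "?p (Suc n) x e = - wkb_integral b (riccati_source k (?p n)) x e" for n
        by simp
      show ?thesis
        unfolding step[of "Suc n"] step[of n] wkb_integral_diff[where F = "riccati_source k (?p (Suc n))" and G = "riccati_source k (?p n)", OF int int]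
        by (simp del: riccati_iter.simps)
    qed
    finally show ?case unfolding norm_minus_cancel D_def by simp
  qed
  then show "norm (?p (Suc n) x e - ?p n x e) \<le> P * (1 / 2) ^ n" using \<open>x \<in> C\<close> .
qed

text \<open>The set \<open>C\<close> will be a closed cone with vertex \<open>b\<close>, cut off by \<open>R\<close>. The iterates are controlled
  on all of it, since the integrals reach back to \<open>b\<close>; their limit is differentiated on an open part \<open>W\<close>.\<close>

proposition riccati_solution:
  assumes R: "open R" "convex R" "k holomorphic_on R" "C \<subseteq> R" "b \<in> C"
    and seg: "\<And>x. x \<in> C \<Longrightarrow> closed_segment b x \<subseteq> C"
    and k: "\<And>x. x \<in> C \<Longrightarrow> norm (k x) \<le> K"
    and m: "0 < m" and S: "open S" "0 \<notin> S"
    and cone: "\<And>x e. x \<in> C \<Longrightarrow> e \<in> S \<Longrightarrow> Im ((x - b) * cnj e) \<le> - m * norm (x - b) * norm e"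
    and P: "P = K / (2 * m) + 1"
    and small: "\<And>e. e \<in> S \<Longrightarrow> norm e * (P\<^sup>2 + K * P) \<le> m" "\<And>e. e \<in> S \<Longrightarrow> norm e * (2 * P + K) \<le> m"
    and W: "open W" "W \<subseteq> C"
  obtains p where "continuous_on (W \<times> S) (\<lambda>(x, e). p x e)"
    and "\<And>x e. x \<in> W \<Longrightarrow> e \<in> S \<Longrightarrow> norm (p x e) \<le> P"
    and "\<And>e. e \<in> S \<Longrightarrow> (\<lambda>x. p x e) holomorphic_on W"
    and "\<And>x. x \<in> W \<Longrightarrow> p x holomorphic_on S"
    and "\<And>x e. x \<in> W \<Longrightarrow> e \<in> S \<Longrightarrow>
           ((\<lambda>x. p x e) has_field_derivative - (2 * \<i> / e) * p x e - riccati_source k p x e) (at x)"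
proof -
  let ?p = "riccati_iter k b"
  define d where "d = (\<lambda>n y. ?p (Suc n) (fst y) (snd y) - ?p n (fst y) (snd y))"
  define p where "p = (\<lambda>x e. \<Sum>n. d n (x, e))"
  have b: "b \<in> R" using R by auto
  have e0: "e \<noteq> 0" if "e \<in> S" for e using that S by auto
  have xC: "x \<in> C" "x \<in> R" if "x \<in> W" for x using that W R by auto
  have cone': "\<And>x. x \<in> C \<Longrightarrow> Im ((x - b) * cnj e) \<le> - m * norm (x - b) * norm e" if "e \<in> S" for e
    using cone that by blast
  note bounds = riccati_iter_bounds[OF R seg k m e0 cone' P small]
  have tele: "(\<Sum>i<n. d i y) = ?p n (fst y) (snd y)" for n y
    unfolding d_def by (induction n) (simp_all del: riccati_iter.simps(2))
  have "uniform_limit (W \<times> S) (\<lambda>n y. \<Sum>i<n. d i y) (\<lambda>y. \<Sum>n. d n y) sequentially"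
  proof (rule Weierstrass_m_test)
    show "norm (d n y) \<le> P * (1 / 2) ^ n" if "y \<in> W \<times> S" for n y
      unfolding d_def using that by (intro bounds(2)) (auto intro: xC)
    show "summable (\<lambda>n. P * (1 / 2) ^ n)"
      by (intro summable_mult summable_geometric) simp
  qed
  then have ul: "uniform_limit (W \<times> S) (\<lambda>n (x, e). ?p n x e) (\<lambda>(x, e). p x e) sequentially"
    by (simp add: tele p_def split_def)
  have lim: "(\<lambda>n. ?p n x e) \<longlonglongrightarrow> p x e" if "x \<in> W" "e \<in> S" for x e
    using tendsto_uniform_limitI[OF ul, of "(x, e)"] that by simp
  have ulx: "uniform_limit X (\<lambda>n x. ?p n x e) (\<lambda>x. p x e) sequentially" if "X \<subseteq> W" "e \<in> S" for X e
    using uniform_limit_compose'[OF ul, of "\<lambda>x. (x, e)" X] that by auto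
  have ule: "uniform_limit X (\<lambda>n e. ?p n x e) (\<lambda>e. p x e) sequentially" if "X \<subseteq> S" "x \<in> W" for X x
    using uniform_limit_compose'[OF ul, of "\<lambda>e. (x, e)" X] that by auto
  show thesis
  proof
    show "continuous_on (W \<times> S) (\<lambda>(x, e). p x e)"
    proof (rule uniform_limit_theorem[OF _ ul])
      show "\<forall>\<^sub>F n in sequentially. continuous_on (W \<times> S) (\<lambda>(x, e). ?p n x e)"
        by (intro always_eventually allI continuous_on_subset[OF riccati_iter_regular(1)[OF R(1,2) b R(3)]])
           (use S xC in auto)
    qed simp
    show "norm (p x e) \<le> P" if "x \<in> W" "e \<in> S" for x e
      by (rule Lim_bounded[OF tendsto_norm[OF lim[OF that]], of 0]) (auto intro!: bounds(1) xC that)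
    fix e assume e: "e \<in> S"
    have balls: "\<exists>d>0. cball x d \<subseteq> W \<and> uniform_limit (cball x d) (\<lambda>n x. ?p (Suc n) x e) (\<lambda>x. p x e) sequentially"
      if x: "x \<in> W" for x
    proof -
      obtain d where d: "d > 0" "cball x d \<subseteq> W"
        using W(1) x unfolding open_contains_cball by meson
      have "uniform_limit (cball x d) (\<lambda>n x. ?p (Suc n) x e) (\<lambda>x. p x e) sequentially"
        by (rule filterlim_compose[OF ulx[OF d(2) e] filterlim_Suc])
      with d show ?thesis by blast
    qed
    have "\<exists>g'. \<forall>x\<in>W. ((\<lambda>x. p x e) has_field_derivative g' x) (at x) \<and>
        (\<lambda>n. - (2 * \<i> / e) * ?p (Suc n) x e - riccati_source k (?p n) x e) \<longlonglongrightarrow> g' x"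
      by (rule has_complex_derivative_uniform_sequence[OF W(1) _ balls],
          rule riccati_iter_has_derivative[OF R(1,2) b R(3)]) (use e0[OF e] xC in auto)
    then obtain g' where g': "\<forall>x\<in>W. ((\<lambda>x. p x e) has_field_derivative g' x) (at x) \<and>
        (\<lambda>n. - (2 * \<i> / e) * ?p (Suc n) x e - riccati_source k (?p n) x e) \<longlonglongrightarrow> g' x" ..
    show D: "((\<lambda>x. p x e) has_field_derivative - (2 * \<i> / e) * p x e - riccati_source k p x e) (at x)"
      if "x \<in> W" for x
    proof -
      have "(\<lambda>n. - (2 * \<i> / e) * ?p (Suc n) x e - riccati_source k (?p n) x e)
              \<longlonglongrightarrow> - (2 * \<i> / e) * p x e - riccati_source k p x e"
        using lim[OF that e] LIMSEQ_Suc[OF lim[OF that e]] by (intro tendsto_intros) auto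
      from LIMSEQ_unique[OF _ this, of "g' x"] g' that have "g' x = - (2 * \<i> / e) * p x e - riccati_source k p x e"
        by blast
      with g' that show ?thesis by metis
    qed
    then show "(\<lambda>x. p x e) holomorphic_on W"
      using W(1) by (auto simp: holomorphic_on_open)
  next
    fix x assume x: "x \<in> W"
    show "p x holomorphic_on S"
    proof (rule holomorphic_uniform_sequence[OF S(1)])
      show "?p n x holomorphic_on S" for n
        by (rule holomorphic_on_subset[OF riccati_iter_regular(3)[OF R(1,2) b R(3)]]) (use x xC S in auto)
      fix e assume "e \<in> S"
      then obtain d where "d > 0" "cball e d \<subseteq> S" using S(1) unfolding open_contains_cball by meson
      then show "\<exists>d>0. cball e d \<subseteq> S \<and> uniform_limit (cball e d) (\<lambda>n. ?p n x) (p x) sequentially"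
        using ule[OF _ x] by blast
    qed
  qed
qed

section \<open>Exponentially close solutions\<close>

text \<open>The difference of two solutions satisfies a homogeneous linear equation whose dominant
  coefficient is \<open>- 2 \<i> / e\<close>. Continued over a distance \<open>\<rho>\<close> in the direction in which
  \<open>exp (- 2 \<i> x / e)\<close> decays fastest, it loses the factor \<open>exp (- 2 \<rho> / |e|)\<close>.\<close>

lemma riccati_difference_exp_small:
  assumes "0 < \<rho>" "e \<noteq> 0"
    and p: "\<And>x. x \<in> ball x0 (2 * \<rho>) \<Longrightarrow>
           ((\<lambda>x. p x e) has_field_derivative - (2 * \<i> / e) * p x e - riccati_source k p x e) (at x)"
    and q: "\<And>x. x \<in> ball x0 (2 * \<rho>) \<Longrightarrow>
           ((\<lambda>x. q x e) has_field_derivative - (2 * \<i> / e) * q x e - riccati_source k q x e) (at x)"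
    and k: "k holomorphic_on ball x0 (2 * \<rho>)" "\<And>x. x \<in> ball x0 (2 * \<rho>) \<Longrightarrow> norm (k x) \<le> K"
    and P: "\<And>x. x \<in> ball x0 (2 * \<rho>) \<Longrightarrow> norm (p x e) \<le> P" "\<And>x. x \<in> ball x0 (2 * \<rho>) \<Longrightarrow> norm (q x e) \<le> P"
  shows "norm (p x0 e - q x0 e) \<le> 2 * P * exp ((2 * P + K) * \<rho>) * exp (- (2 * \<rho>) / norm e)"
proof -
  let ?B = "ball x0 (2 * \<rho>)"
  define Q where "Q = (\<lambda>x. p x e + q x e + k x)"
  have "(\<lambda>x. p x e) holomorphic_on ?B" "(\<lambda>x. q x e) holomorphic_on ?B"
    using p q unfolding holomorphic_on_open[OF open_ball] by blast+
  then have "Q holomorphic_on ?B"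
    unfolding Q_def by (intro holomorphic_intros k)
  then obtain A where A: "\<And>x. x \<in> ?B \<Longrightarrow> (A has_field_derivative Q x) (at x within ?B)"
    using holomorphic_convex_primitive'[of ?B Q] by auto
  have A': "(A has_field_derivative Q x) (at x)" if "x \<in> ?B" for x
    using A[OF that] that by (simp add: at_within_open[OF _ open_ball])
  have nQ: "norm (Q x) \<le> 2 * P + K" if "x \<in> ?B" for x
    unfolding Q_def using P[OF that] k(2)[OF that] norm_triangle_ineq[of "p x e + q x e" "k x"]
      norm_triangle_ineq[of "p x e" "q x e"] by linarith
  define E where "E = (\<lambda>x. (p x e - q x e) * exp (2 * \<i> * x / e + A x))"
  have "(E has_field_derivative 0) (at x within ?B)" if "x \<in> ?B" for x
  proof -
    have "(E has_field_derivative 0) (at x)"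
      unfolding E_def
      by (rule derivative_eq_intros p[OF that] q[OF that] A'[OF that] refl \<open>e \<noteq> 0\<close>)+
         (use \<open>e \<noteq> 0\<close> in \<open>simp add: Q_def power2_eq_square field_simps\<close>)
    then show ?thesis by (rule has_field_derivative_at_within)
  qed
  then obtain c where c: "\<And>x. x \<in> ?B \<Longrightarrow> E x = c"
    using has_field_derivative_zero_constant[of ?B E] by auto
  define x1 where "x1 = x0 + \<i> * (of_real (\<rho> / norm e) * e)"
  have d: "dist x0 x1 = \<rho>"
    using assms(1,2) by (simp add: x1_def dist_norm norm_mult norm_divide)
  then have x1: "x1 \<in> ?B" and x0: "x0 \<in> ?B" using \<open>0 < \<rho>\<close> by auto
  have ex: "2 * \<i> * x1 / e - 2 * \<i> * x0 / e = of_real (- (2 * \<rho>) / norm e)"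
    using \<open>e \<noteq> 0\<close> by (simp add: x1_def field_simps)
  have "p x0 e - q x0 e = E x0 * exp (- (2 * \<i> * x0 / e + A x0))"
    by (simp add: E_def mult.assoc flip: exp_add)
  also have "E x0 = E x1" using c x0 x1 by simp
  also have "E x1 * exp (- (2 * \<i> * x0 / e + A x0))
      = (p x1 e - q x1 e) * exp ((2 * \<i> * x1 / e - 2 * \<i> * x0 / e) + (A x1 - A x0))"
    by (simp add: E_def mult.assoc algebra_simps flip: exp_add)
  also have "\<dots> = (p x1 e - q x1 e) * exp (A x1 - A x0) * of_real (exp (- (2 * \<rho>) / norm e))"
    unfolding ex exp_add exp_of_real by (simp only: mult_ac)
  finally have eq: "p x0 e - q x0 e = (p x1 e - q x1 e) * exp (A x1 - A x0) * of_real (exp (- (2 * \<rho>) / norm e))" .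
  have "norm (A x1 - A x0) \<le> (2 * P + K) * norm (x1 - x0)"
    by (rule field_differentiable_bound[of ?B, OF _ A nQ x1 x0]) auto
  also have "norm (x1 - x0) = \<rho>" using d by (simp add: dist_norm norm_minus_commute)
  finally have "Re (A x1 - A x0) \<le> (2 * P + K) * \<rho>"
    using complex_Re_le_cmod order_trans by blast
  then have 1: "norm (exp (A x1 - A x0)) \<le> exp ((2 * P + K) * \<rho>)" by simp
  have 2: "norm (p x1 e - q x1 e) \<le> 2 * P"
    using P[OF x1] norm_triangle_ineq4[of "p x1 e" "q x1 e"] by linarith
  show ?thesis
    unfolding eq norm_mult
    by (intro mult_mono 1 2 mult_nonneg_nonneg) (use order_trans[OF norm_ge_zero 2] in auto)
qed

section \<open>Gevrey estimates for Cauchy integrals\<close>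

lemma exp_neg_inverse_le:
  fixes x c :: real
  assumes "0 < x" "0 < c"
  shows "exp (- c / x) \<le> fact n * (x / c) ^ n"
proof -
  have s: "summable (\<lambda>n. (c / x) ^ n /\<^sub>R fact n)" by (rule summable_exp_generic)
  have "(\<Sum>i\<in>{n}. (c / x) ^ i /\<^sub>R fact i) \<le> (\<Sum>i. (c / x) ^ i /\<^sub>R fact i)"
    by (rule sum_le_suminf[OF s]) (use assms in auto)
  then have "(c / x) ^ n / fact n \<le> exp (c / x)"
    by (simp add: exp_def field_simps)
  then have "inverse (exp (c / x)) \<le> inverse ((c / x) ^ n / fact n)"
    by (rule le_imp_inverse_le) (use assms in auto)
  moreover have "inverse (exp (c / x)) = exp (- c / x)"
    by (simp flip: exp_minus)
  moreover have "inverse ((c / x) ^ n / fact n) = fact n * (x / c) ^ n"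
    using assms by (simp add: power_divide)
  ultimately show ?thesis by simp
qed

lemma fact_Suc_le_power2: "fact (Suc N) \<le> (2 ^ N * fact N :: real)"
proof -
  have "real (Suc N) \<le> 2 ^ N"
    by (induction N) (auto simp: field_simps)
  then show ?thesis by (simp add: mult_right_mono)
qed

text \<open>At \<open>\<zeta> = 0\<close> the quotient has the value 0 by the convention for division by zero, which is also
  its limit.\<close>

lemma continuous_on_div_power_exp_small:
  fixes U S :: "complex set" and G :: "complex \<Rightarrow> complex \<Rightarrow> complex"
  assumes G: "continuous_on (U \<times> S) (\<lambda>(x, \<zeta>). G x \<zeta>)" and c: "0 < c"
    and bd: "\<And>x \<zeta>. x \<in> U \<Longrightarrow> \<zeta> \<in> S \<Longrightarrow> \<zeta> \<noteq> 0 \<Longrightarrow> norm (G x \<zeta>) \<le> M * exp (- c / norm \<zeta>)"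
  shows "continuous_on (U \<times> S) (\<lambda>(x, \<zeta>). G x \<zeta> / \<zeta> ^ Suc n)"
proof (rule continuous_on_eq_continuous_within[THEN iffD2], rule ballI)
  fix y assume "y \<in> U \<times> S"
  then obtain x \<zeta> where y: "y = (x, \<zeta>)" and mem: "x \<in> U" "\<zeta> \<in> S" by auto
  let ?H = "\<lambda>y. G (fst y) (snd y) / snd y ^ Suc n"
  have "continuous (at (x, \<zeta>) within U \<times> S) ?H"
  proof (cases "\<zeta> = 0")
    case False
    have "continuous (at (x, \<zeta>) within U \<times> S) (\<lambda>y. G (fst y) (snd y))"
      using G mem by (auto simp: continuous_on_eq_continuous_within split_def)
    moreover have "continuous (at (x, \<zeta>) within U \<times> S) (\<lambda>y. snd y ^ Suc n)"
      by (intro continuous_intros)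
    ultimately show ?thesis
      unfolding continuous_within by (rule tendsto_divide) (use False in simp)
  next
    case True
    have "(?H \<longlongrightarrow> 0) (at (x, \<zeta>) within U \<times> S)"
    proof (rule Lim_null_comparison)
      show "\<forall>\<^sub>F y in at (x, \<zeta>) within U \<times> S. norm (?H y) \<le> \<bar>M\<bar> * fact (n + 2) / c ^ (n + 2) * norm (snd y)"
        unfolding eventually_at_filter
      proof (intro always_eventually allI impI)
        fix y :: "complex \<times> complex" assume y: "y \<in> U \<times> S"
        show "norm (?H y) \<le> \<bar>M\<bar> * fact (n + 2) / c ^ (n + 2) * norm (snd y)"
        proof (cases "snd y = 0")
          case False
          have "norm (G (fst y) (snd y)) \<le> M * exp (- c / norm (snd y))"
            using y False by (intro bd) auto
          also have "\<dots> \<le> \<bar>M\<bar> * (fact (n + 2) * (norm (snd y) / c) ^ (n + 2))"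
            using exp_neg_inverse_le[of "norm (snd y)" c "n + 2"] False c by (intro mult_mono) auto
          finally have "norm (?H y) \<le> \<bar>M\<bar> * (fact (n + 2) * (norm (snd y) / c) ^ (n + 2)) / norm (snd y) ^ Suc n"
            unfolding norm_divide norm_power by (rule divide_right_mono) simp
          also have "\<dots> = \<bar>M\<bar> * fact (n + 2) / c ^ (n + 2) * norm (snd y)"
          proof -
            have "\<bar>M\<bar> * (F * (s / c) ^ (n + 2)) / s ^ Suc n = \<bar>M\<bar> * F / c ^ (n + 2) * s" if "s \<noteq> 0" for F s :: real
              using that by (simp add: power_divide power_add power2_eq_square field_simps)
            from this[of "norm (snd y)"] show ?thesis using False by (simp only: norm_eq_zero not_False_eq_True)
          qed
          finally show ?thesis .
        qed simp
      qed
      show "((\<lambda>y. \<bar>M\<bar> * fact (n + 2) / c ^ (n + 2) * norm (snd y)) \<longlongrightarrow> 0) (at (x, \<zeta>) within U \<times> S)"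
        by (rule tendsto_eq_intros refl)+ (use True in auto)
    qed
    then show ?thesis using True by (simp add: continuous_within)
  qed
  then show "continuous (at y within U \<times> S) (\<lambda>(x, \<zeta>). G x \<zeta> / \<zeta> ^ Suc n)"
    by (simp add: split_def y)
qed

text \<open>A Cauchy integral of an exponentially small density is Gevrey of order 1: expand the Cauchy
  kernel in a geometric series; in the remainder the density outweighs \<open>\<zeta> ^ (N + 1)\<close> in the
  denominator at the price of a factorial.\<close>

lemma cauchy_integral_gevrey:
  assumes "open U" and G: "continuous_on (U \<times> closed_segment a b) (\<lambda>(x, \<zeta>). G x \<zeta>)"
    and hol: "\<And>\<zeta>. \<zeta> \<in> closed_segment a b \<Longrightarrow> (\<lambda>x. G x \<zeta>) holomorphic_on U"
    and c: "0 < c" and \<kappa>: "0 < \<kappa>" and M: "0 \<le> M"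
    and bd: "\<And>x \<zeta>. x \<in> U \<Longrightarrow> \<zeta> \<in> closed_segment a b \<Longrightarrow> \<zeta> \<noteq> 0 \<Longrightarrow> norm (G x \<zeta>) \<le> M * exp (- c / norm \<zeta>)"
    and G0: "\<And>x. x \<in> U \<Longrightarrow> G x 0 = 0"
    and far: "\<And>z \<zeta>. z \<in> Z \<Longrightarrow> \<zeta> \<in> closed_segment a b \<Longrightarrow> \<kappa> * norm \<zeta> \<le> norm (\<zeta> - z)" "0 \<notin> Z"
  defines "g \<equiv> \<lambda>n x. contour_integral (linepath a b) (\<lambda>\<zeta>. G x \<zeta> / \<zeta> ^ Suc n)"
  shows "g n holomorphic_on U"
    and "\<And>x z N. x \<in> U \<Longrightarrow> z \<in> Z \<Longrightarrow>
      norm (contour_integral (linepath a b) (\<lambda>\<zeta>. G x \<zeta> / (\<zeta> - z)) - (\<Sum>n<N. g n x * z ^ n))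
        \<le> (M * norm (b - a) / (\<kappa> * c)) * (2 / c) ^ N * fact N * norm z ^ N"
proof -
  note cont = continuous_on_div_power_exp_small[OF G c bd]
  show "g n holomorphic_on U"
    unfolding g_def
  proof (rule holomorphic_on_contour_integral_param[OF \<open>open U\<close>])
    show "continuous_on (U \<times> closed_segment a b) (\<lambda>(x, \<zeta>). G x \<zeta> / \<zeta> ^ Suc n)"
      by (rule cont)
    show "(\<lambda>x. G x \<zeta> / \<zeta> ^ Suc n) holomorphic_on U" if "\<zeta> \<in> closed_segment a b" for \<zeta>
      unfolding divide_inverse by (intro holomorphic_intros hol that)
  qed
  fix x z N assume x: "x \<in> U" and z: "z \<in> Z"
  have ne: "\<zeta> \<noteq> z" if "\<zeta> \<in> closed_segment a b" for \<zeta>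
  proof
    assume "\<zeta> = z"
    then have "\<zeta> = 0" using far(1)[OF z that] \<kappa> by (simp add: mult_le_0_iff)
    then show False using \<open>\<zeta> = z\<close> z far(2) by simp
  qed
  have ci: "(\<lambda>\<zeta>. G x \<zeta> / \<zeta> ^ Suc n) contour_integrable_on linepath a b" for n
  proof (rule contour_integrable_continuous_linepath)
    have "continuous_on (closed_segment a b) (\<lambda>\<zeta>. (\<lambda>(x, \<zeta>). G x \<zeta> / \<zeta> ^ Suc n) (x, \<zeta>))"
      by (rule continuous_on_compose2[OF cont]) (use x in \<open>auto intro!: continuous_intros\<close>)
    then show "continuous_on (closed_segment a b) (\<lambda>\<zeta>. G x \<zeta> / \<zeta> ^ Suc n)" by simp
  qed
  have "continuous_on (closed_segment a b) (\<lambda>\<zeta>. (\<lambda>(x, \<zeta>). G x \<zeta>) (x, \<zeta>))"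
    by (rule continuous_on_compose2[OF G]) (use x in \<open>auto intro!: continuous_intros\<close>)
  then have contG: "continuous_on (closed_segment a b) (\<lambda>\<zeta>. G x \<zeta> / (\<zeta> - z))"
    by (auto intro!: continuous_intros simp: ne)
  have ci2: "(\<lambda>\<zeta>. G x \<zeta> / (\<zeta> - z)) contour_integrable_on linepath a b"
    by (rule contour_integrable_continuous_linepath[OF contG])
  have cis: "(\<lambda>\<zeta>. \<Sum>n<N. G x \<zeta> / \<zeta> ^ Suc n * z ^ n) contour_integrable_on linepath a b"
    by (intro contour_integrable_sum contour_integrable_rmul ci) auto
  have "(\<Sum>n<N. g n x * z ^ n) = contour_integral (linepath a b) (\<lambda>\<zeta>. \<Sum>n<N. G x \<zeta> / \<zeta> ^ Suc n * z ^ n)"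
    unfolding g_def by (simp only: contour_integral_sum contour_integral_rmul contour_integrable_rmul ci finite_lessThan)
  then have "contour_integral (linepath a b) (\<lambda>\<zeta>. G x \<zeta> / (\<zeta> - z)) - (\<Sum>n<N. g n x * z ^ n)
      = contour_integral (linepath a b) (\<lambda>\<zeta>. G x \<zeta> / (\<zeta> - z) - (\<Sum>n<N. G x \<zeta> / \<zeta> ^ Suc n * z ^ n))"
    by (simp only: contour_integral_diff[OF ci2 cis])
  also have "norm \<dots> \<le> (M / (\<kappa> * c)) * (2 / c) ^ N * fact N * norm z ^ N * norm (b - a)"
  proof (rule contour_integral_bound_linepath)
    show "(\<lambda>\<zeta>. G x \<zeta> / (\<zeta> - z) - (\<Sum>n<N. G x \<zeta> / \<zeta> ^ Suc n * z ^ n)) contour_integrable_on linepath a b"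
      by (intro contour_integrable_diff ci2 cis)
    show "0 \<le> (M / (\<kappa> * c)) * (2 / c) ^ N * fact N * norm z ^ N"
      using c \<kappa> M by simp
    fix \<zeta> assume \<zeta>: "\<zeta> \<in> closed_segment a b"
    show "norm (G x \<zeta> / (\<zeta> - z) - (\<Sum>n<N. G x \<zeta> / \<zeta> ^ Suc n * z ^ n))
            \<le> (M / (\<kappa> * c)) * (2 / c) ^ N * fact N * norm z ^ N"
    proof (cases "\<zeta> = 0")
      case True
      then show ?thesis using c \<kappa> M G0[OF x] by simp
    next
      case False
      have geo: "G x \<zeta> / (\<zeta> - z) - (\<Sum>n<N. G x \<zeta> / \<zeta> ^ Suc n * z ^ n) = z ^ N * (G x \<zeta> / (\<zeta> ^ N * (\<zeta> - z)))"
      proof (induction N)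
        case (Suc N)
        have "G x \<zeta> / (\<zeta> - z) - (\<Sum>n<Suc N. G x \<zeta> / \<zeta> ^ Suc n * z ^ n)
            = z ^ N * (G x \<zeta> / (\<zeta> ^ N * (\<zeta> - z))) - G x \<zeta> / \<zeta> ^ Suc N * z ^ N"
          unfolding Suc.IH[symmetric] by simp
        also have "\<dots> = z ^ Suc N * (G x \<zeta> / (\<zeta> ^ Suc N * (\<zeta> - z)))"
          using False ne[OF \<zeta>] by (simp add: field_simps)
        finally show ?case .
      qed simp
      have "norm (G x \<zeta>) \<le> M * exp (- c / norm \<zeta>)" by (rule bd[OF x \<zeta> False])
      also have "\<dots> \<le> M * (fact (Suc N) * (norm \<zeta> / c) ^ Suc N)"
        using exp_neg_inverse_le[of "norm \<zeta>" c "Suc N"] False c M by (intro mult_left_mono) auto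
      also have "\<dots> \<le> M * ((2 ^ N * fact N) * (norm \<zeta> / c) ^ Suc N)"
        using M c by (intro mult_left_mono mult_right_mono fact_Suc_le_power2) auto
      finally have 1: "norm (G x \<zeta>) \<le> M * ((2 ^ N * fact N) * (norm \<zeta> / c) ^ Suc N)" .
      have "norm (G x \<zeta> / (\<zeta> ^ N * (\<zeta> - z))) = norm (G x \<zeta>) / (norm \<zeta> ^ N * norm (\<zeta> - z))"
        by (simp add: norm_divide norm_mult norm_power)
      also have "\<dots> \<le> (M * ((2 ^ N * fact N) * (norm \<zeta> / c) ^ Suc N)) / (norm \<zeta> ^ N * (\<kappa> * norm \<zeta>))"
        using False \<kappa> far(1)[OF z \<zeta>] by (intro frac_le 1 mult_left_mono order_trans[OF norm_ge_zero 1]) auto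
      also have "\<dots> = (M / (\<kappa> * c)) * (2 / c) ^ N * fact N"
        using False \<kappa> c by (simp add: power_divide field_simps)
      finally show ?thesis
        unfolding geo norm_mult norm_power by (subst mult.commute) (rule mult_right_mono, auto)
    qed
  qed
  finally show "norm (contour_integral (linepath a b) (\<lambda>\<zeta>. G x \<zeta> / (\<zeta> - z)) - (\<Sum>n<N. g n x * z ^ n))
        \<le> (M * norm (b - a) / (\<kappa> * c)) * (2 / c) ^ N * fact N * norm z ^ N"
    by (simp add: mult_ac)
qed

section \<open>The Ramis--Sibuya principle on four triangles\<close>

text \<open>The parameter plane is covered by four triangles around 0, obtained from each other by rotation
  through a right angle. They are tilted by a small angle, so that the positive real axis runs
  inside the triangle number 0; \<open>core_sector\<close> is a sector about that axis, well inside this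
  triangle.\<close>

definition tri_vertex :: "real \<Rightarrow> real \<Rightarrow> nat \<Rightarrow> complex" where
  "tri_vertex r \<kappa> j = of_real r * Complex 1 (- \<kappa>) * \<i> ^ j"

definition tri :: "real \<Rightarrow> real \<Rightarrow> nat \<Rightarrow> complex set" where
  "tri r \<kappa> j = convex hull {0, tri_vertex r \<kappa> j, tri_vertex r \<kappa> (Suc j)}"

definition core_sector :: "real \<Rightarrow> real \<Rightarrow> complex set" where
  "core_sector r \<kappa> = {z. 0 < Re z \<and> \<bar>Im z\<bar> < \<kappa> / 4 * Re z \<and> norm z < r / 4}"

lemma mem_tri_iff:
  "\<zeta> \<in> tri r \<kappa> j \<longleftrightarrow> (\<exists>u v. 0 \<le> u \<and> 0 \<le> v \<and> u + v \<le> 1 \<and> \<zeta> = tri_vertex r \<kappa> j * Complex u v)"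
proof -
  have "u *\<^sub>R (tri_vertex r \<kappa> j - 0) + v *\<^sub>R (tri_vertex r \<kappa> (Suc j) - 0) = tri_vertex r \<kappa> j * Complex u v" for u v
    by (simp add: tri_vertex_def scaleR_conv_of_real Complex_eq algebra_simps)
  then show ?thesis
    unfolding tri_def convex_hull_3_alt by auto
qed

lemma Complex_tilt_neq_0: "Complex 1 (- \<kappa>) \<noteq> 0"
  by (simp add: complex_eq_iff)

lemma core_sector_quadrant:
  assumes "z \<in> core_sector r \<kappa>" "0 < \<kappa>" "\<kappa> \<le> 1"
  shows "0 < Re (z / Complex 1 (- \<kappa>))" "0 < Im (z / Complex 1 (- \<kappa>))"
    and "Re (z / Complex 1 (- \<kappa>)) + Im (z / Complex 1 (- \<kappa>)) < r"
proof -
  have z: "0 < Re z" "\<bar>Im z\<bar> \<le> \<kappa> / 4 * Re z" "norm z < r / 4"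
    using assms(1) by (auto simp: core_sector_def)
  have "\<kappa> * \<bar>Im z\<bar> \<le> 1 * (1 / 4 * Re z)"
    using z assms by (intro mult_mono order_trans[OF z(2)]) auto
  moreover have "\<kappa> * Im z \<le> \<kappa> * \<bar>Im z\<bar>" using assms by (intro mult_left_mono) auto
  ultimately have re: "0 < Re z - \<kappa> * Im z" using z by linarith
  have "\<kappa> / 4 * Re z < \<kappa> * Re z" using z assms by (intro mult_strict_right_mono) auto
  then have im: "0 < Im z + \<kappa> * Re z" using z by linarith
  have k: "0 < 1 + \<kappa>\<^sup>2" using zero_le_power2[of \<kappa>] by linarith
  show "0 < Re (z / Complex 1 (- \<kappa>))" "0 < Im (z / Complex 1 (- \<kappa>))"
    using re im k by (simp_all add: Re_divide Im_divide algebra_simps)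
  have "norm (z / Complex 1 (- \<kappa>)) \<le> norm z / 1"
    unfolding norm_divide by (rule divide_left_mono) (use k in \<open>auto simp: cmod_def\<close>)
  moreover have "Re (z / Complex 1 (- \<kappa>)) \<le> norm (z / Complex 1 (- \<kappa>))"
    by (rule complex_Re_le_cmod)
  moreover have "Im (z / Complex 1 (- \<kappa>)) \<le> norm (z / Complex 1 (- \<kappa>))"
    using abs_Im_le_cmod[of "z / Complex 1 (- \<kappa>)"] by linarith
  moreover have "0 \<le> norm z" by simp
  ultimately show "Re (z / Complex 1 (- \<kappa>)) + Im (z / Complex 1 (- \<kappa>)) < r"
    using z(3) by linarith
qed

lemma core_sector_interior_tri:
  assumes "z \<in> core_sector r \<kappa>" "0 < \<kappa>" "\<kappa> \<le> 1" "0 < r"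
  shows "z \<in> interior (tri r \<kappa> 0)"
proof -
  let ?\<omega> = "of_real r * Complex 1 (- \<kappa>)"
  let ?O = "{\<zeta>. 0 < Re (\<zeta> / ?\<omega>) \<and> 0 < Im (\<zeta> / ?\<omega>) \<and> Re (\<zeta> / ?\<omega>) + Im (\<zeta> / ?\<omega>) < 1}"
  have \<omega>: "?\<omega> \<noteq> 0" using assms Complex_tilt_neq_0 by auto
  have "?O \<subseteq> interior (tri r \<kappa> 0)"
  proof (rule interior_maximal)
    show "?O \<subseteq> tri r \<kappa> 0"
    proof
      fix \<zeta> assume "\<zeta> \<in> ?O"
      moreover have "\<zeta> = tri_vertex r \<kappa> 0 * Complex (Re (\<zeta> / ?\<omega>)) (Im (\<zeta> / ?\<omega>))"
        using \<omega> unfolding complex_surj by (simp add: tri_vertex_def)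
      ultimately show "\<zeta> \<in> tri r \<kappa> 0" unfolding mem_tri_iff
        by (intro exI[of _ "Re (\<zeta> / ?\<omega>)"] exI[of _ "Im (\<zeta> / ?\<omega>)"] conjI) (simp_all only: mem_Collect_eq less_imp_le)
    qed
    show "open ?O"
      by (intro open_Collect_conj open_Collect_less continuous_intros) (use \<omega> in auto)
  qed
  moreover have "z / ?\<omega> = (z / Complex 1 (- \<kappa>)) /\<^sub>R r"
    by (simp add: scaleR_conv_of_real field_simps)
  then have "Re (z / ?\<omega>) = Re (z / Complex 1 (- \<kappa>)) / r" "Im (z / ?\<omega>) = Im (z / Complex 1 (- \<kappa>)) / r"
    by (simp_all only:) (simp_all add: field_simps)
  then have "z \<in> ?O"
    using core_sector_quadrant[OF assms(1-3)] \<open>0 < r\<close> by (simp flip: add_divide_distrib)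
  ultimately show ?thesis by blast
qed

lemma core_sector_not_in_tri:
  assumes z: "z \<in> core_sector r \<kappa>" and "0 < \<kappa>" "\<kappa> \<le> 1" "0 < r" "j < 4" "j \<noteq> 0"
  shows "z \<notin> tri r \<kappa> j"
proof
  assume "z \<in> tri r \<kappa> j"
  then obtain u v where uv: "0 \<le> u" "0 \<le> v" "z = tri_vertex r \<kappa> j * Complex u v"
    unfolding mem_tri_iff by blast
  have eq: "z / Complex 1 (- \<kappa>) = of_real r * (\<i> ^ j * Complex u v)"
    using Complex_tilt_neq_0 by (simp add: uv(3) tri_vertex_def)
  have "j = 1 \<or> j = 2 \<or> j = 3" using assms(5,6) by linarith
  then have "Re (z / Complex 1 (- \<kappa>)) \<le> 0 \<or> Im (z / Complex 1 (- \<kappa>)) \<le> 0"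
    unfolding eq using uv(1,2) \<open>0 < r\<close> by (auto simp: power3_eq_cube power2_eq_square)
  then show False using core_sector_quadrant[OF assms(1-3)] by linarith
qed

lemma tri_vertex_cycle: "tri_vertex r \<kappa> (Suc ((j + 3) mod 4)) = tri_vertex r \<kappa> j"
proof -
  have i4: "\<i> ^ (n mod 4) = \<i> ^ n" for n
  proof -
    have "\<i> ^ n = \<i> ^ (4 * (n div 4) + n mod 4)" by simp
    also have "\<dots> = \<i> ^ (n mod 4)"
      unfolding power_add power_mult by (simp add: power4_eq_xxxx)
    finally show ?thesis by simp
  qed
  have "\<i> ^ Suc ((j + 3) mod 4) = \<i> * \<i> ^ (j + 3)"
    by (simp only: power_Suc i4)
  also have "\<dots> = \<i> ^ (j + 4)"
    by (simp only: power_Suc[symmetric]) (simp add: add.commute)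
  also have "\<dots> = \<i> ^ j"
    by (simp add: power_add power4_eq_xxxx)
  finally show ?thesis by (simp add: tri_vertex_def)
qed

lemma ray_in_tri:
  assumes "\<zeta> \<in> closed_segment 0 (tri_vertex r \<kappa> j)"
  shows "\<zeta> \<in> tri r \<kappa> j" "\<zeta> \<in> tri r \<kappa> ((j + 3) mod 4)"
proof -
  show "\<zeta> \<in> tri r \<kappa> j"
    unfolding tri_def by (rule subsetD[OF segments_subset_convex_hull(1) assms])
  note tri_vertex_cycle[of r \<kappa> j]
  with assms show "\<zeta> \<in> tri r \<kappa> ((j + 3) mod 4)"
    unfolding tri_def by (auto intro: subsetD[OF segments_subset_convex_hull(2)])
qed

lemma edge_in_tri:
  "\<zeta> \<in> closed_segment (tri_vertex r \<kappa> j) (tri_vertex r \<kappa> (Suc j)) \<Longrightarrow> \<zeta> \<in> tri r \<kappa> j"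
  unfolding tri_def by (rule subsetD[OF segments_subset_convex_hull(3)])

lemma norm_edge_ge:
  assumes "\<zeta> \<in> closed_segment (tri_vertex r \<kappa> j) (tri_vertex r \<kappa> (Suc j))" "0 < r"
  shows "r / 2 \<le> norm \<zeta>"
proof -
  obtain t where t: "0 \<le> t" "t \<le> 1" "\<zeta> = (1 - t) *\<^sub>R tri_vertex r \<kappa> j + t *\<^sub>R tri_vertex r \<kappa> (Suc j)"
    using assms(1) by (auto simp: in_segment)
  have "\<zeta> = tri_vertex r \<kappa> j * Complex (1 - t) t"
    by (simp add: t(3) tri_vertex_def scaleR_conv_of_real Complex_eq algebra_simps)
  then have "norm \<zeta> = r * norm (Complex 1 (- \<kappa>)) * norm (Complex (1 - t) t)"
    using \<open>0 < r\<close> by (simp add: tri_vertex_def norm_mult norm_power)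
  moreover have "1 \<le> norm (Complex 1 (- \<kappa>))" by (simp add: cmod_def)
  moreover have "1 / 2 \<le> norm (Complex (1 - t) t)"
  proof -
    have "1 / 4 \<le> (1 - t)\<^sup>2 + t\<^sup>2"
      using zero_le_power2[of "2 * t - 1"] by (simp add: power2_eq_square algebra_simps)
    then have "sqrt (1 / 4) \<le> sqrt ((1 - t)\<^sup>2 + t\<^sup>2)" by (rule real_sqrt_le_mono)
    then show ?thesis by (simp add: cmod_def real_sqrt_divide)
  qed
  ultimately have "r * 1 * (1 / 2) \<le> norm \<zeta>"
    using \<open>0 < r\<close> by (simp only:) (intro mult_mono, auto)
  then show ?thesis by simp
qed

text \<open>Each of the four rays is separated from the core sector by a line through the origin,
  that is, by a real linear functional which is nonpositive on the sector and of size comparable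
  to \<open>|\<zeta>|\<close> on the ray.\<close>

lemma core_sector_far_from_rays:
  assumes z: "z \<in> core_sector r \<kappa>" and \<kappa>: "0 < \<kappa>" "\<kappa> \<le> 1" and "0 < r" and j: "j < 4"
    and \<zeta>: "\<zeta> \<in> closed_segment 0 (tri_vertex r \<kappa> j)"
  shows "\<kappa> / 8 * norm \<zeta> \<le> norm (\<zeta> - z)"
proof -
  obtain t where t: "0 \<le> t" "\<zeta> = t *\<^sub>R tri_vertex r \<kappa> j"
    using \<zeta> by (auto simp: in_segment)
  define x where "x = t * r"
  have x: "0 \<le> x" "\<zeta> = of_real x * (Complex 1 (- \<kappa>) * \<i> ^ j)"
    using t \<open>0 < r\<close> by (auto simp: x_def tri_vertex_def scaleR_conv_of_real)
  have z: "0 < Re z" "\<bar>Im z\<bar> \<le> \<kappa> / 4 * Re z"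
    using z by (auto simp: core_sector_def)
  have kz: "\<kappa> / 4 * Re z \<le> 1 / 4 * Re z" using z \<kappa> by (intro mult_right_mono) auto
  have n\<zeta>: "norm \<zeta> \<le> 2 * x"
  proof -
    have "norm (Complex 1 (- \<kappa>)) \<le> \<bar>1\<bar> + \<bar>- \<kappa>\<bar>" using cmod_le[of "Complex 1 (- \<kappa>)"] by simp
    also have "\<dots> \<le> 2" using \<kappa> by simp
    finally have "x * norm (Complex 1 (- \<kappa>)) \<le> x * 2" using x(1) by (rule mult_left_mono)
    then show ?thesis using x by (simp add: norm_mult norm_power mult.commute)
  qed
  have ax: "0 \<le> \<kappa> * x" "\<kappa> * x \<le> x" using \<kappa> x(1) by (auto intro: mult_left_le_one_le)
  have fn: "\<bar>Re w\<bar> \<le> norm w" "\<bar>Im w\<bar> \<le> norm w" for w :: complex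
    by (rule abs_Re_le_cmod, rule abs_Im_le_cmod)
  note fn = fn[of "\<zeta> - z"]
  have main: "\<kappa> * x \<le> 4 * norm (\<zeta> - z)"
  proof -
    have "j = 0 \<or> j = 1 \<or> j = 2 \<or> j = 3" using j by linarith
    then consider "j = 0" | "j = 1" | "j = 2" | "j = 3" by blast
    then show ?thesis
    proof cases
      case 1
      have e: "Re \<zeta> = x" "Im \<zeta> = - (\<kappa> * x)" using x 1 by simp_all
      have "- (\<kappa> * Re (\<zeta> - z)) \<le> \<bar>\<kappa>\<bar> * \<bar>Re (\<zeta> - z)\<bar>" by (metis abs_ge_minus_self abs_mult)
      also have "\<dots> \<le> 1 * norm (\<zeta> - z)" using \<kappa> fn by (intro mult_mono) auto
      finally have "\<kappa> * Re z - \<kappa> * x \<le> norm (\<zeta> - z)" by (simp add: e right_diff_distrib)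
      moreover have "\<kappa> * x + Im z \<le> norm (\<zeta> - z)" using fn e by simp
      moreover have "- Im z \<le> (\<kappa> * Re z) / 4" using z by simp
      moreover have "0 \<le> norm (\<zeta> - z)" by simp
      ultimately show ?thesis by linarith
    next
      case 2
      have e: "Re \<zeta> = \<kappa> * x" "Im \<zeta> = x" using x 2 by simp_all
      show ?thesis using fn z kz ax unfolding minus_complex.sel e by linarith
    next
      case 3
      have e: "Re \<zeta> = - x" "Im \<zeta> = \<kappa> * x" using x 3 by (simp_all add: power2_eq_square)
      show ?thesis using fn z kz ax unfolding minus_complex.sel e by linarith
    next
      case 4
      have e: "Re \<zeta> = - (\<kappa> * x)" "Im \<zeta> = - x" using x 4 by (simp_all add: power3_eq_cube)
      show ?thesis using fn z kz ax unfolding minus_complex.sel e by linarith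
    qed
  qed
  have "\<kappa> / 8 * norm \<zeta> \<le> \<kappa> / 8 * (2 * x)"
    using \<kappa> n\<zeta> by (intro mult_left_mono) auto
  then show ?thesis using main by simp
qed

text \<open>Summing Cauchy's formula over the boundaries of the four triangles, each of the four rays is
  traversed once in either direction; only the jump across it survives.\<close>

lemma cauchy_formula_four_triangles:
  assumes z: "z \<in> core_sector r \<kappa>" and \<kappa>: "0 < \<kappa>" "\<kappa> \<le> 1" and r: "0 < r"
    and cont: "\<And>j. j < 4 \<Longrightarrow> continuous_on (tri r \<kappa> j) (h j)"
    and diff: "\<And>j \<zeta>. j < 4 \<Longrightarrow> \<zeta> \<in> tri r \<kappa> j \<Longrightarrow> \<zeta> \<noteq> 0 \<Longrightarrow> h j field_differentiable at \<zeta>"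
  shows "2 * pi * \<i> * h 0 z =
    (\<Sum>j<4. contour_integral (linepath (tri_vertex r \<kappa> j) (tri_vertex r \<kappa> (Suc j))) (\<lambda>\<zeta>. h j \<zeta> / (\<zeta> - z))
       + contour_integral (linepath 0 (tri_vertex r \<kappa> j)) (\<lambda>\<zeta>. (h j \<zeta> - h ((j + 3) mod 4) \<zeta>) / (\<zeta> - z)))"
proof -
  let ?V = "tri_vertex r \<kappa>"
  let ?f = "\<lambda>j \<zeta>. h j \<zeta> / (\<zeta> - z)"
  let ?C = "\<lambda>a b j. contour_integral (linepath a b) (?f j)"
  have sub: "convex hull {0, ?V j, ?V (Suc j)} = tri r \<kappa> j" for j by (simp add: tri_def)
  have zin: "z \<in> interior (tri r \<kappa> 0)" by (rule core_sector_interior_tri[OF z \<kappa> r])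
  have z0: "z \<noteq> 0" using z by (auto simp: core_sector_def)
  have nv: "z \<notin> closed_segment 0 (?V j)" if "j < 4" for j
  proof
    assume a: "z \<in> closed_segment 0 (?V j)"
    then show False
      using core_sector_far_from_rays[OF z \<kappa> r that a] z0 \<kappa> by (simp add: mult_le_0_iff)
  qed
  have ne: "z \<notin> closed_segment (?V j) (?V (Suc j))" for j
    using norm_edge_ge[OF _ r, of z \<kappa> j] z r by (auto simp: core_sector_def)
  have V4: "?V 4 = ?V 0" by (simp add: tri_vertex_def power4_eq_xxxx)
  have main: "?C 0 (?V j) j + ?C (?V j) (?V (Suc j)) j + ?C (?V (Suc j)) 0 j
               = (if j = 0 then 2 * pi * \<i> * h 0 z else 0)" if j: "j < 4" for j
  proof (rule has_chain_integral_chain_integral3)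
    show "(?f j has_contour_integral (if j = 0 then 2 * pi * \<i> * h 0 z else 0))
        (linepath 0 (?V j) +++ linepath (?V j) (?V (Suc j)) +++ linepath (?V (Suc j)) 0)"
    proof (cases "j = 0")
      case True
      let ?g = "linepath 0 (?V 0) +++ linepath (?V 0) (?V (Suc 0)) +++ linepath (?V (Suc 0)) 0"
      have "winding_number ?g z = (if 0 < Im ((?V 0 - 0) * cnj (?V 0 - z)) then 1 else -1)"
        by (rule winding_number_triangle) (use zin in \<open>simp add: tri_def\<close>)
      also have "Im ((?V 0 - 0) * cnj (?V 0 - z)) = r * (Im z + \<kappa> * Re z)"
        by (simp add: tri_vertex_def algebra_simps)
      finally have w: "winding_number ?g z = (if 0 < r * (Im z + \<kappa> * Re z) then 1 else -1)" .
      have "0 < Im z + \<kappa> * Re z"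
      proof -
        have "\<kappa> / 4 * Re z < \<kappa> * Re z" using z \<kappa> by (intro mult_strict_right_mono) (auto simp: core_sector_def)
        then show ?thesis using z by (auto simp: core_sector_def)
      qed
      with r w have w: "winding_number ?g z = 1" by simp
      have "((\<lambda>w. h 0 w / (w - z)) has_contour_integral (2 * pi * \<i> * winding_number ?g z * h 0 z)) ?g"
      proof (rule Cauchy_integral_formula_weak[where S = "tri r \<kappa> 0" and k = "{0}"])
        show "convex (tri r \<kappa> 0)" by (simp add: tri_def)
        show "h 0 field_differentiable at x" if "x \<in> interior (tri r \<kappa> 0) - {0}" for x
          using that interior_subset by (intro diff) auto
        show "path_image ?g \<subseteq> tri r \<kappa> 0 - {z}"
        proof -
          have "z \<notin> closed_segment (?V (Suc 0)) 0" using nv[of 1] by (simp add: closed_segment_commute)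
          moreover have "path_image ?g \<subseteq> tri r \<kappa> 0"
            using segments_subset_convex_hull[where a = 0 and b = "?V 0" and c = "?V (Suc 0)"]
            unfolding sub by (auto simp: path_image_join closed_segment_commute)
          ultimately show ?thesis using nv[of 0] ne[of 0] by (auto simp: path_image_join)
        qed
      qed (use zin z0 cont[of 0] in auto)
      then show ?thesis using True w by simp
    next
      case False
      have nz: "z \<notin> tri r \<kappa> j" by (rule core_sector_not_in_tri[OF z \<kappa> r j False])
      have "(?f j has_contour_integral 0) (linepath 0 (?V j) +++ linepath (?V j) (?V (Suc j)) +++ linepath (?V (Suc j)) 0)"
      proof (rule Cauchy_theorem_triangle_cofinite[where S = "{0}"])
        show "continuous_on (convex hull {0, ?V j, ?V (Suc j)}) (?f j)"
          unfolding sub using nz by (auto intro!: continuous_intros cont j)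
        show "?f j field_differentiable at x" if "x \<in> interior (convex hull {0, ?V j, ?V (Suc j)}) - {0}" for x
          using that interior_subset nz unfolding sub
          by (intro field_differentiable_divide diff j derivative_intros) auto
      qed auto
      then show ?thesis using False by simp
    qed
  qed
  have cseg: "continuous_on X (?f j)" if "j < 4" "X \<subseteq> tri r \<kappa> j" "z \<notin> X" for X j
    using that by (auto intro!: continuous_intros continuous_on_subset[OF cont])
  have cray: "continuous_on (closed_segment 0 (?V j)) (?f j)"
      "continuous_on (closed_segment 0 (?V j)) (?f ((j + 3) mod 4))" if "j < 4" for j
    using ray_in_tri nv[OF that] that by (auto intro!: cseg)
  have rev: "?C (?V (Suc ((j + 3) mod 4))) 0 ((j + 3) mod 4) = - ?C 0 (?V j) ((j + 3) mod 4)" if "j < 4" for j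
    unfolding tri_vertex_cycle using cray(2)[OF that]
    by (subst contour_integral_reverse_linepath) (auto simp: closed_segment_commute)
  have "2 * pi * \<i> * h 0 z = (\<Sum>j<4::nat. if j = 0 then 2 * pi * \<i> * h 0 z else 0)"
    by (simp add: eval_nat_numeral)
  also have "\<dots> = (\<Sum>j<4. ?C 0 (?V j) j + ?C (?V j) (?V (Suc j)) j + ?C (?V (Suc j)) 0 j)"
    by (intro sum.cong refl main[symmetric]) auto
  also have "\<dots> = (\<Sum>j<4. ?C (?V j) (?V (Suc j)) j + ?C 0 (?V j) j) + (\<Sum>j<4. ?C (?V (Suc j)) 0 j)"
    by (simp add: sum.distrib)
  also have "(\<Sum>j<4. ?C (?V (Suc j)) 0 j) = (\<Sum>j<4. ?C (?V (Suc ((j + 3) mod 4))) 0 ((j + 3) mod 4))"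
  proof -
    have "bij_betw (\<lambda>j. (j + 3) mod 4) {..<4} {..<4::nat}"
      by (rule bij_betwI[where g = "\<lambda>j. (j + 1) mod 4"]) (auto simp: mod_simps)
    from sum.reindex_bij_betw[OF this, of "\<lambda>j. ?C (?V (Suc j)) 0 j"] show ?thesis by simp
  qed
  also have "\<dots> = (\<Sum>j<4. - ?C 0 (?V j) ((j + 3) mod 4))"
    by (intro sum.cong refl rev) auto
  also have "(\<Sum>j<4. ?C (?V j) (?V (Suc j)) j + ?C 0 (?V j) j) + (\<Sum>j<4. - ?C 0 (?V j) ((j + 3) mod 4))
      = (\<Sum>j<4. ?C (?V j) (?V (Suc j)) j + (?C 0 (?V j) j - ?C 0 (?V j) ((j + 3) mod 4)))"
    by (simp add: sum.distrib sum_negf sum_subtractf)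
  also have "\<dots> = (\<Sum>j<4. ?C (?V j) (?V (Suc j)) j
       + contour_integral (linepath 0 (?V j)) (\<lambda>\<zeta>. (h j \<zeta> - h ((j + 3) mod 4) \<zeta>) / (\<zeta> - z)))"
  proof (intro sum.cong refl arg_cong2[where f = "(+)"])
    fix j :: nat assume "j \<in> {..<4}"
    then have "?f j contour_integrable_on linepath 0 (?V j)" "?f ((j + 3) mod 4) contour_integrable_on linepath 0 (?V j)"
      using cray by (auto intro: contour_integrable_continuous_linepath)
    from contour_integral_diff[OF this]
    show "?C 0 (?V j) j - ?C 0 (?V j) ((j + 3) mod 4)
        = contour_integral (linepath 0 (?V j)) (\<lambda>\<zeta>. (h j \<zeta> - h ((j + 3) mod 4) \<zeta>) / (\<zeta> - z))"
      by (simp add: diff_divide_distrib)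
  qed
  finally show ?thesis .
qed

text \<open>The Ramis--Sibuya principle. All segments in Cauchy's formula carry an exponentially small density:
  the rays by assumption, and the outer edges because they stay away from 0, so that any bounded
  function is of size \<open>O(exp (- c / |\<zeta>|))\<close> there.\<close>

proposition four_triangles_gevrey:
  fixes h :: "nat \<Rightarrow> complex \<Rightarrow> complex \<Rightarrow> complex"
  assumes U: "open U" and \<kappa>: "0 < \<kappa>" "\<kappa> \<le> 1" and r: "0 < r" and c: "0 < c" and M: "0 \<le> M"
    and cont: "\<And>j. j < 4 \<Longrightarrow> continuous_on (U \<times> tri r \<kappa> j) (\<lambda>(x, \<zeta>). h j x \<zeta>)"
    and hol: "\<And>j \<zeta>. j < 4 \<Longrightarrow> \<zeta> \<in> tri r \<kappa> j \<Longrightarrow> (\<lambda>x. h j x \<zeta>) holomorphic_on U"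
    and diff: "\<And>j x \<zeta>. j < 4 \<Longrightarrow> x \<in> U \<Longrightarrow> \<zeta> \<in> tri r \<kappa> j \<Longrightarrow> \<zeta> \<noteq> 0 \<Longrightarrow> h j x field_differentiable at \<zeta>"
    and bd: "\<And>j x \<zeta>. j < 4 \<Longrightarrow> x \<in> U \<Longrightarrow> \<zeta> \<in> tri r \<kappa> j \<Longrightarrow> norm (h j x \<zeta>) \<le> M"
    and zero: "\<And>j x. j < 4 \<Longrightarrow> x \<in> U \<Longrightarrow> h j x 0 = 0"
    and jump: "\<And>j x \<zeta>. j < 4 \<Longrightarrow> x \<in> U \<Longrightarrow> \<zeta> \<in> closed_segment 0 (tri_vertex r \<kappa> j) \<Longrightarrow> \<zeta> \<noteq> 0 \<Longrightarrow>
                norm (h j x \<zeta> - h ((j + 3) mod 4) x \<zeta>) \<le> M * exp (- c / norm \<zeta>)"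
  obtains g A B where "0 < A" "0 < B" "\<And>n. g n holomorphic_on U"
    and "\<And>x z N. x \<in> U \<Longrightarrow> z \<in> core_sector r \<kappa> \<Longrightarrow>
           norm (h 0 x z - (\<Sum>n<N. g n x * z ^ n)) \<le> A * B ^ N * fact N * norm z ^ N"
proof -
  let ?V = "tri_vertex r \<kappa>"
  let ?Z = "core_sector r \<kappa>"
  define M' where "M' = M * exp (2 * c / r)"
  define J where "J = (\<lambda>j x \<zeta>. h j x \<zeta> - h ((j + 3) mod 4) x \<zeta>)"
  define ge where "ge = (\<lambda>j n x. contour_integral (linepath (?V j) (?V (Suc j))) (\<lambda>\<zeta>. h j x \<zeta> / \<zeta> ^ Suc n))"
  define gr where "gr = (\<lambda>j n x. contour_integral (linepath 0 (?V j)) (\<lambda>\<zeta>. J j x \<zeta> / \<zeta> ^ Suc n))"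
  have M': "0 \<le> M'" "M \<le> M'"
    using M c r by (auto simp: M'_def mult_le_cancel_left1)
  have Z0: "0 \<notin> ?Z" by (simp add: core_sector_def)
  have edge: "ge j n holomorphic_on U"
     "\<And>x z N. x \<in> U \<Longrightarrow> z \<in> ?Z \<Longrightarrow>
       norm (contour_integral (linepath (?V j) (?V (Suc j))) (\<lambda>\<zeta>. h j x \<zeta> / (\<zeta> - z)) - (\<Sum>n<N. ge j n x * z ^ n))
        \<le> (M' * norm (?V (Suc j) - ?V j) / (\<kappa> / 8 * c)) * (2 / c) ^ N * fact N * norm z ^ N" if j: "j < 4" for j n
  proof -
    have 1: "continuous_on (U \<times> closed_segment (?V j) (?V (Suc j))) (\<lambda>(x, \<zeta>). h j x \<zeta>)"
      by (rule continuous_on_subset[OF cont[OF j]]) (auto intro: edge_in_tri)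
    have 2: "norm (h j x \<zeta>) \<le> M' * exp (- c / norm \<zeta>)"
      if "x \<in> U" "\<zeta> \<in> closed_segment (?V j) (?V (Suc j))" for x \<zeta>
    proof -
      have "r / 2 \<le> norm \<zeta>" by (rule norm_edge_ge[OF that(2) r])
      moreover from this have "0 < norm \<zeta>" using r by linarith
      ultimately have "c / norm \<zeta> \<le> c / (r / 2)" using c r by (intro divide_left_mono) auto
      then have "exp 0 \<le> exp (2 * c / r + - c / norm \<zeta>)" unfolding exp_le_cancel_iff by (simp add: mult.commute)
      then have "1 \<le> exp (2 * c / r) * exp (- c / norm \<zeta>)" unfolding exp_add by simp
      then have "M * 1 \<le> M * (exp (2 * c / r) * exp (- c / norm \<zeta>))" using M by (rule mult_left_mono)
      moreover have "norm (h j x \<zeta>) \<le> M" by (rule bd[OF j that(1) edge_in_tri[OF that(2)]])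
      ultimately show ?thesis by (simp add: M'_def mult.assoc)
    qed
    have 3: "\<kappa> / 8 * norm \<zeta> \<le> norm (\<zeta> - z)"
      if "z \<in> ?Z" "\<zeta> \<in> closed_segment (?V j) (?V (Suc j))" for z \<zeta>
    proof -
      have "r / 2 \<le> norm \<zeta>" by (rule norm_edge_ge[OF that(2) r])
      moreover have "norm z < r / 4" using that by (simp add: core_sector_def)
      moreover have "norm \<zeta> - norm z \<le> norm (\<zeta> - z)" by (rule norm_triangle_ineq2)
      moreover have "\<kappa> / 8 * norm \<zeta> \<le> 1 / 8 * norm \<zeta>" using \<kappa> by (intro mult_right_mono) auto
      ultimately show ?thesis using r by linarith
    qed
    note * = cauchy_integral_gevrey[OF U 1 hol[OF j edge_in_tri] c _ M' (1) 2 zero[OF j] 3 Z0, folded ge_def]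
    show "ge j n holomorphic_on U"
      unfolding ge_def by (rule *(1)) (use \<kappa> in auto)
    show "\<And>x z N. x \<in> U \<Longrightarrow> z \<in> ?Z \<Longrightarrow>
       norm (contour_integral (linepath (?V j) (?V (Suc j))) (\<lambda>\<zeta>. h j x \<zeta> / (\<zeta> - z)) - (\<Sum>n<N. ge j n x * z ^ n))
        \<le> (M' * norm (?V (Suc j) - ?V j) / (\<kappa> / 8 * c)) * (2 / c) ^ N * fact N * norm z ^ N"
      unfolding ge_def by (rule *(2)) (use \<kappa> in auto)
  qed
  have ray: "gr j n holomorphic_on U"
     "\<And>x z N. x \<in> U \<Longrightarrow> z \<in> ?Z \<Longrightarrow>
       norm (contour_integral (linepath 0 (?V j)) (\<lambda>\<zeta>. J j x \<zeta> / (\<zeta> - z)) - (\<Sum>n<N. gr j n x * z ^ n))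
        \<le> (M' * norm (?V j - 0) / (\<kappa> / 8 * c)) * (2 / c) ^ N * fact N * norm z ^ N" if j: "j < 4" for j n
  proof -
    have j': "(j + 3) mod 4 < 4" by simp
    have "continuous_on (U \<times> closed_segment 0 (?V j)) (\<lambda>y. (case y of (x, \<zeta>) \<Rightarrow> h j x \<zeta>)
            - (case y of (x, \<zeta>) \<Rightarrow> h ((j + 3) mod 4) x \<zeta>))"
      by (intro continuous_on_diff continuous_on_subset[OF cont[OF j]] continuous_on_subset[OF cont[OF j']])
         (auto intro: ray_in_tri)
    then have 1: "continuous_on (U \<times> closed_segment 0 (?V j)) (\<lambda>(x, \<zeta>). J j x \<zeta>)"
      by (simp add: split_def J_def)
    have 2: "norm (J j x \<zeta>) \<le> M' * exp (- c / norm \<zeta>)"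
      if "x \<in> U" "\<zeta> \<in> closed_segment 0 (?V j)" "\<zeta> \<noteq> 0" for x \<zeta>
      unfolding J_def by (rule order_trans[OF jump[OF j that] mult_right_mono[OF M'(2)]]) simp
    have 3: "(\<lambda>x. J j x \<zeta>) holomorphic_on U" if "\<zeta> \<in> closed_segment 0 (?V j)" for \<zeta>
      unfolding J_def by (intro holomorphic_intros hol j j' ray_in_tri that)
    have 4: "J j x 0 = 0" if "x \<in> U" for x
      unfolding J_def by (simp add: zero[OF j that] zero[OF j' that])
    note * = cauchy_integral_gevrey[OF U 1 3 c _ M' (1) 2 4 core_sector_far_from_rays[OF _ \<kappa> r j] Z0]
    show "gr j n holomorphic_on U"
      unfolding gr_def by (rule *(1)) (use \<kappa> in auto)
    show "\<And>x z N. x \<in> U \<Longrightarrow> z \<in> ?Z \<Longrightarrow>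
       norm (contour_integral (linepath 0 (?V j)) (\<lambda>\<zeta>. J j x \<zeta> / (\<zeta> - z)) - (\<Sum>n<N. gr j n x * z ^ n))
        \<le> (M' * norm (?V j - 0) / (\<kappa> / 8 * c)) * (2 / c) ^ N * fact N * norm z ^ N"
      unfolding gr_def by (rule *(2)) (use \<kappa> in auto)
  qed
  define a where "a = (\<Sum>j<4. M' * norm (?V (Suc j) - ?V j) / (\<kappa> / 8 * c) + M' * norm (?V j - 0) / (\<kappa> / 8 * c))"
  define g where "g = (\<lambda>n x. (\<Sum>j<4. ge j n x + gr j n x) / (2 * pi * \<i>))"
  have a0: "0 \<le> a" unfolding a_def using M' \<kappa> c by (intro sum_nonneg) auto
  show thesis
  proof
    show "0 < a / (2 * pi) + 1" "0 < 2 / c" using a0 c by (auto simp: add_nonneg_pos)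
    show "g n holomorphic_on U" for n
      unfolding g_def by (intro holomorphic_intros edge(1) ray(1)) auto
    fix x z N assume x: "x \<in> U" and z: "z \<in> ?Z"
    let ?E = "\<lambda>j. contour_integral (linepath (?V j) (?V (Suc j))) (\<lambda>\<zeta>. h j x \<zeta> / (\<zeta> - z))"
    let ?R = "\<lambda>j. contour_integral (linepath 0 (?V j)) (\<lambda>\<zeta>. J j x \<zeta> / (\<zeta> - z))"
    have "continuous_on (tri r \<kappa> j) (h j x)" if "j < 4" for j
    proof -
      have "continuous_on (tri r \<kappa> j) (\<lambda>\<zeta>. (\<lambda>(x, \<zeta>). h j x \<zeta>) (x, \<zeta>))"
        by (rule continuous_on_compose2[OF cont[OF that]]) (use x in \<open>auto intro!: continuous_intros\<close>)
      then show ?thesis by simp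
    qed
    from cauchy_formula_four_triangles[OF z \<kappa> r this diff[OF _ x]]
    have cf: "2 * pi * \<i> * h 0 x z = (\<Sum>j<4. ?E j + ?R j)"
      by (simp add: J_def)
    have gs: "2 * pi * \<i> * (\<Sum>n<N. g n x * z ^ n) = (\<Sum>j<4. (\<Sum>n<N. ge j n x * z ^ n) + (\<Sum>n<N. gr j n x * z ^ n))"
    proof -
      have "2 * pi * \<i> * (\<Sum>n<N. g n x * z ^ n) = (\<Sum>n<N. \<Sum>j<4. (ge j n x + gr j n x) * z ^ n)"
        unfolding sum_distrib_left by (intro sum.cong refl) (simp add: g_def sum_distrib_right)
      also have "\<dots> = (\<Sum>j<4. \<Sum>n<N. (ge j n x + gr j n x) * z ^ n)" by (rule sum.swap)
      finally show ?thesis by (simp add: distrib_right sum.distrib)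
    qed
    have "2 * pi * norm (h 0 x z - (\<Sum>n<N. g n x * z ^ n)) = norm (2 * pi * \<i> * (h 0 x z - (\<Sum>n<N. g n x * z ^ n)))"
      by (simp add: norm_mult)
    also have "2 * pi * \<i> * (h 0 x z - (\<Sum>n<N. g n x * z ^ n))
        = (\<Sum>j<4. (?E j - (\<Sum>n<N. ge j n x * z ^ n)) + (?R j - (\<Sum>n<N. gr j n x * z ^ n)))"
      unfolding right_diff_distrib cf gs by (simp add: sum.distrib sum_subtractf)
    also have "norm \<dots> \<le> (\<Sum>j<4. (M' * norm (?V (Suc j) - ?V j) / (\<kappa> / 8 * c)) * (2 / c) ^ N * fact N * norm z ^ N
                             + (M' * norm (?V j - 0) / (\<kappa> / 8 * c)) * (2 / c) ^ N * fact N * norm z ^ N)"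
      by (intro sum_norm_le order_trans[OF norm_triangle_ineq] add_mono edge(2)[OF _ x z] ray(2)[OF _ x z]) auto
    also have "\<dots> = a * ((2 / c) ^ N * fact N * norm z ^ N)"
      unfolding a_def sum_distrib_right by (intro sum.cong refl) (simp only: distrib_right mult.assoc)
    finally have "norm (h 0 x z - (\<Sum>n<N. g n x * z ^ n)) \<le> a / (2 * pi) * ((2 / c) ^ N * fact N * norm z ^ N)"
      by (subst times_divide_eq_left, subst pos_le_divide_eq) (simp_all only: mult.commute, simp)
    also have "\<dots> \<le> (a / (2 * pi) + 1) * ((2 / c) ^ N * fact N * norm z ^ N)"
      using c by (intro mult_right_mono) auto
    finally show "norm (h 0 x z - (\<Sum>n<N. g n x * z ^ n)) \<le> (a / (2 * pi) + 1) * (2 / c) ^ N * fact N * norm z ^ N"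
      by (simp only: mult.assoc)
  qed
qed

section \<open>Strips, corners and quadrants\<close>

text \<open>The solutions \<open>p\<close> are known to be bounded but not to have a limit at \<open>\<zeta> = 0\<close>; the factor \<open>\<zeta>\<close>
  makes the Cauchy integral theorem applicable on triangles with vertex 0.\<close>

lemma continuous_on_mult_bounded_puncture:
  fixes U S :: "complex set" and p :: "complex \<Rightarrow> complex \<Rightarrow> complex"
  assumes p: "continuous_on (U \<times> (S - {0})) (\<lambda>(x, \<zeta>). p x \<zeta>)"
    and bd: "\<And>x \<zeta>. x \<in> U \<Longrightarrow> \<zeta> \<in> S \<Longrightarrow> \<zeta> \<noteq> 0 \<Longrightarrow> norm (p x \<zeta>) \<le> P"
  shows "continuous_on (U \<times> S) (\<lambda>(x, \<zeta>). \<zeta> * p x \<zeta>)"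
proof (rule continuous_on_eq_continuous_within[THEN iffD2], rule ballI)
  fix y assume "y \<in> U \<times> S"
  then obtain x \<zeta> where y: "y = (x, \<zeta>)" and mem: "x \<in> U" "\<zeta> \<in> S" by auto
  let ?H = "\<lambda>y. snd y * p (fst y) (snd y)"
  have "continuous (at (x, \<zeta>) within U \<times> S) ?H"
  proof (cases "\<zeta> = 0")
    case False
    have "continuous (at (x, \<zeta>) within U \<times> (S - {0})) (\<lambda>y. p (fst y) (snd y))"
      using p mem False by (auto simp: continuous_on_eq_continuous_within split_def)
    also have "at (x, \<zeta>) within U \<times> (S - {0}) = at (x, \<zeta>) within U \<times> S"
      by (rule at_within_nhd[where S = "UNIV \<times> (- {0})"]) (use False in \<open>auto intro!: open_Times open_Compl\<close>)
    finally show ?thesis by (intro continuous_intros)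
  next
    case True
    have "(?H \<longlongrightarrow> 0) (at (x, \<zeta>) within U \<times> S)"
    proof (rule Lim_null_comparison)
      show "\<forall>\<^sub>F y in at (x, \<zeta>) within U \<times> S. norm (?H y) \<le> norm (snd y) * P"
        unfolding eventually_at_filter
      proof (intro always_eventually allI impI)
        fix y :: "complex \<times> complex" assume "y \<in> U \<times> S"
        then show "norm (?H y) \<le> norm (snd y) * P"
          by (cases "snd y = 0") (auto simp: norm_mult intro!: mult_left_mono bd)
      qed
      show "((\<lambda>y. norm (snd y) * P) \<longlongrightarrow> 0) (at (x, \<zeta>) within U \<times> S)"
        by (rule tendsto_eq_intros refl)+ (use True in auto)
    qed
    then show ?thesis using True by (simp add: continuous_within)
  qed
  then show "continuous (at y within U \<times> S) (\<lambda>(x, \<zeta>). \<zeta> * p x \<zeta>)"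
    by (simp add: split_def y)
qed

definition strip :: "real \<Rightarrow> real \<Rightarrow> real \<Rightarrow> complex set" where
  "strip A B \<eta> = {x. A - \<eta> < Re x \<and> Re x < B + \<eta> \<and> \<bar>Im x\<bar> < \<eta>}"

lemma open_strip: "open (strip A B \<eta>)"
  unfolding strip_def by (intro open_Collect_conj open_Collect_less continuous_intros)

lemma strip_eq: "strip A B \<eta> = box (Complex (A - \<eta>) (- \<eta>)) (Complex (B + \<eta>) \<eta>)"
  by (auto simp: strip_def in_box_complex_iff)

lemma convex_strip: "convex (strip A B \<eta>)"
  unfolding strip_eq by (rule convex_box)

lemma strip_mono: "\<eta> \<le> \<eta>' \<Longrightarrow> strip A B \<eta> \<subseteq> strip A B \<eta>'"
  by (auto simp: strip_def)

lemma of_real_in_strip: "0 < \<eta> \<Longrightarrow> of_real ` {A..B} \<subseteq> strip A B \<eta>"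
  by (auto simp: strip_def)

lemma ball_subset_strip: "x \<in> strip A B \<eta> \<Longrightarrow> ball x \<delta> \<subseteq> strip A B (\<eta> + \<delta>)"
proof
  fix y assume x: "x \<in> strip A B \<eta>" and y: "y \<in> ball x \<delta>"
  have "\<bar>Re (y - x)\<bar> < \<delta>" "\<bar>Im (y - x)\<bar> < \<delta>"
    using y abs_Re_le_cmod[of "y - x"] abs_Im_le_cmod[of "y - x"]
    by (auto simp: dist_norm norm_minus_commute)
  with x show "y \<in> strip A B (\<eta> + \<delta>)" by (auto simp: strip_def)
qed

lemma compact_real_interval_strip:
  assumes "open U" "of_real ` {A..B} \<subseteq> U"
  obtains \<eta> where "0 < \<eta>" "cbox (Complex (A - \<eta>) (- \<eta>)) (Complex (B + \<eta>) \<eta>) \<subseteq> U"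
proof -
  have "compact (of_real ` {A..B} :: complex set)"
    by (intro compact_continuous_image continuous_intros) auto
  then obtain e where e: "0 < e" "(\<Union>x\<in>of_real ` {A..B}. ball x e) \<subseteq> U"
    using compact_subset_open_imp_ball_epsilon_subset assms by metis
  show thesis
  proof (cases "A \<le> B")
    case True
    show thesis
    proof
      show "0 < e / 3" using e by simp
      show "cbox (Complex (A - e / 3) (- (e / 3))) (Complex (B + e / 3) (e / 3)) \<subseteq> U"
      proof
        fix z assume z: "z \<in> cbox (Complex (A - e / 3) (- (e / 3))) (Complex (B + e / 3) (e / 3))"
        define s where "s = max A (min B (Re z))"
        have s: "s \<in> {A..B}" "\<bar>Re z - s\<bar> \<le> e / 3" "\<bar>Im z\<bar> \<le> e / 3"
          using z True by (auto simp: s_def in_cbox_complex_iff max_def min_def)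
        have "norm (of_real s - z) \<le> \<bar>Re (of_real s - z)\<bar> + \<bar>Im (of_real s - z)\<bar>" by (rule cmod_le)
        also have "\<dots> < e" using s e(1) unfolding minus_complex.sel Re_complex_of_real Im_complex_of_real by linarith
        finally have "z \<in> ball (of_real s) e" by (simp add: dist_norm)
        then show "z \<in> U" using e(2) s(1) by blast
      qed
    qed
  next
    case False
    show thesis
    proof
      show "0 < (A - B) / 3" using False by simp
      show "cbox (Complex (A - (A - B) / 3) (- ((A - B) / 3))) (Complex (B + (A - B) / 3) ((A - B) / 3)) \<subseteq> U"
        using False by (auto simp: in_cbox_complex_iff field_simps)
    qed
  qed
qed

text \<open>Seen from the top left corner of a rectangle around the interval, all points of a smaller
  rectangle lie in directions in the open fourth quadrant. Therefore the exponential
  \<open>exp (2 \<i> (s - x) / e)\<close> decays along the segment from the corner to \<open>x\<close>, as \<open>s\<close> moves away from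
  \<open>x\<close>, whenever \<open>e\<close> lies in the first quadrant or slightly below. The corners are listed
  anticlockwise; rotating \<open>x - corner\<close> and \<open>e\<close> by the same angle reduces each of them to this case,
  so that the corner number \<open>j\<close> serves the quadrant of \<open>e\<close> rotated by \<open>j\<close> right angles.\<close>

definition corner :: "real \<Rightarrow> real \<Rightarrow> real \<Rightarrow> nat \<Rightarrow> complex" where
  "corner A B \<eta> j = [Complex (A - 2 * \<eta>) (2 * \<eta>), Complex (A - 2 * \<eta>) (- 2 * \<eta>),
                     Complex (B + 2 * \<eta>) (- 2 * \<eta>), Complex (B + 2 * \<eta>) (2 * \<eta>)] ! j"

definition direction_cone :: "real \<Rightarrow> complex set" where
  "direction_cone \<sigma> = {w. \<sigma> * Re w \<le> - Im w \<and> \<sigma> * - Im w \<le> Re w}"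

definition quadrant :: "real \<Rightarrow> complex set" where
  "quadrant \<kappa> = {e. 0 < Re e \<and> 0 < Im e + 2 * \<kappa> * Re e}"

lemma cone_nonneg:
  assumes "w \<in> direction_cone \<sigma>" "0 < \<sigma>" "\<sigma> < 1"
  shows "0 \<le> Re w" "0 \<le> - Im w"
proof -
  have w: "\<sigma> * Re w \<le> - Im w" "\<sigma> * - Im w \<le> Re w" using assms(1) by (auto simp: direction_cone_def)
  have "\<sigma> * (\<sigma> * Re w) \<le> \<sigma> * - Im w" using w(1) assms by (intro mult_left_mono) auto
  then have "0 \<le> (1 - \<sigma> * \<sigma>) * Re w" using w(2) by (simp add: algebra_simps)
  moreover have "0 < 1 - \<sigma> * \<sigma>" using assms mult_strict_mono[of \<sigma> 1 \<sigma> 1] by simp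
  ultimately show "0 \<le> Re w" by (simp add: zero_le_mult_iff)
  then show "0 \<le> - Im w" using w(1) assms by (meson less_imp_le mult_nonneg_nonneg order_trans)
qed

text \<open>Directions in the fourth quadrant, bounded away from its edges, and parameters \<open>e\<close> in the first
  quadrant, or slightly below it: then \<open>Im (w / e)\<close> is negative, of the order of its largest
  possible size.\<close>

lemma cone_quadrant_decay:
  assumes w: "w \<in> direction_cone \<sigma>" and e: "e \<in> quadrant (\<sigma> / 4)" and \<sigma>: "0 < \<sigma>" "\<sigma> \<le> 1 / 4"
  shows "Im (w * cnj e) \<le> - (\<sigma> / 8) * norm w * norm e"
proof -
  define x y a b where "x = Re w" and "y = - Im w" and "a = Re e" and "b = Im e"
  have xy: "0 \<le> x" "0 \<le> y" "\<sigma> * x \<le> y" "\<sigma> * y \<le> x"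
    using cone_nonneg[OF w] w \<sigma> by (auto simp: x_def y_def direction_cone_def)
  have ab: "0 < a" "0 < b + \<sigma> / 2 * a" using e by (auto simp: quadrant_def a_def b_def)
  have "norm w \<le> x + y" using cmod_le[of w] xy by (simp add: x_def y_def)
  moreover have "norm e \<le> a + \<bar>b\<bar>" using cmod_le[of e] ab by (simp add: a_def b_def)
  ultimately have n: "norm w * norm e \<le> (x + y) * (a + \<bar>b\<bar>)"
    using xy by (intro mult_mono) auto
  have sx: "\<sigma> * y \<le> y" "\<sigma> * x \<le> x" using \<sigma> xy by (auto intro: mult_left_le_one_le)
  have "\<sigma> * (x + y) / 2 \<le> y" using xy sx by (simp add: distrib_left)
  moreover have "\<sigma> * (x + y) / 2 \<le> x" using xy sx by (simp add: distrib_left)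
  ultimately have mn: "\<sigma> * (x + y) / 2 \<le> y" "\<sigma> * (x + y) / 2 \<le> x" .
  have "\<sigma> / 8 * ((x + y) * (a + \<bar>b\<bar>)) \<le> y * a + x * b"
  proof (cases "0 \<le> b")
    case True
    define T where "T = \<sigma> * (x + y)"
    have "T / 2 * a \<le> y * a" by (rule mult_right_mono) (use mn ab in \<open>simp_all add: T_def\<close>)
    moreover have "T / 2 * b \<le> x * b" by (rule mult_right_mono) (use mn True in \<open>simp_all add: T_def\<close>)
    moreover have "0 \<le> T * a" "0 \<le> T * b" using \<sigma> xy ab True by (simp_all add: T_def)
    moreover have "\<sigma> / 8 * ((x + y) * (a + \<bar>b\<bar>)) = (T * a + T * b) / 8"
      using True by (simp add: T_def algebra_simps)
    ultimately show ?thesis by (simp add: field_simps)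
  next
    case False
    have "x * - b \<le> x * (\<sigma> / 2 * a)" using ab xy by (intro mult_left_mono) auto
    also have "\<dots> = \<sigma> * x * a / 2" by simp
    also have "\<dots> \<le> y * a / 2" using xy ab by (simp add: mult_right_mono)
    finally have 1: "y * a / 2 \<le> y * a + x * b" by (simp add: field_simps)
    have "\<sigma> / 2 * a \<le> 1 / 8 * a" using \<sigma> ab by (intro mult_right_mono) auto
    then have "a + \<bar>b\<bar> \<le> 2 * a" using False ab by linarith
    then have "\<sigma> / 8 * ((x + y) * (a + \<bar>b\<bar>)) \<le> \<sigma> / 8 * ((x + y) * (2 * a))"
      using \<sigma> xy by (intro mult_left_mono) auto
    also have "\<dots> = (\<sigma> * (x + y) / 2) * a / 2" by simp
    also have "\<dots> \<le> y * a / 2" using mn ab by (intro divide_right_mono mult_right_mono) auto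
    finally show ?thesis using 1 by linarith
  qed
  moreover have "Im (w * cnj e) = - (y * a + x * b)" by (simp add: x_def y_def a_def b_def)
  moreover have "\<sigma> / 8 * (norm w * norm e) \<le> \<sigma> / 8 * ((x + y) * (a + \<bar>b\<bar>))"
    using n \<sigma> by (intro mult_left_mono) auto
  ultimately show ?thesis by simp
qed

lemma rotation_cancel: "\<i> ^ j * (- \<i>) ^ j = 1"
  by (simp flip: power_mult_distrib)

lemma Im_mult_cnj_rotate: "Im (v * cnj e) = Im ((v * (- \<i>) ^ j) * cnj (e * (- \<i>) ^ j))"
proof -
  have "(v * (- \<i>) ^ j) * cnj (e * (- \<i>) ^ j) = v * cnj e * (\<i> ^ j * (- \<i>) ^ j)"
    by (simp add: mult_ac)
  then show ?thesis by (simp only: rotation_cancel) simp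
qed

lemma norm_rotate: "norm (v * (- \<i>) ^ j) = norm v"
  by (simp add: norm_mult norm_power)

text \<open>Both the width and the height of \<open>x - corner\<close> lie between \<open>\<eta>\<close> and \<open>B - A + 4 \<eta>\<close>.\<close>

lemma strip_in_corner_cone:
  assumes x: "x \<in> strip A B \<eta>" and "A \<le> B" "0 < \<eta>" "j < 4"
  shows "(x - corner A B \<eta> j) * (- \<i>) ^ j \<in> direction_cone (\<eta> / (B - A + 4 * \<eta>))"
proof -
  define L where "L = B - A + 4 * \<eta>"
  have L: "4 * \<eta> \<le> L" "0 < L" using assms by (auto simp: L_def)
  have key: "\<eta> / L * s \<le> t" if "\<eta> \<le> t" "s \<le> L" "0 \<le> s" for s t
  proof -
    have "\<eta> / L * s \<le> \<eta> / L * L" using that L assms by (intro mult_left_mono) auto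
    then show ?thesis using that L by simp
  qed
  have j: "j = 0 \<or> j = 1 \<or> j = 2 \<or> j = 3" using assms(4) by linarith
  show ?thesis
    unfolding L_def[symmetric] direction_cone_def mem_Collect_eq using j x assms(2,3)
    by (elim disjE; intro conjI key)
       (auto simp: corner_def strip_def L_def power2_eq_square power3_eq_cube numeral_eq_Suc)
qed

lemma tri_subset_quadrant:
  assumes "\<zeta> \<in> tri r \<kappa> j" "\<zeta> \<noteq> 0" "0 < r" "0 < \<kappa>"
  shows "\<zeta> * (- \<i>) ^ j \<in> quadrant \<kappa>"
proof -
  obtain u v where uv: "0 \<le> u" "0 \<le> v" "\<zeta> = tri_vertex r \<kappa> j * Complex u v"
    using assms(1) unfolding mem_tri_iff by blast
  have "\<zeta> * (- \<i>) ^ j = of_real r * Complex 1 (- \<kappa>) * Complex u v * (\<i> ^ j * (- \<i>) ^ j)"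
    by (simp add: uv(3) tri_vertex_def mult_ac)
  also have "\<dots> = Complex (r * (u + \<kappa> * v)) (r * (v - \<kappa> * u))"
    unfolding rotation_cancel by (simp add: complex_eq_iff algebra_simps)
  finally have eq: "\<zeta> * (- \<i>) ^ j = Complex (r * (u + \<kappa> * v)) (r * (v - \<kappa> * u))" .
  have "u \<noteq> 0 \<or> v \<noteq> 0" using assms(2) uv by (auto simp: complex_eq_iff)
  have "0 < u + \<kappa> * v \<and> 0 < v + \<kappa> * u + 2 * \<kappa> * (\<kappa> * v)"
  proof (cases "v = 0")
    case True
    with \<open>u \<noteq> 0 \<or> v \<noteq> 0\<close> uv(1) have "0 < u" by auto
    then show ?thesis using True assms(4) by simp
  next
    case False
    then have "0 < v" using uv(2) by auto
    then have "0 < \<kappa> * v" "0 < \<kappa> * (\<kappa> * v)" "0 \<le> \<kappa> * u" using assms(4) uv(1) by auto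
    then show ?thesis using uv \<open>0 < v\<close> by simp
  qed
  moreover have "Im (\<zeta> * (- \<i>) ^ j) + 2 * \<kappa> * Re (\<zeta> * (- \<i>) ^ j) = r * (v + \<kappa> * u + 2 * \<kappa> * (\<kappa> * v))"
    unfolding eq by (simp add: algebra_simps)
  ultimately show ?thesis using assms(3) unfolding quadrant_def mem_Collect_eq by (simp add: eq)
qed

lemma norm_tri_le:
  assumes "\<zeta> \<in> tri r \<kappa> j" "0 < r" "0 < \<kappa>" "\<kappa> \<le> 1"
  shows "norm \<zeta> \<le> 2 * r"
proof -
  obtain u v where uv: "0 \<le> u" "0 \<le> v" "u + v \<le> 1" "\<zeta> = tri_vertex r \<kappa> j * Complex u v"
    using assms(1) unfolding mem_tri_iff by blast
  have "norm (Complex 1 (- \<kappa>)) \<le> 2" using cmod_le[of "Complex 1 (- \<kappa>)"] assms by simp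
  moreover have "norm (Complex u v) \<le> 1" using cmod_le[of "Complex u v"] uv by simp
  ultimately have "r * norm (Complex 1 (- \<kappa>)) * norm (Complex u v) \<le> r * 2 * 1"
    using assms(2) by (intro mult_mono) auto
  then show ?thesis using assms(2) by (simp add: uv(4) tri_vertex_def norm_mult norm_power)
qed

section \<open>The Gevrey solution of the Riccati equation\<close>

text \<open>A family \<open>F t\<close> of functions of \<open>z \<in> Z\<close> with asymptotic expansion \<open>\<Sum>n. c n t * z ^ n\<close> of Gevrey
  order 1, uniformly in \<open>t \<in> D\<close>. The coefficients are a parameter, because the first two of
  them have to be identified. Continuity at the vertex \<open>z = 0\<close> is contained in
  the estimate for \<open>N = 1\<close>, as \<open>F t 0 = c 0 t\<close>.\<close>

definition gevrey_family ::
    "complex set \<Rightarrow> complex set \<Rightarrow> (complex \<Rightarrow> complex \<Rightarrow> complex) \<Rightarrow> (nat \<Rightarrow> complex \<Rightarrow> complex) \<Rightarrow> bool" where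
  "gevrey_family D Z F c \<longleftrightarrow>
     (\<forall>z\<in>Z. (\<lambda>t. F t z) holomorphic_on D) \<and> (\<forall>t\<in>D. F t holomorphic_on Z) \<and>
     (\<forall>n. c n holomorphic_on D) \<and> (\<forall>t\<in>D. F t 0 = c 0 t) \<and>
     (\<exists>A B. 0 < A \<and> 0 < B \<and> (\<forall>N. \<forall>t\<in>D. \<forall>z\<in>Z.
        norm (F t z - (\<Sum>n<N. c n t * z ^ n)) \<le> A * B ^ N * fact N * norm z ^ N))"

lemma zero_if_small_on_core_sector:
  fixes a :: complex
  assumes "0 < r" "0 < \<kappa>" and a: "\<And>z. z \<in> core_sector r \<kappa> \<Longrightarrow> norm a \<le> C * norm z"
  shows "a = 0"
proof (rule ccontr)
  assume "a \<noteq> 0"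
  define t where "t = min (r / 8) (norm a / (2 * (\<bar>C\<bar> + 1)))"
  have t: "0 < t" "t < r / 4" using assms \<open>a \<noteq> 0\<close> by (auto simp: t_def)
  then have "of_real t \<in> core_sector r \<kappa>" using assms by (auto simp: core_sector_def)
  from a[OF this] have "norm a \<le> C * t" using t by simp
  also have "\<dots> \<le> (\<bar>C\<bar> + 1) * t" using t by (intro mult_right_mono) auto
  also have "\<dots> \<le> (\<bar>C\<bar> + 1) * (norm a / (2 * (\<bar>C\<bar> + 1)))" by (intro mult_left_mono) (auto simp: t_def)
  also have "\<dots> = norm a / 2" by (simp add: field_simps)
  finally show False using \<open>a \<noteq> 0\<close> by simp
qed

text \<open>Four solutions, one for each corner and each quadrant of the parameter, differ by exponentially
  small amounts on the common rays, since these rays carry two bounded solutions of the same equation.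
  So the four-triangle principle gives the expansion of the first one, whose quadrant contains
  a sector about the positive axis. The coefficient of order 0 vanishes because \<open>w = z p\<close> with bounded \<open>p\<close>;
  that of order 1 is the limit of \<open>p\<close>, which the equation gives, as \<open>z p'\<close> tends to 0 by Cauchy's
  inequality.\<close>

proposition riccati_gevrey_solution:
  assumes U: "open U" "of_real ` {A..B} \<subseteq> U" and AB: "A \<le> B" and k: "k holomorphic_on U"
  obtains \<eta> r \<kappa> w c where "0 < \<eta>" "0 < r" "0 < \<kappa>" "\<kappa> \<le> 1" "strip A B \<eta> \<subseteq> U"
    and "gevrey_family (strip A B \<eta>) (core_sector r \<kappa>) w c"
    and "\<And>x. x \<in> strip A B \<eta> \<Longrightarrow> c 0 x = 0" "\<And>x. x \<in> strip A B \<eta> \<Longrightarrow> c 1 x = - k x / 2"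
    and "\<And>x z. x \<in> strip A B \<eta> \<Longrightarrow> z \<in> core_sector r \<kappa> \<Longrightarrow>
           ((\<lambda>x. w x z) has_field_derivative (- 2 * \<i> * w x z - (w x z)\<^sup>2 - z * k x * (\<i> + w x z)) / z) (at x)"
proof -
  obtain \<eta>0 where \<eta>0: "0 < \<eta>0" "cbox (Complex (A - \<eta>0) (- \<eta>0)) (Complex (B + \<eta>0) \<eta>0) \<subseteq> U"
    using compact_real_interval_strip[OF U] by blast
  define \<eta> where "\<eta> = \<eta>0 / 3"
  have \<eta>: "0 < \<eta>" using \<eta>0 by (simp add: \<eta>_def)
  define R where "R = strip A B (3 * \<eta>)"
  have Rsub: "R \<subseteq> cbox (Complex (A - \<eta>0) (- \<eta>0)) (Complex (B + \<eta>0) \<eta>0)"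
    by (auto simp: R_def strip_def in_cbox_complex_iff \<eta>_def)
  have R: "open R" "convex R" "k holomorphic_on R" and RU: "R \<subseteq> U"
    using Rsub \<eta>0 holomorphic_on_subset[OF k] by (auto simp: R_def open_strip convex_strip)
  have "compact (k ` cbox (Complex (A - \<eta>0) (- \<eta>0)) (Complex (B + \<eta>0) \<eta>0))"
    by (intro compact_continuous_image compact_cbox continuous_on_subset[OF holomorphic_on_imp_continuous_on[OF k] \<eta>0(2)])
  then obtain K where K: "0 < K" "\<And>x. x \<in> R \<Longrightarrow> norm (k x) \<le> K"
    using Rsub unfolding bounded_pos[THEN iffD1, OF compact_imp_bounded]
    by (metis (no_types, lifting) bounded_pos compact_imp_bounded image_eqI subsetD)
  \<comment> \<open>\<open>\<sigma>\<close> bounds the slopes of the directions from the corners; \<open>m\<close> is the resulting decay rate and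
      \<open>\<kappa>\<close> the admissible tilt of the triangles.\<close>
  define \<sigma> where "\<sigma> = \<eta> / (B - A + 4 * \<eta>)"
  have \<sigma>: "0 < \<sigma>" "\<sigma> \<le> 1 / 4" using \<eta> AB by (auto simp: \<sigma>_def divide_simps)
  define m P \<kappa> where "m = \<sigma> / 8" and "P = K / (2 * m) + 1" and "\<kappa> = \<sigma> / 4"
  have m: "0 < m" using \<sigma> by (simp add: m_def)
  have P: "0 < P" using m K by (simp add: P_def add_nonneg_pos)
  have \<kappa>: "0 < \<kappa>" "\<kappa> \<le> 1" using \<sigma> by (auto simp: \<kappa>_def)
  \<comment> \<open>The denominator dominates both smallness conditions of the Picard iteration; a triangle of
      size \<open>r1 / 4\<close> lies in the disc of radius \<open>r1\<close>.\<close>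
  define r1 r where "r1 = m / (P\<^sup>2 + K * P + 2 * P + K + 1)" and "r = r1 / 4"
  have den': "0 \<le> P\<^sup>2" "0 \<le> K * P" using P K by auto
  have den: "0 < P\<^sup>2 + K * P + 2 * P + K + 1" using den' P K(1) by linarith
  note den = den den'
  have r1: "0 < r1" "r1 * (P\<^sup>2 + K * P + 2 * P + K + 1) = m" using m den by (auto simp: r1_def)
  have r: "0 < r" using r1 by (simp add: r_def)
  define W where "W = strip A B \<eta>"
  define C where "C = (\<lambda>j. {x \<in> R. (x - corner A B \<eta> j) * (- \<i>) ^ j \<in> direction_cone \<sigma>})"
  define S where "S = (\<lambda>j. {e. norm e < r1 \<and> e * (- \<i>) ^ j \<in> quadrant \<kappa>})"
  define Q where "Q = (\<lambda>j p. continuous_on (W \<times> S j) (\<lambda>(x, e). p x e) \<and>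
      (\<forall>x\<in>W. \<forall>e\<in>S j. norm (p x e) \<le> P) \<and> (\<forall>e\<in>S j. (\<lambda>x. p x e) holomorphic_on W) \<and>
      (\<forall>x\<in>W. p x holomorphic_on S j) \<and>
      (\<forall>x\<in>W. \<forall>e\<in>S j. ((\<lambda>x. p x e) has_field_derivative - (2 * \<i> / e) * p x e - riccati_source k p x e) (at x)))"
  have openS: "open (S j)" and S0: "0 \<notin> S j" for j
  proof -
    show "open (S j)"
      unfolding S_def quadrant_def mem_Collect_eq
      by (intro open_Collect_conj open_Collect_less continuous_intros)
    show "0 \<notin> S j" by (simp add: S_def quadrant_def)
  qed
  have sol: "\<exists>p. Q j p" if j: "j < 4" for j
  proof -
    have j': "j = 0 \<or> j = 1 \<or> j = 2 \<or> j = 3" using j by linarith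
    have bR: "corner A B \<eta> j \<in> R"
      using j' \<eta> AB by (elim disjE) (auto simp: R_def strip_def corner_def numeral_eq_Suc)
    have bC: "corner A B \<eta> j \<in> C j" using bR by (simp add: C_def direction_cone_def)
    have seg: "closed_segment (corner A B \<eta> j) x \<subseteq> C j" if x: "x \<in> C j" for x
    proof
      fix y assume y: "y \<in> closed_segment (corner A B \<eta> j) x"
      then obtain t where t: "0 \<le> t" "t \<le> 1" "y = (1 - t) *\<^sub>R corner A B \<eta> j + t *\<^sub>R x"
        by (auto simp: in_segment)
      have "y \<in> R" using y x bR R(2) closed_segment_subset[of "corner A B \<eta> j" R x] by (auto simp: C_def)
      moreover have "(y - corner A B \<eta> j) * (- \<i>) ^ j = t *\<^sub>R ((x - corner A B \<eta> j) * (- \<i>) ^ j)"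
        by (simp add: t(3) scaleR_conv_of_real algebra_simps)
      moreover have "t *\<^sub>R v \<in> direction_cone \<sigma>" if "v \<in> direction_cone \<sigma>" for v
        using that t mult_left_mono[of "\<sigma> * Re v" "- Im v" t] mult_left_mono[of "\<sigma> * - Im v" "Re v" t]
        by (simp add: direction_cone_def mult_ac)
      ultimately show "y \<in> C j" using x by (simp add: C_def)
    qed
    have decay: "Im ((x - corner A B \<eta> j) * cnj e) \<le> - m * norm (x - corner A B \<eta> j) * norm e"
      if "x \<in> C j" "e \<in> S j" for x e
      using cone_quadrant_decay[OF _ _ \<sigma>, of "(x - corner A B \<eta> j) * (- \<i>) ^ j" "e * (- \<i>) ^ j"] that
      unfolding Im_mult_cnj_rotate[of "x - corner A B \<eta> j" e j] norm_rotate
      by (simp add: C_def S_def \<kappa>_def m_def)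
    have small: "norm e * (P\<^sup>2 + K * P) \<le> m" "norm e * (2 * P + K) \<le> m" if "e \<in> S j" for e
    proof -
      have e: "norm e \<le> r1" using that by (simp add: S_def)
      have "norm e * (P\<^sup>2 + K * P) \<le> r1 * (P\<^sup>2 + K * P + 2 * P + K + 1)"
        using e r1 den P K by (intro mult_mono) auto
      moreover have "norm e * (2 * P + K) \<le> r1 * (P\<^sup>2 + K * P + 2 * P + K + 1)"
        using e r1 den P K by (intro mult_mono) auto
      ultimately show "norm e * (P\<^sup>2 + K * P) \<le> m" "norm e * (2 * P + K) \<le> m" using r1 by auto
    qed
    have WC: "W \<subseteq> C j"
      using strip_in_corner_cone[OF _ AB \<eta> j] strip_mono[of \<eta> "3 * \<eta>" A B] \<eta>
      by (auto simp: C_def W_def R_def \<sigma>_def)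
    show ?thesis
      unfolding Q_def
      by (rule riccati_solution[OF R _ bC seg _ m openS S0 decay P_def small _ WC])
         (auto simp: C_def W_def open_strip intro: K(2))
  qed
  define p where "p = (\<lambda>j. SOME p. Q j p)"
  have Qp: "Q j (p j)" if "j < 4" for j
    unfolding p_def by (rule someI_ex[OF sol[OF that]])
  have triS: "\<zeta> \<in> S j" if "\<zeta> \<in> tri r \<kappa> j" "\<zeta> \<noteq> 0" for j \<zeta>
    using tri_subset_quadrant[OF that r \<kappa>(1)] norm_tri_le[OF that(1) r \<kappa>] r1
    by (simp add: S_def r_def)
  define D where "D = strip A B (\<eta> / 2)"
  have DW: "D \<subseteq> W" using \<eta> by (auto simp: D_def W_def intro!: strip_mono)
  have WR: "W \<subseteq> R" using \<eta> by (auto simp: R_def W_def intro!: strip_mono)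
  have ballW: "ball x (\<eta> / 2) \<subseteq> W" if "x \<in> D" for x
    using ball_subset_strip[of x A B "\<eta> / 2" "\<eta> / 2"] that by (simp add: D_def W_def)
  define h where "h = (\<lambda>j x \<zeta>. \<zeta> * p j x \<zeta>)"
  define E where "E = 2 * P * exp ((2 * P + K) * (\<eta> / 4))"
  have E0: "0 \<le> E" using P by (simp add: E_def)
  \<comment> \<open>One constant for both requirements: \<open>2 r P\<close> bounds \<open>|h|\<close>, and \<open>2 r E\<close> bounds the factor of the
      exponential in the jumps.\<close>
  define M where "M = 2 * r * (P + E)"
  have nb: "norm (h j x \<zeta>) \<le> 2 * r * P" if "j < 4" "x \<in> W" "\<zeta> \<in> tri r \<kappa> j" for j x \<zeta>
  proof (cases "\<zeta> = 0")
    case True then show ?thesis using r P by (simp add: h_def)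
  next
    case False
    have "norm (p j x \<zeta>) \<le> P" using Qp[OF that(1)] that triS[OF that(3) False] by (auto simp: Q_def)
    then show ?thesis unfolding h_def norm_mult
      using norm_tri_le[OF that(3) r \<kappa>] r by (intro mult_mono) auto
  qed
  obtain g A' B' where A': "0 < A'" "0 < B'" and g: "\<And>n. g n holomorphic_on D"
    and exp: "\<And>x z N. x \<in> D \<Longrightarrow> z \<in> core_sector r \<kappa> \<Longrightarrow>
           norm (h 0 x z - (\<Sum>n<N. g n x * z ^ n)) \<le> A' * B' ^ N * fact N * norm z ^ N"
  proof (rule four_triangles_gevrey[where h = h and U = D and M = M and c = "\<eta> / 2" and r = r and \<kappa> = \<kappa>])
    show "open D" by (simp add: D_def open_strip)
    show "0 < \<eta> / 2" "0 \<le> M" using \<eta> r P E0 by (auto simp: M_def)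
    fix j :: nat assume j: "j < 4"
    show "continuous_on (D \<times> tri r \<kappa> j) (\<lambda>(x, \<zeta>). h j x \<zeta>)"
      unfolding h_def
    proof (rule continuous_on_mult_bounded_puncture[where p = "p j" and P = P])
      show "continuous_on (D \<times> (tri r \<kappa> j - {0})) (\<lambda>(x, \<zeta>). p j x \<zeta>)"
        by (rule continuous_on_subset[of "W \<times> S j"]) (use Qp[OF j] DW triS in \<open>auto simp: Q_def\<close>)
      show "norm (p j x \<zeta>) \<le> P" if "x \<in> D" "\<zeta> \<in> tri r \<kappa> j" "\<zeta> \<noteq> 0" for x \<zeta>
        using Qp[OF j] that DW triS by (auto simp: Q_def)
    qed
    show "(\<lambda>x. h j x \<zeta>) holomorphic_on D" if "\<zeta> \<in> tri r \<kappa> j" for \<zeta>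
    proof (cases "\<zeta> = 0")
      case False
      then have "(\<lambda>x. p j x \<zeta>) holomorphic_on W" using Qp[OF j] triS[OF that] by (auto simp: Q_def)
      then show ?thesis unfolding h_def by (intro holomorphic_intros) (rule holomorphic_on_subset[OF _ DW])
    qed (simp add: h_def)
    show "h j x field_differentiable at \<zeta>" if "x \<in> D" "\<zeta> \<in> tri r \<kappa> j" "\<zeta> \<noteq> 0" for x \<zeta>
    proof -
      have "p j x holomorphic_on S j" using Qp[OF j] that DW by (auto simp: Q_def)
      then have "h j x holomorphic_on S j" unfolding h_def by (intro holomorphic_intros)
      then show ?thesis using openS triS[OF that(2,3)] by (rule holomorphic_on_imp_differentiable_at)
    qed
    show "norm (h j x \<zeta>) \<le> M" if "x \<in> D" "\<zeta> \<in> tri r \<kappa> j" for x \<zeta>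
    proof -
      have "norm (h j x \<zeta>) \<le> 2 * r * P" using nb[OF j _ that(2)] that DW by auto
      also have "\<dots> \<le> M" unfolding M_def using r E0 by (intro mult_left_mono) auto
      finally show ?thesis .
    qed
    show "h j x 0 = 0" if "x \<in> D" for x by (simp add: h_def)
    show "norm (h j x \<zeta> - h ((j + 3) mod 4) x \<zeta>) \<le> M * exp (- (\<eta> / 2) / norm \<zeta>)"
      if x: "x \<in> D" and \<zeta>: "\<zeta> \<in> closed_segment 0 (tri_vertex r \<kappa> j)" "\<zeta> \<noteq> 0" for x \<zeta>
    proof -
      let ?j = "(j + 3) mod 4"
      have j': "?j < 4" by simp
      have \<zeta>S: "\<zeta> \<in> S j" "\<zeta> \<in> S ?j" using triS ray_in_tri[OF \<zeta>(1)] \<zeta>(2) by auto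
      have bW: "y \<in> W" if "y \<in> ball x (2 * (\<eta> / 4))" for y
        using ballW[OF x] that by auto
      have "norm (p j x \<zeta> - p ?j x \<zeta>) \<le> 2 * P * exp ((2 * P + K) * (\<eta> / 4)) * exp (- (2 * (\<eta> / 4)) / norm \<zeta>)"
      proof (rule riccati_difference_exp_small[where k = k and p = "p j" and q = "p ?j" and e = \<zeta> and \<rho> = "\<eta> / 4" and P = P and K = K])
        show "k holomorphic_on ball x (2 * (\<eta> / 4))"
          by (rule holomorphic_on_subset[OF R(3)]) (use bW WR in auto)
      qed (use \<eta> \<zeta>(2) \<zeta>S bW WR K(2) Qp[OF j] Qp[OF j'] in \<open>auto simp: Q_def\<close>)
      then have d: "norm (p j x \<zeta> - p ?j x \<zeta>) \<le> E * exp (- (\<eta> / 2) / norm \<zeta>)"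
        by (simp add: E_def)
      have "norm (h j x \<zeta> - h ?j x \<zeta>) = norm \<zeta> * norm (p j x \<zeta> - p ?j x \<zeta>)"
        by (simp add: h_def norm_mult flip: right_diff_distrib)
      also have "\<dots> \<le> 2 * r * (E * exp (- (\<eta> / 2) / norm \<zeta>))"
        using norm_tri_le[OF ray_in_tri(1)[OF \<zeta>(1)] r \<kappa>] r by (intro mult_mono d) auto
      also have "\<dots> \<le> 2 * r * ((P + E) * exp (- (\<eta> / 2) / norm \<zeta>))"
        using r P by (intro mult_left_mono mult_right_mono) auto
      finally show ?thesis by (simp add: M_def mult.assoc)
    qed
  qed (use \<kappa> r in auto)
  have ZS: "z \<in> tri r \<kappa> 0" "z \<in> S 0" "z \<noteq> 0" if "z \<in> core_sector r \<kappa>" for z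
  proof -
    show 1: "z \<in> tri r \<kappa> 0" using core_sector_interior_tri[OF that \<kappa> r] interior_subset by blast
    show 2: "z \<noteq> 0" using that by (auto simp: core_sector_def)
    show "z \<in> S 0" by (rule triS[OF 1 2])
  qed
  have p0: "norm (p 0 x z) \<le> P"
     "((\<lambda>x. p 0 x z) has_field_derivative - (2 * \<i> / z) * p 0 x z - riccati_source k (p 0) x z) (at x)"
    if "x \<in> W" "z \<in> core_sector r \<kappa>" for x z
    using Qp[of 0] that ZS[OF that(2)] by (auto simp: Q_def)
  have g0: "g 0 x = 0" if x: "x \<in> D" for x
  proof (rule zero_if_small_on_core_sector[OF r \<kappa>(1)])
    fix z assume z: "z \<in> core_sector r \<kappa>"
    have "norm (h 0 x z - g 0 x) \<le> A' * B' * norm z" using exp[OF x z, of 1] by simp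
    moreover have "norm (h 0 x z) \<le> norm z * P"
      unfolding h_def norm_mult using p0(1)[OF _ z] x DW by (intro mult_left_mono) auto
    moreover have "norm (g 0 x) \<le> norm (h 0 x z) + norm (h 0 x z - g 0 x)"
      using norm_triangle_ineq4[of "h 0 x z" "h 0 x z - g 0 x"] by simp
    ultimately show "norm (g 0 x) \<le> (P + A' * B') * norm z" by (simp add: algebra_simps)
  qed
  have g1: "g 1 x = - k x / 2" if x: "x \<in> D" for x
  proof -
    have xW: "x \<in> W" "x \<in> R" using x DW WR by auto
    have "g 1 x + k x / 2 = 0"
    proof (rule zero_if_small_on_core_sector[OF r \<kappa>(1)])
      fix z assume z: "z \<in> core_sector r \<kappa>"
      have z0: "z \<noteq> 0" by (rule ZS(3)[OF z])
      let ?p = "p 0 x z"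
      define d where "d = - (2 * \<i> / z) * ?p - riccati_source k (p 0) x z"
      have "norm (h 0 x z - g 1 x * z) \<le> A' * B'\<^sup>2 * 2 * (norm z)\<^sup>2"
        using exp[OF x z, of 2] g0[OF x] by (simp add: numeral_2_eq_2)
      moreover have "norm (h 0 x z - g 1 x * z) = norm z * norm (?p - g 1 x)"
      proof -
        have "h 0 x z - g 1 x * z = z * (?p - g 1 x)" by (simp add: h_def right_diff_distrib)
        then show ?thesis by (simp only: norm_mult)
      qed
      ultimately have "norm z * norm (?p - g 1 x) \<le> norm z * (A' * B'\<^sup>2 * 2 * norm z)"
        by (simp add: power2_eq_square mult_ac)
      then have 1: "norm (?p - g 1 x) \<le> 2 * A' * B'\<^sup>2 * norm z" using z0 by simp
      have cb: "cball x (\<eta> / 4) \<subseteq> W" using ballW[OF x] \<eta> by (auto simp: subset_iff)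
      have hol: "(\<lambda>x. p 0 x z) holomorphic_on W" using Qp[of 0] ZS(2)[OF z] by (simp add: Q_def)
      have "norm ((deriv ^^ 1) (\<lambda>x. p 0 x z) x) \<le> fact 1 * P / (\<eta> / 4) ^ 1"
      proof (rule Cauchy_inequality)
        show "(\<lambda>x. p 0 x z) holomorphic_on ball x (\<eta> / 4)"
          by (rule holomorphic_on_subset[OF hol]) (use cb in auto)
        show "continuous_on (cball x (\<eta> / 4)) (\<lambda>x. p 0 x z)"
          by (rule continuous_on_subset[OF holomorphic_on_imp_continuous_on[OF hol] cb])
        show "norm (p 0 y z) \<le> P" if "norm (x - y) = \<eta> / 4" for y
          using cb that by (intro p0(1)[OF _ z]) (auto simp: dist_norm)
      qed (use \<eta> in auto)
      moreover have "deriv (\<lambda>x. p 0 x z) x = d"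
        unfolding d_def by (rule DERIV_imp_deriv[OF p0(2)[OF xW(1) z]])
      ultimately have nd: "norm d \<le> 4 * P / \<eta>" by (simp add: mult.commute)
      have "- \<i> * (2 * ?p + k x) = z * (d + ?p\<^sup>2 + k x * ?p)"
        using z0 by (simp add: d_def field_simps)
      then have "norm (2 * ?p + k x) = norm z * norm (d + ?p\<^sup>2 + k x * ?p)"
        by (metis norm_ii norm_minus_cancel norm_mult mult_1)
      also have "norm (d + ?p\<^sup>2 + k x * ?p) \<le> 4 * P / \<eta> + P\<^sup>2 + K * P"
        by (intro order_trans[OF norm_triangle_ineq] add_mono nd)
           (use p0(1)[OF xW(1) z] K(2)[OF xW(2)] K(1) in \<open>auto simp: norm_mult norm_power intro!: power_mono mult_mono\<close>)
      finally have 2: "norm (2 * ?p + k x) \<le> norm z * (4 * P / \<eta> + P\<^sup>2 + K * P)"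
        by (simp add: mult_left_mono)
      have "g 1 x + k x / 2 = (2 * ?p + k x) / 2 - (?p - g 1 x)" by (simp add: field_simps)
      then have "norm (g 1 x + k x / 2) \<le> norm ((2 * ?p + k x) / 2) + norm (?p - g 1 x)"
        using norm_triangle_ineq4 by metis
      also have "\<dots> \<le> norm z * (4 * P / \<eta> + P\<^sup>2 + K * P) / 2 + 2 * A' * B'\<^sup>2 * norm z"
        unfolding norm_divide norm_numeral by (intro add_mono divide_right_mono 1 2) simp
      finally show "norm (g 1 x + k x / 2) \<le> ((4 * P / \<eta> + P\<^sup>2 + K * P) / 2 + 2 * A' * B'\<^sup>2) * norm z"
        by (simp add: algebra_simps)
    qed
    then show ?thesis by (simp add: eq_neg_iff_add_eq_0)
  qed
  show thesis
  proof
    show "0 < \<eta> / 2" "0 < r" "0 < \<kappa>" "\<kappa> \<le> 1" using \<eta> r \<kappa> by auto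
    show "strip A B (\<eta> / 2) \<subseteq> U" using DW WR RU by (auto simp: D_def)
    show "gevrey_family (strip A B (\<eta> / 2)) (core_sector r \<kappa>) (h 0) g"
      unfolding gevrey_family_def D_def[symmetric]
    proof (intro conjI ballI allI)
      fix z assume z: "z \<in> core_sector r \<kappa>"
      have "(\<lambda>x. p 0 x z) holomorphic_on W" using Qp[of 0] ZS(2)[OF z] by (simp add: Q_def)
      then show "(\<lambda>x. h 0 x z) holomorphic_on D"
        unfolding h_def by (intro holomorphic_intros) (rule holomorphic_on_subset[OF _ DW])
    next
      fix x assume x: "x \<in> D"
      have "p 0 x holomorphic_on S 0" using Qp[of 0] x DW by (auto simp: Q_def)
      then have "h 0 x holomorphic_on S 0" unfolding h_def by (intro holomorphic_intros)
      then show "h 0 x holomorphic_on core_sector r \<kappa>"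
        by (rule holomorphic_on_subset) (use ZS in auto)
      show "h 0 x 0 = g 0 x" by (simp add: h_def g0[OF x])
    qed (use g exp A' in blast)+
    show "g 0 x = 0" "g 1 x = - k x / 2" if "x \<in> strip A B (\<eta> / 2)" for x
      using g0 g1 that by (auto simp: D_def)
    fix x z assume x: "x \<in> strip A B (\<eta> / 2)" and z: "z \<in> core_sector r \<kappa>"
    have "x \<in> W" using x DW by (auto simp: D_def)
    show "((\<lambda>x. h 0 x z) has_field_derivative
             (- 2 * \<i> * h 0 x z - (h 0 x z)\<^sup>2 - z * k x * (\<i> + h 0 x z)) / z) (at x)"
      unfolding h_def
      by (rule derivative_eq_intros p0(2)[OF \<open>x \<in> W\<close> z] refl)+
         (use ZS(3)[OF z] in \<open>simp add: field_simps power2_eq_square\<close>)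
  qed
qed

section \<open>Operations on Gevrey families\<close>

lemma sector_subset_core_sector:
  assumes "0 < r" "0 < \<kappa>"
  obtains \<theta> where "0 < \<theta>" "\<theta> < 2 * pi" "sector \<theta> \<inter> ball 0 (r / 4) \<subseteq> core_sector r \<kappa>"
proof
  let ?\<theta> = "2 * arctan (\<kappa> / 4)"
  show "0 < ?\<theta>" using assms by simp
  show "?\<theta> < 2 * pi" using arctan_ubound[of "\<kappa> / 4"] pi_gt_zero by linarith
  show "sector ?\<theta> \<inter> ball 0 (r / 4) \<subseteq> core_sector r \<kappa>"
  proof
    fix z assume "z \<in> sector ?\<theta> \<inter> ball 0 (r / 4)"
    then have z: "z \<noteq> 0" "\<bar>Arg z\<bar> < arctan (\<kappa> / 4)" "norm z < r / 4" by (auto simp: sector_def)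
    have A: "- (pi / 2) < Arg z" "Arg z < pi / 2"
      using z(2) arctan_ubound[of "\<kappa> / 4"] by (auto simp: abs_less_iff)
    have c: "0 < cos (Arg z)" by (rule cos_gt_zero_pi[OF A])
    have re: "Re z = norm z * cos (Arg z)" and im: "Im z = norm z * sin (Arg z)"
      by (metis Re_rcis rcis_cmod_Arg, metis Im_rcis rcis_cmod_Arg)
    have "tan (Arg z) < tan (arctan (\<kappa> / 4))"
      using z(2) A arctan_ubound[of "\<kappa> / 4"] by (intro tan_monotone) auto
    moreover have "tan (- Arg z) < tan (arctan (\<kappa> / 4))"
      using z(2) A arctan_ubound[of "\<kappa> / 4"] by (intro tan_monotone) auto
    ultimately have "\<bar>tan (Arg z)\<bar> < \<kappa> / 4" by (simp add: tan_arctan abs_less_iff)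
    then have "\<bar>sin (Arg z)\<bar> < \<kappa> / 4 * cos (Arg z)"
      using c by (simp add: tan_def abs_divide field_simps)
    then have "norm z * \<bar>sin (Arg z)\<bar> < norm z * (\<kappa> / 4 * cos (Arg z))"
      using z(1) by (intro mult_strict_left_mono) auto
    then show "z \<in> core_sector r \<kappa>"
      using z c by (simp add: core_sector_def re im abs_mult mult_ac)
  qed
qed

lemma gevrey_family_subset:
  assumes "gevrey_family D Z F c" "D' \<subseteq> D" "Z' \<subseteq> Z"
  shows "gevrey_family D' Z' F c"
  using assms unfolding gevrey_family_def
  by (elim conjE exE) (intro conjI exI; force intro: holomorphic_on_subset)

lemma gevrey_family_compose:
  assumes "gevrey_family D Z F c" and \<phi>: "\<phi> holomorphic_on D'" "\<phi> ` D' \<subseteq> D"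
  shows "gevrey_family D' Z (\<lambda>t. F (\<phi> t)) (\<lambda>n t. c n (\<phi> t))"
proof -
  have comp: "(\<lambda>t. f (\<phi> t)) holomorphic_on D'" if "f holomorphic_on D" for f
    using holomorphic_on_compose_gen[OF \<phi>(1) that \<phi>(2)] by (simp add: o_def)
  show ?thesis
    using assms(1) \<phi>(2) unfolding gevrey_family_def
    by (elim conjE exE) (intro conjI exI; force intro: comp)
qed

lemma gevrey_family_const:
  assumes "h holomorphic_on D" "\<And>t. t \<in> D \<Longrightarrow> norm (h t) \<le> K"
  shows "gevrey_family D Z (\<lambda>t z. h t) (\<lambda>n t. if n = 0 then h t else 0)"
  unfolding gevrey_family_def
proof (intro conjI ballI allI exI)
  show "0 < \<bar>K\<bar> + 1" "0 < (1::real)" by auto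
  show "(\<lambda>t. if n = 0 then h t else 0) holomorphic_on D" for n using assms(1) by (cases "n = 0") auto
  fix N t and z :: complex assume t: "t \<in> D"
  show "norm (h t - (\<Sum>n<N. (if n = 0 then h t else 0) * z ^ n)) \<le> (\<bar>K\<bar> + 1) * 1 ^ N * fact N * norm z ^ N"
  proof (cases N)
    case 0
    then show ?thesis using assms(2)[OF t] by simp
  next
    case (Suc M)
    have "(\<Sum>n<N. (if n = 0 then h t else 0) * z ^ n) = h t"
      by (simp add: Suc sum.lessThan_Suc_shift del: sum.lessThan_Suc)
    then show ?thesis by simp
  qed
qed (use assms in auto)

lemma gevrey_family_add:
  assumes F: "gevrey_family D Z F c" and G: "gevrey_family D Z G d"
  shows "gevrey_family D Z (\<lambda>t z. F t z + G t z) (\<lambda>n t. c n t + d n t)"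
proof -
  obtain A B where AB: "0 < A" "0 < B"
    and F': "\<And>N t z. t \<in> D \<Longrightarrow> z \<in> Z \<Longrightarrow> norm (F t z - (\<Sum>n<N. c n t * z ^ n)) \<le> A * B ^ N * fact N * norm z ^ N"
    using F unfolding gevrey_family_def by blast
  obtain A' B' where AB': "0 < A'" "0 < B'"
    and G': "\<And>N t z. t \<in> D \<Longrightarrow> z \<in> Z \<Longrightarrow> norm (G t z - (\<Sum>n<N. d n t * z ^ n)) \<le> A' * B' ^ N * fact N * norm z ^ N"
    using G unfolding gevrey_family_def by blast
  have "norm (F t z + G t z - (\<Sum>n<N. (c n t + d n t) * z ^ n)) \<le> (A + A') * (max B B') ^ N * fact N * norm z ^ N"
    if tz: "t \<in> D" "z \<in> Z" for t z N
  proof -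
    let ?m = "max B B'"
    have "F t z + G t z - (\<Sum>n<N. (c n t + d n t) * z ^ n)
        = (F t z - (\<Sum>n<N. c n t * z ^ n)) + (G t z - (\<Sum>n<N. d n t * z ^ n))"
      by (simp add: distrib_right sum.distrib)
    also have "norm \<dots> \<le> A * B ^ N * fact N * norm z ^ N + A' * B' ^ N * fact N * norm z ^ N"
      by (intro order_trans[OF norm_triangle_ineq] add_mono F' G' tz)
    also have "\<dots> \<le> A * ?m ^ N * fact N * norm z ^ N + A' * ?m ^ N * fact N * norm z ^ N"
      using AB AB' by (intro add_mono mult_right_mono mult_left_mono power_mono) auto
    finally show ?thesis by (simp add: algebra_simps)
  qed
  moreover have "0 < A + A'" "0 < max B B'" using AB AB' by auto
  ultimately show ?thesis
    using F G unfolding gevrey_family_def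
    by (elim conjE) (intro conjI ballI allI exI[of _ "A + A'"] exI[of _ "max B B'"]; auto intro!: holomorphic_intros)
qed

lemma gevrey_family_mult:
  assumes F: "gevrey_family D Z F c" and s: "s holomorphic_on D" "\<And>t. t \<in> D \<Longrightarrow> norm (s t) \<le> K"
  shows "gevrey_family D Z (\<lambda>t z. s t * F t z) (\<lambda>n t. s t * c n t)"
proof -
  obtain A B where AB: "0 < A" "0 < B"
    and F': "\<And>N t z. t \<in> D \<Longrightarrow> z \<in> Z \<Longrightarrow> norm (F t z - (\<Sum>n<N. c n t * z ^ n)) \<le> A * B ^ N * fact N * norm z ^ N"
    using F unfolding gevrey_family_def by blast
  have "norm (s t * F t z - (\<Sum>n<N. s t * c n t * z ^ n)) \<le> ((\<bar>K\<bar> + 1) * A) * B ^ N * fact N * norm z ^ N"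
    if tz: "t \<in> D" "z \<in> Z" for t z N
  proof -
    have "s t * F t z - (\<Sum>n<N. s t * c n t * z ^ n) = s t * (F t z - (\<Sum>n<N. c n t * z ^ n))"
      by (simp add: right_diff_distrib sum_distrib_left mult.assoc)
    also have "norm \<dots> \<le> (\<bar>K\<bar> + 1) * (A * B ^ N * fact N * norm z ^ N)"
      unfolding norm_mult using s(2)[OF tz(1)] by (intro mult_mono F' tz) auto
    finally show ?thesis by (simp add: mult.assoc)
  qed
  moreover have "0 < (\<bar>K\<bar> + 1) * A" using AB by (simp add: add_nonneg_pos)
  ultimately show ?thesis
    using F s(1) AB(2) unfolding gevrey_family_def
    by (elim conjE) (intro conjI ballI allI exI[of _ "(\<bar>K\<bar> + 1) * A"] exI[of _ B]; auto intro!: holomorphic_intros)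
qed

text \<open>Conjugating the variables as well as the value gives a holomorphic function that agrees with
  \<open>cnj (F t z)\<close> for real \<open>t\<close> and \<open>z\<close>.\<close>

lemma gevrey_family_cnj:
  assumes F: "gevrey_family D Z F c" and D: "open D" "cnj ` D = D" and Z: "open Z" "cnj ` Z = Z"
  shows "gevrey_family D Z (\<lambda>t z. cnj (F (cnj t) (cnj z))) (\<lambda>n t. cnj (c n (cnj t)))"
proof -
  have cD: "cnj t \<in> D \<longleftrightarrow> t \<in> D" for t using D(2) by (metis complex_cnj_cnj image_eqI)
  have cZ: "cnj z \<in> Z \<longleftrightarrow> z \<in> Z" for z using Z(2) by (metis complex_cnj_cnj image_eqI)
  have hD: "(\<lambda>t. cnj (f (cnj t))) holomorphic_on D" if "f holomorphic_on D" for f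
    using holomorphic_on_compose_cnj_cnj[of f D] that D by (simp add: o_def)
  have hZ: "(\<lambda>t. cnj (f (cnj t))) holomorphic_on Z" if "f holomorphic_on Z" for f
    using holomorphic_on_compose_cnj_cnj[of f Z] that Z by (simp add: o_def)
  obtain A B where AB: "0 < A" "0 < B"
    and F': "\<And>N t z. t \<in> D \<Longrightarrow> z \<in> Z \<Longrightarrow> norm (F t z - (\<Sum>n<N. c n t * z ^ n)) \<le> A * B ^ N * fact N * norm z ^ N"
    using F unfolding gevrey_family_def by blast
  have "norm (cnj (F (cnj t) (cnj z)) - (\<Sum>n<N. cnj (c n (cnj t)) * z ^ n)) \<le> A * B ^ N * fact N * norm z ^ N"
    if tz: "t \<in> D" "z \<in> Z" for t z N
  proof -
    have "cnj (F (cnj t) (cnj z)) - (\<Sum>n<N. cnj (c n (cnj t)) * z ^ n)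
        = cnj (F (cnj t) (cnj z) - (\<Sum>n<N. c n (cnj t) * cnj z ^ n))"
      by simp
    then show ?thesis using F'[of "cnj t" "cnj z" N] tz cD cZ by (simp only: complex_mod_cnj)
  qed
  then show ?thesis
    using F AB cD cZ unfolding gevrey_family_def
    by (elim conjE) (intro conjI ballI allI exI[of _ A] exI[of _ B]; auto intro!: hD hZ)
qed

text \<open>Dividing out the first two terms shifts the expansion; \<open>(N + 2)!\<close> is at most
  \<open>2 \<cdot> 4 ^ N \<cdot> N!\<close>.\<close>

lemma gevrey_family_remainder2:
  assumes F: "gevrey_family D Z F c" and "0 \<notin> Z"
  shows "gevrey_family D Z (\<lambda>t z. if z = 0 then c 2 t else (F t z - c 0 t - c 1 t * z) / z\<^sup>2) (\<lambda>n. c (n + 2))"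
proof -
  obtain A B where AB: "0 < A" "0 < B"
    and F': "\<And>N t z. t \<in> D \<Longrightarrow> z \<in> Z \<Longrightarrow> norm (F t z - (\<Sum>n<N. c n t * z ^ n)) \<le> A * B ^ N * fact N * norm z ^ N"
    using F unfolding gevrey_family_def by blast
  let ?G = "\<lambda>t z. if z = 0 then c 2 t else (F t z - c 0 t - c 1 t * z) / z\<^sup>2"
  have bound: "norm (?G t z - (\<Sum>n<N. c (n + 2) t * z ^ n)) \<le> (2 * A * B\<^sup>2) * (4 * B) ^ N * fact N * norm z ^ N"
    if tz: "t \<in> D" "z \<in> Z" for t z N
  proof -
    have z0: "z \<noteq> 0" using tz assms(2) by auto
    have "(\<Sum>n<N + 2. c n t * z ^ n) = c 0 t + c 1 t * z + z\<^sup>2 * (\<Sum>n<N. c (n + 2) t * z ^ n)"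
      by (simp add: sum.lessThan_Suc_shift sum_distrib_left power2_eq_square mult_ac del: sum.lessThan_Suc)
    then have "F t z - (\<Sum>n<N + 2. c n t * z ^ n) = z\<^sup>2 * (?G t z - (\<Sum>n<N. c (n + 2) t * z ^ n))"
      using z0 by (simp add: field_simps)
    then have "(norm z)\<^sup>2 * norm (?G t z - (\<Sum>n<N. c (n + 2) t * z ^ n)) \<le> A * B ^ (N + 2) * fact (N + 2) * norm z ^ (N + 2)"
      using F'[OF tz, of "N + 2"] by (simp only: norm_mult norm_power)
    also have "\<dots> = (norm z)\<^sup>2 * (A * B ^ (N + 2) * fact (N + 2) * norm z ^ N)"
      by (simp add: power_add power2_eq_square mult_ac)
    finally have "norm (?G t z - (\<Sum>n<N. c (n + 2) t * z ^ n)) \<le> A * B ^ (N + 2) * fact (N + 2) * norm z ^ N"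
      using z0 by (simp only: mult_le_cancel_left_pos zero_less_power zero_less_norm_iff not_False_eq_True)
    also have "\<dots> \<le> A * B ^ (N + 2) * (2 * 4 ^ N * fact N) * norm z ^ N"
    proof -
      have "fact (Suc (Suc N)) \<le> (2 ^ Suc N * fact (Suc N) :: real)" by (rule fact_Suc_le_power2)
      also have "\<dots> \<le> 2 ^ Suc N * (2 ^ N * fact N)" by (intro mult_left_mono fact_Suc_le_power2) simp
      also have "\<dots> = 2 * 4 ^ N * fact N" by (simp flip: power_mult_distrib)
      finally show ?thesis using AB by (intro mult_left_mono mult_right_mono) auto
    qed
    also have "\<dots> = (2 * A * B\<^sup>2) * (4 * B) ^ N * fact N * norm z ^ N"
      by (simp add: power_add power_mult_distrib power2_eq_square mult_ac)
    finally show ?thesis .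
  qed
  have hF: "\<And>z. z \<in> Z \<Longrightarrow> (\<lambda>t. F t z) holomorphic_on D" "\<And>t. t \<in> D \<Longrightarrow> F t holomorphic_on Z" "\<And>n. c n holomorphic_on D"
    using F by (auto simp: gevrey_family_def)
  show ?thesis
    unfolding gevrey_family_def
  proof (intro conjI ballI allI exI)
    show "0 < 2 * A * B\<^sup>2" "0 < 4 * B" using AB by auto
    fix z assume z: "z \<in> Z"
    then have "z \<noteq> 0" using assms(2) by auto
    then show "(\<lambda>t. ?G t z) holomorphic_on D" by (auto intro!: holomorphic_intros hF z)
  next
    fix t assume t: "t \<in> D"
    have "(\<lambda>z. (F t z - c 0 t - c 1 t * z) / z\<^sup>2) holomorphic_on Z"
      by (intro holomorphic_intros hF t) (use assms(2) in auto)
    then show "?G t holomorphic_on Z"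
      by (rule holomorphic_transform) (use assms(2) in auto)
    show "?G t 0 = c (0 + 2) t" by (simp add: numeral_2_eq_2)
    fix N z assume "z \<in> Z"
    with t show "norm (?G t z - (\<Sum>n<N. c (n + 2) t * z ^ n)) \<le> (2 * A * B\<^sup>2) * (4 * B) ^ N * fact N * norm z ^ N"
      by (rule bound)
  qed (rule hF)
qed

text \<open>The larger constant \<open>A + A B |r|\<close> is for \<open>N = 0\<close>, where the two estimates differ: one of them
  subtracts the value at 0.\<close>

lemma gevrey_family_imp_analytic_unif_gevrey1:
  assumes D: "open D" "connected D" "of_real ` I \<subseteq> D" and \<theta>: "0 < \<theta>" "\<theta> < 2 * pi" and "e < r"
    and F: "gevrey_family D (sector \<theta> \<inter> ball 0 r) F c"
    and h: "\<And>t \<epsilon>. t \<in> I \<Longrightarrow> \<epsilon> \<in> {0..e} \<Longrightarrow> h t \<epsilon> = F (of_real t) (of_real \<epsilon>)"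
  shows "analytic_unif_gevrey1 I e h"
proof -
  let ?Z = "sector \<theta> \<inter> ball 0 r"
  have Z0: "0 \<notin> ?Z" by (simp add: sector_def)
  obtain A B where AB: "0 < A" "0 < B"
    and F': "\<And>N t z. t \<in> D \<Longrightarrow> z \<in> ?Z \<Longrightarrow> norm (F t z - (\<Sum>n<N. c n t * z ^ n)) \<le> A * B ^ N * fact N * norm z ^ N"
    using F unfolding gevrey_family_def by blast
  have hF: "\<And>z. z \<in> ?Z \<Longrightarrow> (\<lambda>t. F t z) holomorphic_on D" "\<And>t. t \<in> D \<Longrightarrow> F t holomorphic_on ?Z"
      "\<And>n. c n holomorphic_on D" "\<And>t. t \<in> D \<Longrightarrow> F t 0 = c 0 t"
    using F by (auto simp: gevrey_family_def)
  have lip: "norm (F t z - F t 0) \<le> A * B * norm z" if "t \<in> D" "z \<in> ?Z" for t z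
    using F'[OF that, of 1] hF(4)[OF that(1)] by simp
  have cont: "continuous_on (insert 0 ?Z) (F t)" if t: "t \<in> D" for t
  proof (rule continuous_on_eq_continuous_within[THEN iffD2], rule ballI)
    fix z assume z: "z \<in> insert 0 ?Z"
    show "continuous (at z within insert 0 ?Z) (F t)"
    proof (cases "z = 0")
      case False
      have "continuous (at z within ?Z) (F t)"
        using holomorphic_on_imp_continuous_on[OF hF(2)[OF t]] z False
        by (auto simp: continuous_on_eq_continuous_within)
      also have "at z within ?Z = at z within insert 0 ?Z"
        by (rule at_within_nhd[where S = "- {0}"]) (use False in auto)
      finally show ?thesis .
    next
      case True
      have "((\<lambda>w. F t w - F t 0) \<longlongrightarrow> 0) (at 0 within insert 0 ?Z)"
      proof (rule Lim_null_comparison)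
        show "\<forall>\<^sub>F w in at 0 within insert 0 ?Z. norm (F t w - F t 0) \<le> A * B * norm w"
          unfolding eventually_at_filter using lip[OF t] by (intro always_eventually) auto
        show "((\<lambda>w. A * B * norm w) \<longlongrightarrow> 0) (at 0 within insert 0 ?Z)"
          by (rule tendsto_eq_intros refl)+ auto
      qed
      then show ?thesis using True by (simp add: continuous_within Lim_null[symmetric])
    qed
  qed
  have gb: "gevrey1_bound ?Z (\<lambda>n. c n t) (A + A * B * \<bar>r\<bar>) B (F t)" if t: "t \<in> D" for t
    unfolding gevrey1_bound_def
  proof (intro allI ballI)
    fix N z assume z: "z \<in> ?Z"
    show "norm (F t z - F t 0 - (\<Sum>n = 1..<N. c n t * z ^ n)) \<le> (A + A * B * \<bar>r\<bar>) * B ^ N * fact N * norm z ^ N"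
    proof (cases N)
      case 0
      have "norm (F t z - F t 0) \<le> A * B * norm z" by (rule lip[OF t z])
      also have "\<dots> \<le> A * B * \<bar>r\<bar>" using z AB by (intro mult_left_mono) auto
      finally show ?thesis using 0 AB by simp
    next
      case (Suc M)
      have "(\<Sum>n<N. c n t * z ^ n) = c 0 t + (\<Sum>n = 1..<N. c n t * z ^ n)"
        by (simp add: Suc lessThan_atLeast0 sum.atLeast_Suc_lessThan)
      then have "norm (F t z - F t 0 - (\<Sum>n = 1..<N. c n t * z ^ n)) \<le> A * B ^ N * fact N * norm z ^ N"
        using F'[OF t z, of N] hF(4)[OF t] by (simp add: diff_diff_eq)
      also have "\<dots> \<le> (A + A * B * \<bar>r\<bar>) * B ^ N * fact N * norm z ^ N"
        using AB by (intro mult_right_mono) auto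
      finally show ?thesis .
    qed
  qed
  have F0: "(\<lambda>t. F t 0) holomorphic_on D"
    by (rule holomorphic_transform[OF hF(3)[of 0]]) (simp add: hF(4))
  have A': "0 < A + A * B * \<bar>r\<bar>" using AB by (simp add: add_pos_nonneg)
  show ?thesis
    unfolding analytic_unif_gevrey1_def
    by (intro exI[of _ F] exI[of _ D] exI[of _ \<theta>] exI[of _ r] exI[of _ c] exI[of _ "A + A * B * \<bar>r\<bar>"] exI[of _ B])
       (use D \<theta> \<open>e < r\<close> A' AB h F0 hF cont gb in auto)
qed

section \<open>Complex extension and the phase variable\<close>

text \<open>Near each real point the real power series also converges on a complex disc. Two discs with
  real centres that meet do so in a convex set containing real points, so by the identity
  theorem the local extensions fit together.\<close>

lemma real_analytic_complex_extension:
  assumes \<mu>: "real_analytic_on \<mu> S"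
  obtains U M where "open U" "of_real ` S \<subseteq> U" "M holomorphic_on U"
    and "\<And>y. of_real y \<in> U \<Longrightarrow> M (of_real y) = of_real (\<mu> y)"
proof -
  have "\<forall>x. \<exists>r c. x \<in> S \<longrightarrow> 0 < r \<and> (\<forall>y. \<bar>y - x\<bar> < r \<longrightarrow> (\<lambda>n. c n * (y - x) ^ n) sums \<mu> y)"
    using \<mu> unfolding real_analytic_on_def by blast
  then obtain r c where r: "\<And>x. x \<in> S \<Longrightarrow> 0 < r x"
    and c: "\<And>x y. x \<in> S \<Longrightarrow> \<bar>y - x\<bar> < r x \<Longrightarrow> (\<lambda>n. c x n * (y - x) ^ n) sums \<mu> y"
    by metis
  define B where "B = (\<lambda>x. ball (complex_of_real x) (r x))"
  define F where "F = (\<lambda>x z. \<Sum>n. of_real (c x n) * (z - complex_of_real x) ^ n)"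
  have F: "(\<lambda>n. of_real (c x n) * (z - complex_of_real x) ^ n) sums F x z" if x: "x \<in> S" and z: "z \<in> B x" for x z
  proof -
    have "norm (z - complex_of_real x) < r x" using z by (simp add: B_def dist_norm norm_minus_commute)
    then obtain \<rho> where \<rho>: "norm (z - complex_of_real x) < \<rho>" "\<rho> < r x" using dense by blast
    then have "0 < \<rho>" using norm_ge_zero le_less_trans by blast
    have "summable (\<lambda>n. c x n * \<rho> ^ n)"
      using c[OF x, of "x + \<rho>"] \<rho> \<open>0 < \<rho>\<close> by (auto simp: sums_iff)
    then have "summable (\<lambda>n. complex_of_real (c x n * \<rho> ^ n))" by (rule summable_of_real)
    then have "summable (\<lambda>n. complex_of_real (c x n) * complex_of_real \<rho> ^ n)" by simp
    from powser_inside[OF this, of "z - complex_of_real x"] \<rho> \<open>0 < \<rho>\<close>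
    have "summable (\<lambda>n. of_real (c x n) * (z - complex_of_real x) ^ n)" by simp
    then show ?thesis unfolding F_def by (rule summable_sums)
  qed
  have holF: "F x holomorphic_on B x" if "x \<in> S" for x
    using power_series_holomorphic[of "of_real x" "r x" "\<lambda>n. of_real (c x n)" "F x"] F[OF that]
    unfolding B_def by blast
  have realF: "F x (of_real y) = of_real (\<mu> y)" if x: "x \<in> S" and y: "of_real y \<in> B x" for x y
  proof -
    have "\<bar>y - x\<bar> < r x" using y by (simp add: B_def dist_norm flip: of_real_diff)
    then have "(\<lambda>n. complex_of_real (c x n * (y - x) ^ n)) sums of_real (\<mu> y)"
      by (intro sums_of_real c x)
    then have "(\<lambda>n. of_real (c x n) * (of_real y - complex_of_real x) ^ n) sums of_real (\<mu> y)" by simp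
    with F[OF x y] show ?thesis by (rule sums_unique2)
  qed
  have glue: "F x z = F x' z" if x: "x \<in> S" "x' \<in> S" and z: "z \<in> B x" "z \<in> B x'" for x x' z
  proof -
    let ?I = "B x \<inter> B x'"
    let ?\<xi> = "complex_of_real (Re z)"
    have reB: "?\<xi> \<in> B y" if "z \<in> B y" for y
    proof -
      have "\<bar>Re (of_real y - z)\<bar> \<le> norm (of_real y - z)" by (rule abs_Re_le_cmod)
      then show ?thesis using that by (simp add: B_def dist_norm flip: of_real_diff)
    qed
    have opI: "open ?I" by (simp add: B_def open_Int)
    have \<xi>: "?\<xi> \<in> ?I" using reB z by auto
    obtain e where e: "0 < e" "ball ?\<xi> e \<subseteq> ?I" using opI \<xi> unfolding open_contains_ball by blast
    have "F x z - F x' z = 0"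
    proof (rule analytic_continuation[where S = ?I and U = "?I \<inter> \<real>" and f = "\<lambda>z. F x z - F x' z" and \<xi> = ?\<xi>])
      show "(\<lambda>z. F x z - F x' z) holomorphic_on ?I"
        by (intro holomorphic_intros holomorphic_on_subset[OF holF[OF x(1)]] holomorphic_on_subset[OF holF[OF x(2)]]) auto
      show "connected ?I" unfolding B_def by (intro convex_connected convex_Int convex_ball)
      show "?\<xi> islimpt ?I \<inter> \<real>"
        unfolding islimpt_approachable
      proof (intro allI impI)
        fix d :: real assume d: "0 < d"
        let ?y = "complex_of_real (Re z + min d e / 2)"
        have n: "norm (?\<xi> - ?y) = min d e / 2" using d e by (simp flip: of_real_diff)
        then have "?y \<in> ball ?\<xi> e" using d e by (simp add: dist_norm)
        then have "?y \<in> ?I \<inter> \<real>" using e by (auto simp del: of_real_add)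
        moreover have "?y \<noteq> ?\<xi>" using d e by (simp add: min_def)
        moreover have "dist ?y ?\<xi> < d" using n d e by (simp add: dist_norm norm_minus_commute)
        ultimately show "\<exists>x'\<in>?I \<inter> \<real>. x' \<noteq> ?\<xi> \<and> dist x' ?\<xi> < d" by blast
      qed
      show "F x y - F x' y = 0" if "y \<in> ?I \<inter> \<real>" for y
        using that realF x by (auto elim!: Reals_cases)
    qed (use opI \<xi> z in auto)
    then show ?thesis by simp
  qed
  define U where "U = (\<Union>x\<in>S. B x)"
  define M where "M = (\<lambda>z. F (SOME x. x \<in> S \<and> z \<in> B x) z)"
  have M: "M z = F x z" if "x \<in> S" "z \<in> B x" for x z
  proof -
    have "(SOME x. x \<in> S \<and> z \<in> B x) \<in> S \<and> z \<in> B (SOME x. x \<in> S \<and> z \<in> B x)"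
      by (rule someI[of _ x]) (use that in auto)
    then show ?thesis unfolding M_def using that glue by blast
  qed
  show thesis
  proof
    show "open U" by (auto simp: U_def B_def)
    show "of_real ` S \<subseteq> U" using r by (force simp: U_def B_def)
    show "M holomorphic_on U"
      unfolding U_def
    proof (rule holomorphic_on_UN_open)
      show "M holomorphic_on B x" if "x \<in> S" for x
        by (rule holomorphic_transform[OF holF[OF that]]) (simp add: M[OF that])
    qed (simp add: B_def)
    show "M (of_real y) = of_real (\<mu> y)" if "of_real y \<in> U" for y
      using that M realF by (auto simp: U_def)
  qed
qed

lemma holomorphic_real_derivative:
  assumes "(M has_field_derivative M') (at (of_real x))" "open V" "x \<in> V"
    and "\<And>y. y \<in> V \<Longrightarrow> M (of_real y) = of_real (\<mu> y)"
  shows "(\<mu> has_real_derivative Re M') (at x)"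
proof -
  have "((\<lambda>y. M (of_real y)) has_vector_derivative M') (at x)"
    by (rule has_vector_derivative_real_field[OF assms(1)])
  then have "((\<lambda>y. Re (M (of_real y))) has_vector_derivative Re M') (at x)"
    by (rule bounded_linear.has_vector_derivative[OF bounded_linear_Re])
  then have "(\<mu> has_vector_derivative Re M') (at x)"
    by (rule has_vector_derivative_transform_within_open[OF _ assms(2,3)]) (simp add: assms(4))
  then show ?thesis by (simp add: has_real_derivative_iff_has_vector_derivative)
qed

text \<open>Just to the right of 0 the function is positive because its derivative is; a later nonpositive
  value would force a second zero.\<close>

lemma positive_right_of_simple_zero:
  fixes \<mu> :: "real \<Rightarrow> real"
  assumes N: "open N" "connected N" "0 \<in> N" and an: "real_analytic_on \<mu> N"
    and \<mu>: "\<mu> 0 = 0" "deriv \<mu> 0 > 0" "\<And>t. t \<in> N \<Longrightarrow> \<mu> t = 0 \<longleftrightarrow> t = 0" and t: "t \<in> N" "0 < t"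
  shows "0 < \<mu> t"
proof -
  obtain U M where U: "open U" "of_real ` N \<subseteq> U" and M: "M holomorphic_on U"
    and M\<mu>: "\<And>y. of_real y \<in> U \<Longrightarrow> M (of_real y) = complex_of_real (\<mu> y)"
    using real_analytic_complex_extension[OF an] by blast
  have der: "(\<mu> has_real_derivative Re (deriv M (of_real x))) (at x)" if "x \<in> N" for x
  proof (rule holomorphic_real_derivative[OF _ N(1) that])
    show "(M has_field_derivative deriv M (of_real x)) (at (of_real x))"
      using that U by (intro holomorphic_derivI[OF M]) auto
  qed (use U M\<mu> in auto)
  have "(\<mu> has_real_derivative deriv \<mu> 0) (at 0)"
    using der[OF N(3)] DERIV_imp_deriv[OF der[OF N(3)]] by simp
  from DERIV_pos_inc_right[OF this \<mu>(2)] \<mu>(1) obtain d where d: "0 < d" "\<And>h. 0 < h \<Longrightarrow> h < d \<Longrightarrow> 0 < \<mu> h"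
    by auto
  define h where "h = min (d / 2) t"
  have h: "0 < h" "h \<le> t" "0 < \<mu> h" using d t by (auto simp: h_def)
  have sub: "{h..t} \<subseteq> N"
    using connected_contains_Icc[OF N(2) N(3) t(1)] h by (auto simp: subset_iff)
  show ?thesis
  proof (rule ccontr)
    assume "\<not> 0 < \<mu> t"
    moreover have "continuous_on {h..t} \<mu>"
      by (intro continuous_at_imp_continuous_on ballI DERIV_isCont[OF der]) (use sub in auto)
    ultimately obtain x where "h \<le> x" "x \<le> t" "\<mu> x = 0"
      using IVT2'[of \<mu> t 0 h] h by auto
    moreover have "x \<in> N" using sub calculation by auto
    ultimately show False using \<mu>(3) h by auto
  qed
qed

text \<open>Along a segment from \<open>x\<close> to \<open>y\<close>, the real part of \<open>\<phi> / (y - x)\<close> is strictly increasing.\<close>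

lemma injective_if_Re_derivative_pos:
  assumes T: "convex T" and \<phi>: "\<And>t. t \<in> T \<Longrightarrow> (\<phi> has_field_derivative s t) (at t)"
    and s: "\<And>t. t \<in> T \<Longrightarrow> 0 < Re (s t)"
  shows "inj_on \<phi> T"
proof (rule inj_onI, rule ccontr)
  fix x y assume xy: "x \<in> T" "y \<in> T" "\<phi> x = \<phi> y" "x \<noteq> y"
  define \<gamma> where "\<gamma> = (\<lambda>\<tau>::real. x + of_real \<tau> * (y - x))"
  define g where "g = (\<lambda>\<tau>. Re (\<phi> (\<gamma> \<tau>) / (y - x)))"
  have \<gamma>: "\<gamma> \<tau> \<in> T" if "0 \<le> \<tau>" "\<tau> \<le> 1" for \<tau>
  proof -
    have "\<gamma> \<tau> = (1 - \<tau>) *\<^sub>R x + \<tau> *\<^sub>R y" by (simp add: \<gamma>_def scaleR_conv_of_real algebra_simps)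
    then show ?thesis using T xy that by (simp add: convexD_alt)
  qed
  have "g 0 < g 1"
  proof (rule DERIV_pos_imp_increasing[of 0 1 g])
    fix \<tau> :: real assume \<tau>: "0 \<le> \<tau>" "\<tau> \<le> 1"
    have "((\<lambda>z. \<phi> (x + z * (y - x)) / (y - x)) has_field_derivative s (\<gamma> \<tau>)) (at (of_real \<tau>))"
    proof -
      have "((\<lambda>z. x + z * (y - x)) has_field_derivative (y - x)) (at (of_real \<tau>))"
        by (auto intro!: derivative_eq_intros)
      from DERIV_chain2[OF _ this, of \<phi> "s (\<gamma> \<tau>)"] \<phi>[OF \<gamma>[OF \<tau>]]
      have "((\<lambda>z. \<phi> (x + z * (y - x))) has_field_derivative s (\<gamma> \<tau>) * (y - x)) (at (of_real \<tau>))"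
        by (simp add: \<gamma>_def)
      from DERIV_cdivide[OF this, of "y - x"] xy show ?thesis by simp
    qed
    from has_vector_derivative_real_field[OF this]
    have "((\<lambda>\<tau>. \<phi> (\<gamma> \<tau>) / (y - x)) has_vector_derivative s (\<gamma> \<tau>)) (at \<tau>)" by (simp add: \<gamma>_def)
    then have "(g has_vector_derivative Re (s (\<gamma> \<tau>))) (at \<tau>)"
      unfolding g_def by (rule bounded_linear.has_vector_derivative[OF bounded_linear_Re])
    then show "\<exists>y. (g has_real_derivative y) (at \<tau>) \<and> 0 < y"
      using s[OF \<gamma>[OF \<tau>]] by (auto simp: has_real_derivative_iff_has_vector_derivative)
  qed simp
  then show False using xy by (simp add: g_def \<gamma>_def)
qed

text \<open>The derivative of \<open>\<phi>\<close> along the interval is real and positive, so \<open>\<phi>\<close> stays real and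
  increases, and the intermediate value theorem applies.\<close>

lemma real_interval_image:
  fixes \<phi> s :: "complex \<Rightarrow> complex"
  assumes ab: "a \<le> b" and \<phi>: "\<And>t. t \<in> {a..b} \<Longrightarrow> (\<phi> has_field_derivative s (of_real t)) (at (of_real t))"
    and s: "\<And>t. t \<in> {a..b} \<Longrightarrow> s (of_real t) \<in> \<real> \<and> 0 < Re (s (of_real t))" and "\<phi> (of_real a) = 0"
  obtains L where "0 \<le> L" "\<phi> ` of_real ` {a..b} = of_real ` {0..L}"
proof -
  have vd: "((\<lambda>t. \<phi> (of_real t)) has_vector_derivative s (of_real t)) (at t within X)" if "t \<in> {a..b}" for t X
    by (rule has_vector_derivative_real_field[OF \<phi>[OF that]])
  have dIm: "((\<lambda>t. Im (\<phi> (of_real t))) has_vector_derivative 0) (at t within {a..b})" if "t \<in> {a..b}" for t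
    using bounded_linear.has_vector_derivative[OF bounded_linear_Im vd[OF that]] s[OF that]
    by (simp add: complex_is_Real_iff)
  have im: "Im (\<phi> (of_real t)) = 0" if "t \<in> {a..b}" for t
  proof -
    have "\<exists>c. \<forall>t\<in>{a..b}. Im (\<phi> (of_real t)) = c"
      by (rule has_vector_derivative_zero_constant[OF _ dIm]) auto
    then obtain c where c: "\<And>t. t \<in> {a..b} \<Longrightarrow> Im (\<phi> (of_real t)) = c" by blast
    show ?thesis using c[OF that] c[of a] ab assms(4) by simp
  qed
  define f where "f = (\<lambda>t. Re (\<phi> (of_real t)))"
  have df: "(f has_real_derivative Re (s (of_real t))) (at t)" if "t \<in> {a..b}" for t
    unfolding f_def has_real_derivative_iff_has_vector_derivative
    by (rule bounded_linear.has_vector_derivative[OF bounded_linear_Re vd[OF that]])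
  have cf: "continuous_on {a..b} f"
    by (intro continuous_at_imp_continuous_on ballI DERIV_isCont[OF df])
  have mono: "f x \<le> f y" if "a \<le> x" "x \<le> y" "y \<le> b" for x y
  proof (rule DERIV_nonneg_imp_nondecreasing[OF that(2)])
    fix z assume "x \<le> z" "z \<le> y"
    with that have z: "z \<in> {a..b}" by simp
    show "\<exists>d. (f has_real_derivative d) (at z) \<and> 0 \<le> d"
      using df[OF z] s[OF z] by (intro exI[of _ "Re (s (of_real z))"]) simp
  qed
  have fa: "f a = 0" using assms(4) by (simp add: f_def)
  have eq: "\<phi> (of_real t) = of_real (f t)" if "t \<in> {a..b}" for t
    using im[OF that] by (simp add: complex_eq_iff f_def)
  have "f ` {a..b} = {0..f b}"
  proof
    show "f ` {a..b} \<subseteq> {0..f b}" using mono[of a] mono[of _ b] fa by auto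
    show "{0..f b} \<subseteq> f ` {a..b}"
    proof
      fix y assume "y \<in> {0..f b}"
      then obtain x where "a \<le> x" "x \<le> b" "f x = y" using IVT'[of f a y b] fa cf ab by auto
      then show "y \<in> f ` {a..b}" by auto
    qed
  qed
  moreover have "\<phi> ` of_real ` {a..b} = of_real ` (f ` {a..b})"
    unfolding image_image by (rule image_cong[OF refl eq])
  moreover have "0 \<le> f b" using mono[of a b] fa ab by simp
  ultimately show thesis using that by metis
qed

section \<open>The exponent and the diagonalising transformation\<close>

text \<open>In the variable \<open>x = \<phi> t\<close> with \<open>\<phi>' = s = \<surd>M\<close>, the equation \<open>z \<nu>' + \<nu>\<^sup>2 + M = 0\<close> for
  \<open>\<nu> = s (\<i> + w)\<close> becomes the Riccati equation for \<open>w\<close> with the coefficient \<open>k = s' / s\<^sup>2\<close>, the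
  logarithmic derivative of \<open>s\<close> with respect to \<open>x\<close>. The expansion \<open>w = - (k / 2) z + O(z\<^sup>2)\<close> gives the
  term \<open>- s' / (2 s)\<close> of \<open>\<nu>\<close>.\<close>

proposition wkb_exponent:
  assumes ab: "a \<le> b" and U: "open U" "of_real ` {a..b} \<subseteq> U" and M: "M holomorphic_on U"
    and pos: "\<And>t. t \<in> {a..b} \<Longrightarrow> M (of_real t) \<in> \<real> \<and> 0 < Re (M (of_real t))"
  obtains \<delta> r \<kappa> \<nu> c where "0 < \<delta>" "0 < r" "0 < \<kappa>" "strip a b \<delta> \<subseteq> U"
    and "\<And>t. t \<in> strip a b \<delta> \<Longrightarrow> 0 < Re (M t)"
    and "gevrey_family (strip a b \<delta>) (core_sector r \<kappa>) \<nu> c"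
    and "(\<lambda>t. csqrt (M t)) holomorphic_on strip a b \<delta>"
    and "\<And>t. t \<in> strip a b \<delta> \<Longrightarrow> c 0 t = \<i> * csqrt (M t)"
    and "\<And>t. t \<in> strip a b \<delta> \<Longrightarrow> c 1 t = - deriv (\<lambda>t. csqrt (M t)) t / (2 * csqrt (M t))"
    and "\<And>t z. t \<in> strip a b \<delta> \<Longrightarrow> z \<in> insert 0 (core_sector r \<kappa>) \<Longrightarrow>
           \<exists>d. ((\<lambda>t. \<nu> t z) has_field_derivative d) (at t) \<and> z * d + (\<nu> t z)\<^sup>2 + M t = 0"
proof -
  define s where "s = (\<lambda>t. csqrt (M t))"
  have s2: "s t ^ 2 = M t" for t by (simp add: s_def)
  define V where "V = U \<inter> M -` {z. 0 < Re z}"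
  have oV: "open V"
    unfolding V_def
    by (rule continuous_open_preimage[OF holomorphic_on_imp_continuous_on[OF M] U(1) open_halfspace_Re_gt])
  have abV: "of_real ` {a..b} \<subseteq> V" using U(2) pos by (auto simp: V_def)
  obtain \<delta>1 where \<delta>1: "0 < \<delta>1" "cbox (Complex (a - \<delta>1) (- \<delta>1)) (Complex (b + \<delta>1) \<delta>1) \<subseteq> V"
    using compact_real_interval_strip[OF oV abV] by blast
  define T where "T = strip a b \<delta>1"
  have TV: "T \<subseteq> V"
    using \<delta>1(2) by (force simp: T_def strip_def in_cbox_complex_iff)
  have T: "open T" "convex T" "of_real ` {a..b} \<subseteq> T"
    using of_real_in_strip[OF \<delta>1(1)] by (auto simp: T_def open_strip convex_strip)
  have MT: "t \<in> U" "0 < Re (M t)" if "t \<in> T" for t using that TV by (auto simp: V_def)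
  have npos: "M t \<notin> \<real>\<^sub>\<le>\<^sub>0" if "t \<in> T" for t
    using MT(2)[OF that] by (auto simp: complex_nonpos_Reals_iff)
  have hs: "s holomorphic_on T"
    unfolding s_def by (intro holomorphic_intros holomorphic_on_subset[OF M] npos) (use MT in auto)
  have Res: "0 < Re (s t)" if "t \<in> T" for t
  proof (rule ccontr)
    assume "\<not> 0 < Re (s t)"
    then have "Re (s t) = 0" using csqrt_principal[of "M t"] by (auto simp: s_def)
    then have "Re (M t) \<le> 0" unfolding s2[symmetric] by (simp add: power2_eq_square)
    then show False using MT(2)[OF that] by simp
  qed
  have s0: "s t \<noteq> 0" if "t \<in> T" for t using Res[OF that] by auto
  have ds: "(s has_field_derivative deriv s t) (at t)" if "t \<in> T" for t
    by (rule holomorphic_derivI[OF hs T(1) that])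
  obtain \<phi>0 where \<phi>0: "\<And>t. t \<in> T \<Longrightarrow> (\<phi>0 has_field_derivative s t) (at t within T)"
    using holomorphic_convex_primitive'[OF T(2,1) hs] by blast
  define \<phi> where "\<phi> = (\<lambda>t. \<phi>0 t - \<phi>0 (of_real a))"
  have d\<phi>: "(\<phi> has_field_derivative s t) (at t)" if "t \<in> T" for t
    using \<phi>0[OF that] unfolding at_within_open[OF that T(1)] \<phi>_def
    by (auto intro!: derivative_eq_intros)
  have h\<phi>: "\<phi> holomorphic_on T" using d\<phi> T(1) by (auto simp: holomorphic_on_open)
  have inj: "inj_on \<phi> T" by (rule injective_if_Re_derivative_pos[OF T(2) d\<phi> Res])
  obtain g where g: "g holomorphic_on (\<phi> ` T)" "\<And>t. t \<in> T \<Longrightarrow> g (\<phi> t) = t"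
    using holomorphic_has_inverse[OF h\<phi> T(1) inj] by metis
  have sreal: "s (of_real t) \<in> \<real> \<and> 0 < Re (s (of_real t))" if "t \<in> {a..b}" for t
  proof
    have "M (of_real t) = of_real (Re (M (of_real t)))" using pos[OF that] by (simp add: of_real_Re)
    then have "s (of_real t) = of_real (sqrt (Re (M (of_real t))))"
      unfolding s_def using pos[OF that] by (metis less_imp_le of_real_sqrt)
    then show "s (of_real t) \<in> \<real>" by simp
    show "0 < Re (s (of_real t))" using Res T(3) imageI[OF that, of of_real] by blast
  qed
  obtain L where L: "0 \<le> L" "\<phi> ` of_real ` {a..b} = of_real ` {0..L}"
  proof (rule real_interval_image[where s = s and \<phi> = \<phi>, OF ab _ sreal])
    show "(\<phi> has_field_derivative s (of_real t)) (at (of_real t))" if "t \<in> {a..b}" for t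
      using T(3) imageI[OF that, of of_real] by (intro d\<phi>) blast
    show "\<phi> (of_real a) = 0" by (simp add: \<phi>_def)
  qed
  have o\<phi>: "open (\<phi> ` T)" by (rule open_mapping_thm3[OF h\<phi> T(1) inj])
  define k where "k = (\<lambda>x. deriv s (g x) / (s (g x))\<^sup>2)"
  have gT: "g ` (\<phi> ` T) \<subseteq> T" using g(2) by auto
  have comp: "(\<lambda>x. f (g x)) holomorphic_on (\<phi> ` T)" if "f holomorphic_on T" for f
    using holomorphic_on_compose_gen[OF g(1) that gT] by (simp add: o_def)
  have hk: "k holomorphic_on (\<phi> ` T)"
    unfolding k_def
    by (intro holomorphic_intros comp[OF hs] comp[OF holomorphic_deriv[OF hs T(1)]]) (use g(2) s0 in auto)
  have LT: "of_real ` {0..L} \<subseteq> \<phi> ` T"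
    unfolding L(2)[symmetric] by (rule image_mono[OF T(3)])
  obtain \<eta> r \<kappa> w c where \<eta>: "0 < \<eta>" and r: "0 < r" and \<kappa>: "0 < \<kappa>" and sub: "strip 0 L \<eta> \<subseteq> \<phi> ` T"
    and fam: "gevrey_family (strip 0 L \<eta>) (core_sector r \<kappa>) w c"
    and c0: "\<And>x. x \<in> strip 0 L \<eta> \<Longrightarrow> c 0 x = 0" and c1: "\<And>x. x \<in> strip 0 L \<eta> \<Longrightarrow> c 1 x = - k x / 2"
    and ode: "\<And>x z. x \<in> strip 0 L \<eta> \<Longrightarrow> z \<in> core_sector r \<kappa> \<Longrightarrow>
       ((\<lambda>x. w x z) has_field_derivative (- 2 * \<i> * w x z - (w x z)\<^sup>2 - z * k x * (\<i> + w x z)) / z) (at x)"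
    by (rule riccati_gevrey_solution[OF o\<phi> LT L(1) hk]) (assumption | rule that)+
  define V2 where "V2 = T \<inter> \<phi> -` strip 0 L \<eta>"
  have oV2: "open V2"
    unfolding V2_def
    by (rule continuous_open_preimage[OF holomorphic_on_imp_continuous_on[OF h\<phi>] T(1) open_strip])
  have abV2: "of_real ` {a..b} \<subseteq> V2"
    using T(3) L(2) of_real_in_strip[OF \<eta>, of 0 L] unfolding V2_def by blast
  obtain \<delta> where \<delta>: "0 < \<delta>" "cbox (Complex (a - \<delta>) (- \<delta>)) (Complex (b + \<delta>) \<delta>) \<subseteq> V2"
    using compact_real_interval_strip[OF oV2 abV2] by blast
  let ?Q = "cbox (Complex (a - \<delta>) (- \<delta>)) (Complex (b + \<delta>) \<delta>)"
  define D where "D = strip a b \<delta>"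
  have DQ: "D \<subseteq> ?Q" by (auto simp: D_def strip_def in_cbox_complex_iff)
  have DT: "D \<subseteq> T" and D\<phi>: "\<phi> ` D \<subseteq> strip 0 L \<eta>" using DQ \<delta>(2) by (auto simp: V2_def)
  have "continuous_on ?Q s"
    by (rule continuous_on_subset[OF holomorphic_on_imp_continuous_on[OF hs]]) (use \<delta>(2) in \<open>auto simp: V2_def\<close>)
  then have "bounded (s ` ?Q)" by (intro compact_imp_bounded compact_continuous_image) auto
  then obtain K where K: "\<And>t. t \<in> D \<Longrightarrow> norm (s t) \<le> K"
    using DQ unfolding bounded_iff by (metis image_eqI subsetD)
  define \<nu> where "\<nu> = (\<lambda>t z. s t * (\<i> + w (\<phi> t) z))"
  define c' where "c' = (\<lambda>n t. s t * ((if n = 0 then \<i> else 0) + c n (\<phi> t)))"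
  have famc: "gevrey_family D (core_sector r \<kappa>) (\<lambda>t. w (\<phi> t)) (\<lambda>n t. c n (\<phi> t))"
    by (rule gevrey_family_compose[OF fam holomorphic_on_subset[OF h\<phi> DT] D\<phi>])
  have w0: "w x 0 = 0" if "x \<in> strip 0 L \<eta>" for x using fam c0 that by (auto simp: gevrey_family_def)
  show thesis
  proof
    show "0 < \<delta>" "0 < r" "0 < \<kappa>" using \<delta> r \<kappa> by auto
    show "strip a b \<delta> \<subseteq> U" using DT MT(1) by (auto simp: D_def)
    show "0 < Re (M t)" if "t \<in> strip a b \<delta>" for t using MT(2) DT that by (auto simp: D_def)
    show "gevrey_family (strip a b \<delta>) (core_sector r \<kappa>) \<nu> c'"
      unfolding \<nu>_def c'_def D_def[symmetric]
      by (rule gevrey_family_mult[OF gevrey_family_add[OF gevrey_family_const[of "\<lambda>_. \<i>" D 1] famc] holomorphic_on_subset[OF hs DT] K])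
         auto
    show "(\<lambda>t. csqrt (M t)) holomorphic_on strip a b \<delta>"
      using holomorphic_on_subset[OF hs DT] by (simp add: s_def D_def)
    fix t assume "t \<in> strip a b \<delta>"
    then have t: "t \<in> D" "t \<in> T" "\<phi> t \<in> strip 0 L \<eta>" using DT D\<phi> by (auto simp: D_def)
    have kt: "k (\<phi> t) = deriv s t / (s t)\<^sup>2" by (simp add: k_def g(2)[OF t(2)])
    have st: "csqrt (M t) = s t" by (simp only: s_def)
    show "c' 0 t = \<i> * csqrt (M t)" using c0[OF t(3)] by (simp add: c'_def s_def)
    show "c' 1 t = - deriv (\<lambda>t. csqrt (M t)) t / (2 * csqrt (M t))"
      unfolding s_def[symmetric] st using c1[OF t(3)] s0[OF t(2)]
      by (simp add: c'_def kt power2_eq_square field_simps)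
    fix z assume z: "z \<in> insert 0 (core_sector r \<kappa>)"
    show "\<exists>d. ((\<lambda>t. \<nu> t z) has_field_derivative d) (at t) \<and> z * d + (\<nu> t z)\<^sup>2 + M t = 0"
    proof (cases "z = 0")
      case True
      have "((\<lambda>t. s t * \<i>) has_field_derivative deriv s t * \<i>) (at t)"
        by (rule DERIV_cmult_right[OF ds[OF t(2)]])
      then have "((\<lambda>t. \<nu> t z) has_field_derivative deriv s t * \<i>) (at t)"
      proof (rule has_field_derivative_transform_within_open)
        show "open D" "t \<in> D" using t by (auto simp: D_def open_strip)
        show "s x * \<i> = \<nu> x z" if "x \<in> D" for x using w0[of "\<phi> x"] D\<phi> that True by (auto simp: \<nu>_def)
      qed
      moreover have "(\<nu> t z)\<^sup>2 + M t = 0"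
        using w0[OF t(3)] True by (simp add: \<nu>_def power_mult_distrib s2)
      ultimately show ?thesis using True by auto
    next
      case False
      with z have z': "z \<in> core_sector r \<kappa>" by simp
      let ?w = "w (\<phi> t) z"
      define e where "e = (- 2 * \<i> * ?w - ?w\<^sup>2 - z * k (\<phi> t) * (\<i> + ?w)) / z"
      have "((\<lambda>t. w (\<phi> t) z) has_field_derivative e * s t) (at t)"
        using DERIV_chain2[OF ode[OF t(3) z'] d\<phi>[OF t(2)]] by (simp add: e_def)
      then have "((\<lambda>t. \<nu> t z) has_field_derivative deriv s t * (\<i> + ?w) + s t * (e * s t)) (at t)"
        unfolding \<nu>_def by (auto intro!: derivative_eq_intros ds[OF t(2)])
      moreover have "z * (deriv s t * (\<i> + ?w) + s t * (e * s t)) + (\<nu> t z)\<^sup>2 + M t = 0"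
      proof -
        have ze: "z * e = - 2 * \<i> * ?w - ?w\<^sup>2 - z * k (\<phi> t) * (\<i> + ?w)" using False by (simp add: e_def)
        have ks: "k (\<phi> t) * (s t)\<^sup>2 = deriv s t" using s0[OF t(2)] by (simp add: kt)
        have "z * (deriv s t * (\<i> + ?w) + s t * (e * s t)) + (\<nu> t z)\<^sup>2 + M t
            = z * (k (\<phi> t) * (s t)\<^sup>2) * (\<i> + ?w) + (z * e) * (s t)\<^sup>2 + (s t)\<^sup>2 * (\<i> + ?w)\<^sup>2 + (s t)\<^sup>2"
          unfolding ks s2[of t, symmetric] \<nu>_def by (simp add: power2_eq_square algebra_simps)
        also have "\<dots> = 0"
          unfolding ze by (simp add: power2_eq_square algebra_simps)
        finally show ?thesis .
      qed
      ultimately show ?thesis by blast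
    qed
  qed
qed

lemma has_vector_derivative_inverse_complex:
  fixes f :: "real \<Rightarrow> complex"
  assumes "(f has_vector_derivative f') (at x within S)" "f x \<noteq> 0"
  shows "((\<lambda>x. inverse (f x)) has_vector_derivative - f' / (f x)\<^sup>2) (at x within S)"
proof -
  have "(inverse has_field_derivative - (inverse (f x) ^ Suc (Suc 0))) (at (f x) within f ` S)"
    by (rule DERIV_inverse[OF assms(2)])
  from field_vector_diff_chain_within[OF assms(1) this] show ?thesis
    by (simp add: o_def power2_eq_square divide_inverse mult_ac)
qed

text \<open>Where \<open>\<epsilon> \<nu>' + \<nu>\<^sup>2 + \<mu> = 0\<close>, the curves \<open>y = \<nu> x\<close> and \<open>y = cnj \<nu> x\<close> are invariant under the
  \<open>xy\<close> system; they are independent where \<open>\<nu>\<close> is not real, and then diagonalise it.\<close>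

lemma transforms_system_riccati:
  fixes \<nu> :: "real \<Rightarrow> real \<Rightarrow> complex" and \<Phi> :: "real \<Rightarrow> real \<Rightarrow> complex ^ 2 \<Rightarrow> complex ^ 2"
  assumes ric: "\<And>t. t \<in> I \<Longrightarrow> \<exists>d. ((\<lambda>t. \<nu> t \<epsilon>) has_vector_derivative d) (at t) \<and>
                   of_real \<epsilon> * d + (\<nu> t \<epsilon>)\<^sup>2 + of_real (\<mu> t) = 0"
    and im: "\<And>t. t \<in> I \<Longrightarrow> Im (\<nu> t \<epsilon>) \<noteq> 0"
    and \<Phi>: "\<And>t w. \<Phi> t \<epsilon> w = vector [w $ 1 + w $ 2, \<nu> t \<epsilon> * w $ 1 + cnj (\<nu> t \<epsilon>) * w $ 2]"
  shows "transforms_system \<mu> \<nu> I \<epsilon> \<Phi>"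
  unfolding transforms_system_def
proof (intro allI impI)
  fix J :: "real set" and u v :: "real \<Rightarrow> complex" and \<tau> :: "real \<Rightarrow> real"
  assume "is_interval J \<and> \<tau> ` J \<subseteq> I"
  then have J: "\<And>s. s \<in> J \<Longrightarrow> \<tau> s \<in> I" by auto
  define n where "n = (\<lambda>s. \<nu> (\<tau> s) \<epsilon>)"
  define x where "x = (\<lambda>s. u s + v s)"
  define y where "y = (\<lambda>s. n s * u s + cnj (n s) * v s)"
  have n: "(n has_vector_derivative - (n s)\<^sup>2 - of_real (\<mu> (\<tau> s))) (at s within J)"
      "((\<lambda>s. cnj (n s)) has_vector_derivative - (cnj (n s))\<^sup>2 - of_real (\<mu> (\<tau> s))) (at s within J)"
    if s: "s \<in> J" and \<tau>: "(\<tau> has_vector_derivative \<epsilon>) (at s within J)" for s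
  proof -
    obtain d where d: "((\<lambda>t. \<nu> t \<epsilon>) has_vector_derivative d) (at (\<tau> s))"
        "of_real \<epsilon> * d + (n s)\<^sup>2 + of_real (\<mu> (\<tau> s)) = 0"
      using ric[OF J[OF s]] by (auto simp: n_def)
    have "((\<lambda>t. \<nu> t \<epsilon>) \<circ> \<tau> has_vector_derivative \<epsilon> *\<^sub>R d) (at s within J)"
      by (rule vector_diff_chain_within[OF \<tau> has_vector_derivative_at_within[OF d(1)]])
    moreover have "\<epsilon> *\<^sub>R d = - (n s)\<^sup>2 - of_real (\<mu> (\<tau> s))"
      using d(2) by (simp add: scaleR_conv_of_real eq_neg_iff_add_eq_0 algebra_simps)
    ultimately show 1: "(n has_vector_derivative - (n s)\<^sup>2 - of_real (\<mu> (\<tau> s))) (at s within J)"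
      by (simp add: o_def n_def)
    show "((\<lambda>s. cnj (n s)) has_vector_derivative - (cnj (n s))\<^sup>2 - of_real (\<mu> (\<tau> s))) (at s within J)"
      using bounded_linear.has_vector_derivative[OF bounded_linear_cnj 1] by simp
  qed
  have "solves_uv \<nu> \<epsilon> J u v \<tau> \<longleftrightarrow> solves_xy \<mu> \<epsilon> J x y \<tau>"
  proof
    assume uv: "solves_uv \<nu> \<epsilon> J u v \<tau>"
    show "solves_xy \<mu> \<epsilon> J x y \<tau>"
      unfolding solves_xy_def
    proof (intro ballI conjI)
      fix s assume s: "s \<in> J"
      have du: "(u has_vector_derivative n s * u s) (at s within J)"
        and dv: "(v has_vector_derivative cnj (n s) * v s) (at s within J)"
        and \<tau>: "(\<tau> has_vector_derivative \<epsilon>) (at s within J)"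
        using uv s by (auto simp: solves_uv_def n_def)
      note dn = n[OF s \<tau>]
      show "(\<tau> has_vector_derivative \<epsilon>) (at s within J)" by fact
      show "(x has_vector_derivative y s) (at s within J)"
        unfolding x_def y_def by (rule has_vector_derivative_add[OF du dv])
      have "(y has_vector_derivative (n s * (n s * u s) + (- (n s)\<^sup>2 - of_real (\<mu> (\<tau> s))) * u s)
              + (cnj (n s) * (cnj (n s) * v s) + (- (cnj (n s))\<^sup>2 - of_real (\<mu> (\<tau> s))) * v s)) (at s within J)"
        unfolding y_def
        by (intro has_vector_derivative_add has_vector_derivative_mult dn du dv)
      then show "(y has_vector_derivative - of_real (\<mu> (\<tau> s)) * x s) (at s within J)"
        by (simp add: x_def power2_eq_square algebra_simps)
    qed
  next
    assume xy: "solves_xy \<mu> \<epsilon> J x y \<tau>"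
    define q where "q = (\<lambda>s. inverse (n s - cnj (n s)))"
    have ne: "n s - cnj (n s) \<noteq> 0" if "s \<in> J" for s
      using im[OF J[OF that]] by (auto simp: n_def complex_eq_iff)
    have u: "u s = (y s - cnj (n s) * x s) * q s" and v: "v s = (n s * x s - y s) * q s" if "s \<in> J" for s
      using ne[OF that] by (simp_all add: x_def y_def q_def field_simps)
    show "solves_uv \<nu> \<epsilon> J u v \<tau>"
      unfolding solves_uv_def
    proof (intro ballI conjI)
      fix s assume s: "s \<in> J"
      let ?m = "complex_of_real (\<mu> (\<tau> s))"
      let ?n' = "- (n s)\<^sup>2 - ?m" and ?c' = "- (cnj (n s))\<^sup>2 - ?m"
      have dx: "(x has_vector_derivative y s) (at s within J)"
        and dy: "(y has_vector_derivative - ?m * x s) (at s within J)"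
        and \<tau>: "(\<tau> has_vector_derivative \<epsilon>) (at s within J)"
        using xy s by (auto simp: solves_xy_def)
      note dn = n[OF s \<tau>]
      show "(\<tau> has_vector_derivative \<epsilon>) (at s within J)" by fact
      have q2: "- (?n' - ?c') / (n s - cnj (n s))\<^sup>2 = (n s + cnj (n s)) * q s"
      proof -
        have num: "- (?n' - ?c') = (n s + cnj (n s)) * (n s - cnj (n s))"
          by (simp add: power2_eq_square algebra_simps)
        show ?thesis unfolding num using ne[OF s] by (simp add: q_def power2_eq_square divide_inverse)
      qed
      have "(q has_vector_derivative - (?n' - ?c') / (n s - cnj (n s))\<^sup>2) (at s within J)"
        unfolding q_def
        by (rule has_vector_derivative_inverse_complex[OF has_vector_derivative_diff[OF dn] ne[OF s]])
      then have dq: "(q has_vector_derivative (n s + cnj (n s)) * q s) (at s within J)"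
        unfolding q2 .
      have "((\<lambda>s. (y s - cnj (n s) * x s) * q s) has_vector_derivative
              (y s - cnj (n s) * x s) * ((n s + cnj (n s)) * q s)
              + (- ?m * x s - (cnj (n s) * y s + ?c' * x s)) * q s) (at s within J)"
        by (intro has_vector_derivative_diff has_vector_derivative_mult dn dx dy dq)
      also have "(y s - cnj (n s) * x s) * ((n s + cnj (n s)) * q s)
              + (- ?m * x s - (cnj (n s) * y s + ?c' * x s)) * q s = n s * u s"
        unfolding u[OF s] by (simp add: power2_eq_square algebra_simps)
      finally have du: "((\<lambda>s. (y s - cnj (n s) * x s) * q s) has_vector_derivative n s * u s) (at s within J)" .
      have "(u has_vector_derivative n s * u s) (at s within J)"
        by (rule has_vector_derivative_transform[OF s _ du]) (rule u)
      then show "(u has_vector_derivative \<nu> (\<tau> s) \<epsilon> * u s) (at s within J)" by (simp add: n_def)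
      have "((\<lambda>s. (n s * x s - y s) * q s) has_vector_derivative
              (n s * x s - y s) * ((n s + cnj (n s)) * q s)
              + ((n s * y s + ?n' * x s) - - ?m * x s) * q s) (at s within J)"
        by (intro has_vector_derivative_diff has_vector_derivative_mult dn dx dy dq)
      also have "(n s * x s - y s) * ((n s + cnj (n s)) * q s)
              + ((n s * y s + ?n' * x s) - - ?m * x s) * q s = cnj (n s) * v s"
        unfolding v[OF s] by (simp add: power2_eq_square algebra_simps)
      finally have dv: "((\<lambda>s. (n s * x s - y s) * q s) has_vector_derivative cnj (n s) * v s) (at s within J)" .
      have "(v has_vector_derivative cnj (n s) * v s) (at s within J)"
        by (rule has_vector_derivative_transform[OF s _ dv]) (rule v)
      then show "(v has_vector_derivative cnj (\<nu> (\<tau> s) \<epsilon>) * v s) (at s within J)" by (simp add: n_def)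
    qed
  qed
  then show "solves_uv \<nu> \<epsilon> J u v \<tau> \<longleftrightarrow>
         solves_xy \<mu> \<epsilon> J (\<lambda>s. \<Phi> (\<tau> s) \<epsilon> (vector [u s, v s]) $ 1) (\<lambda>s. \<Phi> (\<tau> s) \<epsilon> (vector [u s, v s]) $ 2) \<tau>"
    by (simp add: \<Phi> x_def y_def n_def)
qed

lemma linear_bij_eigenbasis:
  fixes m n :: complex and \<Phi> :: "complex ^ 2 \<Rightarrow> complex ^ 2"
  assumes \<Phi>: "\<And>w. \<Phi> w = vector [w $ 1 + w $ 2, m * w $ 1 + n * w $ 2]" and "m \<noteq> n"
  shows "Vector_Spaces.linear (*s) (*s) \<Phi>" "bij \<Phi>"
proof -
  show "Vector_Spaces.linear (*s) (*s) \<Phi>"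
    by unfold_locales (simp_all add: \<Phi> vec_eq_iff forall_2 algebra_simps)
  define \<Psi> :: "complex ^ 2 \<Rightarrow> complex ^ 2" where
    "\<Psi> = (\<lambda>w. vector [(w $ 2 - n * w $ 1) / (m - n), (m * w $ 1 - w $ 2) / (m - n)])"
  have mn: "m - n \<noteq> 0" using assms by simp
  have "\<Psi> (\<Phi> w) = w" "\<Phi> (\<Psi> w) = w" for w
    using mn by (simp_all add: \<Phi> \<Psi>_def vec_eq_iff forall_2 divide_simps) (simp_all add: algebra_simps)
  then show "bij \<Phi>" by (intro o_bij[of \<Psi>]) (auto simp: fun_eq_iff)
qed

section \<open>The transformation theorem\<close>

lemma cnj_image_eq: "(\<And>x. x \<in> X \<Longrightarrow> cnj x \<in> X) \<Longrightarrow> cnj ` X = X"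
  by (auto simp: image_iff) (metis complex_cnj_cnj)

lemma open_core_sector: "open (core_sector r \<kappa>)"
  unfolding core_sector_def by (intro open_Collect_conj open_Collect_less continuous_intros)

theorem lemma2p3:
  fixes \<mu> :: "real \<Rightarrow> real" and N :: "real set" and a b :: real
  assumes "open N" and "connected N" and "0 \<in> N"
    and "real_analytic_on \<mu> N"
    and "\<mu> 0 = 0" and "deriv \<mu> 0 > 0"
    and "\<And>t. t \<in> N \<Longrightarrow> \<mu> t = 0 \<longleftrightarrow> t = 0"
    and "0 < a" and "a \<le> b" and "{a..b} \<subseteq> N"
  shows "\<exists>\<epsilon>0>0. \<exists>(\<Phi> :: real \<Rightarrow> real \<Rightarrow> complex ^ 2 \<Rightarrow> complex ^ 2)
           (\<nu> :: real \<Rightarrow> real \<Rightarrow> complex)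
           (f :: real \<Rightarrow> real \<Rightarrow> complex)
           (T\<^sub>2 :: real \<Rightarrow> real \<Rightarrow> complex).
         (\<forall>w i. analytic_unif_gevrey1 {a..b} \<epsilon>0 (\<lambda>t \<epsilon>. \<Phi> t \<epsilon> w $ i)) \<and>
         analytic_unif_gevrey1 {a..b} \<epsilon>0 \<nu> \<and>
         analytic_unif_gevrey1 {a..b} \<epsilon>0 T\<^sub>2 \<and>
         (\<forall>\<epsilon>\<in>{0..\<epsilon>0}.
            (\<forall>t\<in>{a..b}. Vector_Spaces.linear (*s) (*s) (\<Phi> t \<epsilon>) \<and> bij (\<Phi> t \<epsilon>)) \<and>
            transforms_system \<mu> \<nu> {a..b} \<epsilon> \<Phi> \<and>
            (\<forall>t\<in>{a..b}.
               \<nu> t \<epsilon> = lam \<mu> t * f t \<epsilon> - complex_of_real \<epsilon> * inverse (lam \<mu> t) * lam' \<mu> t \<and>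
               \<nu> t \<epsilon> = lam \<mu> t - 1 / 2 * inverse (lam \<mu> t) * lam' \<mu> t * complex_of_real \<epsilon>
                        + complex_of_real \<epsilon> ^ 2 * T\<^sub>2 t \<epsilon>))"
proof -
  have \<mu>pos: "0 < \<mu> t" if "t \<in> {a..b}" for t
    by (rule positive_right_of_simple_zero[OF assms(1-7)]) (use that assms(8,10) in auto)
  obtain U M where U: "open U" "of_real ` N \<subseteq> U" and M: "M holomorphic_on U"
    and M\<mu>: "\<And>y. of_real y \<in> U \<Longrightarrow> M (of_real y) = complex_of_real (\<mu> y)"
    using real_analytic_complex_extension[OF assms(4)] by blast
  have abU: "of_real ` {a..b} \<subseteq> U" using U(2) assms(10) by blast
  have Mt: "M (of_real t) = of_real (\<mu> t)" if "t \<in> {a..b}" for t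
    by (rule M\<mu>) (use abU that in blast)
  have Mpos: "M (of_real t) \<in> \<real> \<and> 0 < Re (M (of_real t))" if "t \<in> {a..b}" for t
    using \<mu>pos[OF that] by (simp add: Mt[OF that])
  obtain \<delta> r \<kappa> n c where \<delta>: "0 < \<delta>" and r: "0 < r" and \<kappa>: "0 < \<kappa>" and DU: "strip a b \<delta> \<subseteq> U"
    and ReM: "\<And>t. t \<in> strip a b \<delta> \<Longrightarrow> 0 < Re (M t)"
    and fam: "gevrey_family (strip a b \<delta>) (core_sector r \<kappa>) n c"
    and hs: "(\<lambda>t. csqrt (M t)) holomorphic_on strip a b \<delta>"
    and c0: "\<And>t. t \<in> strip a b \<delta> \<Longrightarrow> c 0 t = \<i> * csqrt (M t)"
    and c1: "\<And>t. t \<in> strip a b \<delta> \<Longrightarrow> c 1 t = - deriv (\<lambda>t. csqrt (M t)) t / (2 * csqrt (M t))"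
    and ric: "\<And>t z. t \<in> strip a b \<delta> \<Longrightarrow> z \<in> insert 0 (core_sector r \<kappa>) \<Longrightarrow>
           \<exists>d. ((\<lambda>t. n t z) has_field_derivative d) (at t) \<and> z * d + (n t z)\<^sup>2 + M t = 0"
    by (rule wkb_exponent[OF assms(9) U(1) abU M Mpos]) (assumption | rule that)+
  define D where "D = strip a b \<delta>"
  define s where "s = (\<lambda>t. csqrt (M t))"
  have realD: "of_real ` {a..b} \<subseteq> D" using of_real_in_strip[OF \<delta>] by (simp add: D_def)
  have tD: "of_real t \<in> D" if "t \<in> {a..b}" for t using realD that by blast
  have D: "open D" "connected D" by (auto simp: D_def open_strip convex_connected convex_strip)
  have st: "s (of_real t) = of_real (sqrt (\<mu> t))" if "t \<in> {a..b}" for t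
    unfolding s_def Mt[OF that] by (rule of_real_sqrt[symmetric]) (use \<mu>pos[OF that] in simp)
  have lam: "lam \<mu> t = \<i> * s (of_real t)" if "t \<in> {a..b}" for t
    by (simp add: lam_def st[OF that])
  have lam0: "lam \<mu> t \<noteq> 0" if "t \<in> {a..b}" for t
    using \<mu>pos[OF that] by (simp add: lam_def)
  have lam': "lam' \<mu> t = \<i> * deriv s (of_real t)" if t: "t \<in> {a..b}" for t
  proof (rule vector_derivative_at, rule has_vector_derivative_transform_within_open)
    have "((\<lambda>t. \<i> * s t) has_field_derivative \<i> * deriv s (of_real t)) (at (of_real t))"
      using hs tD[OF t] D(1) unfolding s_def[symmetric] D_def[symmetric]
      by (intro DERIV_cmult holomorphic_derivI)
    then show "((\<lambda>t. \<i> * s (of_real t)) has_vector_derivative \<i> * deriv s (of_real t)) (at t)"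
      by (rule has_vector_derivative_real_field)
    show "open (of_real -` D :: real set)" by (rule open_vimage[OF D(1)]) (auto intro!: continuous_intros)
    show "t \<in> of_real -` D" using tD[OF t] by simp
    fix y assume "y \<in> (of_real -` D :: real set)"
    then have y: "complex_of_real y \<in> strip a b \<delta>" by (simp add: D_def)
    then have My: "M (of_real y) = of_real (\<mu> y)" using DU by (intro M\<mu>) auto
    then have "0 < \<mu> y" using ReM[OF y] by simp
    then show "\<i> * s (of_real y) = lam \<mu> y"
      unfolding lam_def s_def My using of_real_sqrt[of "\<mu> y"] by (metis less_imp_le)
  qed
  obtain A B where AB: "0 < A" "0 < B"
    and exp: "\<And>m t z. t \<in> D \<Longrightarrow> z \<in> core_sector r \<kappa> \<Longrightarrow>
        norm (n t z - (\<Sum>n<m. c n t * z ^ n)) \<le> A * B ^ m * fact m * norm z ^ m"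
    using fam unfolding gevrey_family_def D_def by blast
  have n0: "n t 0 = c 0 t" if "t \<in> D" for t using fam that by (simp add: gevrey_family_def D_def)
  have "continuous_on {a..b} (\<lambda>t. Re (M (of_real t)))"
    by (intro continuous_intros continuous_on_compose2[OF holomorphic_on_imp_continuous_on[OF M] _ abU])
  then obtain t0 where t0: "t0 \<in> {a..b}" "\<And>t. t \<in> {a..b} \<Longrightarrow> Re (M (of_real t0)) \<le> Re (M (of_real t))"
    using continuous_attains_inf[of "{a..b}" "\<lambda>t. Re (M (of_real t))"] assms(9) by auto
  define m where "m = sqrt (\<mu> t0)"
  have m: "0 < m" using \<mu>pos[OF t0(1)] by (simp add: m_def)
  have m_le: "m \<le> sqrt (\<mu> t)" if "t \<in> {a..b}" for t
    using t0(2)[OF that] by (simp add: m_def Mt[OF that] Mt[OF t0(1)])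
  \<comment> \<open>The second bound makes the deviation \<open>A B \<epsilon>\<close> of \<open>\<nu>\<close> from its leading term at most \<open>m / 2\<close>.\<close>
  define \<epsilon>0 where "\<epsilon>0 = min (r / 8) (m / (2 * (A * B)))"
  have \<epsilon>0: "0 < \<epsilon>0" "\<epsilon>0 < r / 4" "A * B * \<epsilon>0 \<le> m / 2"
  proof -
    show "0 < \<epsilon>0" "\<epsilon>0 < r / 4" using r m AB by (auto simp: \<epsilon>0_def)
    have "A * B * \<epsilon>0 \<le> A * B * (m / (2 * (A * B)))" using AB by (intro mult_left_mono) (auto simp: \<epsilon>0_def)
    then show "A * B * \<epsilon>0 \<le> m / 2" using AB by simp
  qed
  have eZ: "of_real \<epsilon> \<in> insert 0 (core_sector r \<kappa>)" if "\<epsilon> \<in> {0..\<epsilon>0}" for \<epsilon>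
    using that \<epsilon>0(2) r \<kappa> by (auto simp: core_sector_def)
  define \<nu> where "\<nu> = (\<lambda>t \<epsilon>. n (complex_of_real t) (complex_of_real \<epsilon>))"
  \<comment> \<open>The imaginary part of \<open>\<nu>\<close> stays close to \<open>sqrt \<mu>\<close>: this makes \<open>\<nu>\<close> differ from its conjugate.\<close>
  have Im\<nu>: "Im (\<nu> t \<epsilon>) \<noteq> 0" if t: "t \<in> {a..b}" and \<epsilon>: "\<epsilon> \<in> {0..\<epsilon>0}" for t \<epsilon>
  proof -
    have "norm (\<nu> t \<epsilon> - c 0 (of_real t)) \<le> A * B * \<epsilon>"
    proof (cases "\<epsilon> = 0")
      case True
      then show ?thesis using n0[OF tD[OF t]] by (simp add: \<nu>_def)
    next
      case False
      then show ?thesis using exp[OF tD[OF t], of "of_real \<epsilon>" 1] eZ[OF \<epsilon>] \<epsilon> by (simp add: \<nu>_def)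
    qed
    also have "\<dots> \<le> A * B * \<epsilon>0" using \<epsilon> AB by (intro mult_left_mono) auto
    also have "\<dots> \<le> m / 2" by (rule \<epsilon>0(3))
    finally have "\<bar>Im (\<nu> t \<epsilon> - c 0 (of_real t))\<bar> \<le> m / 2"
      using abs_Im_le_cmod order_trans by blast
    moreover have "c 0 (of_real t) = \<i> * of_real (sqrt (\<mu> t))"
      using c0[of "of_real t"] tD[OF t] st[OF t] by (simp add: s_def D_def)
    ultimately show ?thesis using m_le[OF t] m by auto
  qed
  define \<Phi> :: "real \<Rightarrow> real \<Rightarrow> complex ^ 2 \<Rightarrow> complex ^ 2" where
    "\<Phi> = (\<lambda>t \<epsilon> w. vector [w $ 1 + w $ 2, \<nu> t \<epsilon> * w $ 1 + cnj (\<nu> t \<epsilon>) * w $ 2])"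
  define G where "G = (\<lambda>t z. if z = 0 then c 2 t else (n t z - c 0 t - c 1 t * z) / z\<^sup>2)"
  define T2 where "T2 = (\<lambda>t \<epsilon>. G (complex_of_real t) (complex_of_real \<epsilon>))"
  define f where "f = (\<lambda>t \<epsilon>. (\<nu> t \<epsilon> + complex_of_real \<epsilon> * inverse (lam \<mu> t) * lam' \<mu> t) / lam \<mu> t)"
  obtain \<theta> where \<theta>: "0 < \<theta>" "\<theta> < 2 * pi" and sec: "sector \<theta> \<inter> ball 0 (r / 4) \<subseteq> core_sector r \<kappa>"
    using sector_subset_core_sector[OF r \<kappa>] by blast
  have unif: "analytic_unif_gevrey1 {a..b} \<epsilon>0 h"
    if "gevrey_family D (core_sector r \<kappa>) F d" "\<And>t \<epsilon>. h t \<epsilon> = F (of_real t) (of_real \<epsilon>)" for h F d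
    by (rule gevrey_family_imp_analytic_unif_gevrey1[OF D realD \<theta> \<epsilon>0(2) gevrey_family_subset[OF that(1) order_refl sec]])
       (simp add: that(2))
  have fam: "gevrey_family D (core_sector r \<kappa>) n c" using fam by (simp add: D_def)
  have const: "gevrey_family D (core_sector r \<kappa>) (\<lambda>t z. x) (\<lambda>n t. if n = 0 then x else 0)" for x
    by (rule gevrey_family_const[of "\<lambda>_. x" D "norm x"]) auto
  have cmul: "gevrey_family D (core_sector r \<kappa>) (\<lambda>t z. x * F t z) (\<lambda>n t. x * d n t)"
    if "gevrey_family D (core_sector r \<kappa>) F d" for x F d
    by (rule gevrey_family_mult[OF that, of "\<lambda>_. x" "norm x"]) auto
  have fam_cnj: "gevrey_family D (core_sector r \<kappa>) (\<lambda>t z. cnj (n (cnj t) (cnj z))) (\<lambda>n t. cnj (c n (cnj t)))"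
    by (rule gevrey_family_cnj[OF fam D(1) cnj_image_eq open_core_sector cnj_image_eq])
       (auto simp: D_def strip_def core_sector_def)
  show ?thesis
  proof (rule exI[of _ \<epsilon>0], rule conjI[OF \<epsilon>0(1)], rule exI[of _ \<Phi>], rule exI[of _ \<nu>],
      rule exI[of _ f], rule exI[of _ T2], intro conjI ballI allI)
    show "analytic_unif_gevrey1 {a..b} \<epsilon>0 \<nu>" by (rule unif[OF fam]) (simp add: \<nu>_def)
    show "analytic_unif_gevrey1 {a..b} \<epsilon>0 T2"
      by (rule unif[OF gevrey_family_remainder2[OF fam]]) (simp_all add: T2_def G_def core_sector_def)
    show "analytic_unif_gevrey1 {a..b} \<epsilon>0 (\<lambda>t \<epsilon>. \<Phi> t \<epsilon> w $ i)" for w i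
    proof -
      have "i = 1 \<or> i = 2" by (rule exhaust_2)
      then show ?thesis
      proof
        assume "i = 1"
        then show ?thesis by (intro unif[OF const[of "w $ 1 + w $ 2"]]) (simp add: \<Phi>_def)
      next
        assume "i = 2"
        then show ?thesis
          by (intro unif[OF gevrey_family_add[OF cmul[OF fam, of "w $ 1"] cmul[OF fam_cnj, of "w $ 2"]]])
             (simp add: \<Phi>_def \<nu>_def mult.commute)
      qed
    qed
  next
    fix \<epsilon> assume \<epsilon>: "\<epsilon> \<in> {0..\<epsilon>0}"
    show "transforms_system \<mu> \<nu> {a..b} \<epsilon> \<Phi>"
    proof (rule transforms_system_riccati)
      show "\<Phi> t \<epsilon> w = vector [w $ 1 + w $ 2, \<nu> t \<epsilon> * w $ 1 + cnj (\<nu> t \<epsilon>) * w $ 2]" for t w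
        by (simp add: \<Phi>_def)
      fix t assume t: "t \<in> {a..b}"
      show "Im (\<nu> t \<epsilon>) \<noteq> 0" by (rule Im\<nu>[OF t \<epsilon>])
      obtain d where d: "((\<lambda>t. n t (of_real \<epsilon>)) has_field_derivative d) (at (of_real t))"
        "of_real \<epsilon> * d + (\<nu> t \<epsilon>)\<^sup>2 + M (of_real t) = 0"
        using ric[OF _ eZ[OF \<epsilon>], of "of_real t"] tD[OF t] by (auto simp: D_def \<nu>_def)
      show "\<exists>d. ((\<lambda>t. \<nu> t \<epsilon>) has_vector_derivative d) (at t) \<and>
                   of_real \<epsilon> * d + (\<nu> t \<epsilon>)\<^sup>2 + of_real (\<mu> t) = 0"
        using has_vector_derivative_real_field[OF d(1)] d(2) by (auto simp: \<nu>_def Mt[OF t])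
    qed
    fix t assume t: "t \<in> {a..b}"
    have ne: "\<nu> t \<epsilon> \<noteq> cnj (\<nu> t \<epsilon>)" using Im\<nu>[OF t \<epsilon>] by (auto simp: complex_eq_iff)
    have \<Phi>t: "\<Phi> t \<epsilon> w = vector [w $ 1 + w $ 2, \<nu> t \<epsilon> * w $ 1 + cnj (\<nu> t \<epsilon>) * w $ 2]" for w
      by (simp add: \<Phi>_def)
    show "Vector_Spaces.linear (*s) (*s) (\<Phi> t \<epsilon>)" "bij (\<Phi> t \<epsilon>)"
      by (rule linear_bij_eigenbasis[OF \<Phi>t ne])+
    show "\<nu> t \<epsilon> = lam \<mu> t * f t \<epsilon> - complex_of_real \<epsilon> * inverse (lam \<mu> t) * lam' \<mu> t"
      using lam0[OF t] by (simp add: f_def)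
    have s0: "s (of_real t) \<noteq> 0" using lam0[OF t] lam[OF t] by auto
    have "\<nu> t \<epsilon> = c 0 (of_real t) + c 1 (of_real t) * of_real \<epsilon> + of_real \<epsilon> ^ 2 * T2 t \<epsilon>"
      using n0[OF tD[OF t]] by (cases "\<epsilon> = 0") (simp_all add: \<nu>_def T2_def G_def)
    moreover have "c 0 (of_real t) = lam \<mu> t"
      using c0[of "of_real t"] tD[OF t] lam[OF t] by (simp add: s_def D_def)
    moreover have "c 1 (of_real t) = - (1 / 2 * inverse (lam \<mu> t) * lam' \<mu> t)"
    proof -
      have "csqrt (M (of_real t)) = s (of_real t)" by (simp only: s_def)
      then have "c 1 (of_real t) = - deriv s (of_real t) / (2 * s (of_real t))"
        using c1[of "of_real t"] tD[OF t] unfolding s_def[symmetric] D_def[symmetric] by simp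
      then show ?thesis
        using s0 unfolding lam'[OF t] lam[OF t] by (simp add: field_simps)
    qed
    ultimately show "\<nu> t \<epsilon> = lam \<mu> t - 1 / 2 * inverse (lam \<mu> t) * lam' \<mu> t * complex_of_real \<epsilon>
                        + complex_of_real \<epsilon> ^ 2 * T2 t \<epsilon>"
      by simp
  qed
qed

end
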